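(* Let $T$ be a complete first-order theory. If $T$ has the strong witnessing property, then $T$ is either $\mathrm{TP}_2$ or simple.
   Context: Work in a monster model $\mathbb{M}$. A global type $p$ is $M$-invariant if membership of $\varphi(x,b)$ depends only on $\mathrm{tp}(b/M)$; an invariant Morley sequence over $M$ in $p$ is $(b_i)_{i\in I}$ with $b_i\models p|_{Mb_{<i}}$. Kim-dividing order: for $M$-invariant global $p,q$ with common restriction $r$ to $M$, $p\geq q$ if for every $\varphi(x,b)$ with $b\models r$, if Morley sequences in $q$ starting with $b$ make $\{\varphi(x,b_i)\}$ inconsistent then so do Morley sequences in $p$. An $M$-invariant type is least if it is $\leq$ all $M$-invariant global types with the same restriction to $M$. Strong witnessing property: for every small $M\prec\mathbb{M}$ there is a global type $\mathbb{P}(\mathbb{X})$ extending $\mathrm{tp}(\mathbb{M}/M)$ (in variables $\mathbb{X}$ indexed by elements of $\mathbb{M}$) such that for every small subtuple $x\subseteq\mathbb{X}$, $\mathbb{P}(\mathbb{X})|_x$ is least in the Kim-dividing order among $M$-invariant global extensions of $(\mathbb{P}(\mathbb{X})|_x)|_M$. $T$ is simple iff dividing independence is symmetric, where $a$ does not divide from $b$ over $M$ if no $\varphi(x,b)\in\mathrm{tp}(a/Mb)$ has an $M$-indiscernible sequence $(b_i)$ starting with $b$ with $\{\varphi(x,b_i)\}$ inconsistent. $\mathrm{TP}_2$: there are $\varphi(x,y)$, $k\geq 2$, and an array $(b_{ij})_{i,j<\omega}$ such that each row $\{\varphi(x,b_{ij})\}_{j<\omega}$ is $k$-inconsistent and for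 every $\sigma:\omega\to\omega$, $\{\varphi(x,b_{i\sigma(i)})\}_{i<\omega}$ is consistent. *)

theory Defs
  imports Main
begin

unbundle cardinal_syntax

section \<open>First-order syntax and semantics\<close>

text \<open>
  A language is given by partial arity functions; its symbols are those on which they are defined.
  Free variables and parameters are names of type \<open>'v\<close>, bound variables are de Bruijn indices.
\<close>

record ('f, 'r) language =
  farity :: "'f \<Rightarrow> nat option"
  rarity :: "'r \<Rightarrow> nat option"

datatype (dead 'f, trm_names: 'v) trm =
    Var 'v
  | Bnd nat
  | Fn 'f "('f, 'v) trm list"

datatype (dead 'f, dead 'r, names: 'v) fm =
    Bot
  | Eq "('f, 'v) trm" "('f, 'v) trm"
  | Rel 'r "('f, 'v) trm list"
  | Imp "('f, 'r, 'v) fm" "('f, 'r, 'v) fm"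
  | All "('f, 'r, 'v) fm"

definition Neg :: "('f, 'r, 'v) fm \<Rightarrow> ('f, 'r, 'v) fm" where
  "Neg \<phi> = Imp \<phi> Bot"

text \<open>The number \<open>k\<close> counts the enclosing quantifiers.\<close>

primrec wf_trm :: "('f, 'r) language \<Rightarrow> nat \<Rightarrow> ('f, 'v) trm \<Rightarrow> bool" where
  "wf_trm L k (Var v) \<longleftrightarrow> True"
| "wf_trm L k (Bnd i) \<longleftrightarrow> i < k"
| "wf_trm L k (Fn f ts) \<longleftrightarrow> farity L f = Some (length ts) \<and> list_all (wf_trm L k) ts"

primrec wf_fm :: "('f, 'r) language \<Rightarrow> nat \<Rightarrow> ('f, 'r, 'v) fm \<Rightarrow> bool" where
  "wf_fm L k Bot \<longleftrightarrow> True"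
| "wf_fm L k (Eq s t) \<longleftrightarrow> wf_trm L k s \<and> wf_trm L k t"
| "wf_fm L k (Rel r ts) \<longleftrightarrow> rarity L r = Some (length ts) \<and> list_all (wf_trm L k) ts"
| "wf_fm L k (Imp \<phi> \<psi>) \<longleftrightarrow> wf_fm L k \<phi> \<and> wf_fm L k \<psi>"
| "wf_fm L k (All \<phi>) \<longleftrightarrow> wf_fm L (Suc k) \<phi>"

record ('f, 'r, 'm) struct =
  univ :: "'m set"
  fun_of :: "'f \<Rightarrow> 'm list \<Rightarrow> 'm"
  rel_of :: "'r \<Rightarrow> 'm list \<Rightarrow> bool"

definition is_struct :: "('f, 'r) language \<Rightarrow> ('f, 'r, 'm) struct \<Rightarrow> bool" where
  "is_struct L \<AA> \<longleftrightarrow> univ \<AA> \<noteq> {} \<and>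
     (\<forall>f xs. farity L f = Some (length xs) \<and> set xs \<subseteq> univ \<AA> \<longrightarrow> fun_of \<AA> f xs \<in> univ \<AA>)"

text \<open>The list \<open>s\<close> holds the values of the bound variables, innermost first.\<close>

primrec val :: "('f, 'r, 'm) struct \<Rightarrow> 'm list \<Rightarrow> ('v \<Rightarrow> 'm) \<Rightarrow> ('f, 'v) trm \<Rightarrow> 'm" where
  "val \<AA> s e (Var v) = e v"
| "val \<AA> s e (Bnd i) = s ! i"
| "val \<AA> s e (Fn f ts) = fun_of \<AA> f (map (val \<AA> s e) ts)"

primrec sat :: "('f, 'r, 'm) struct \<Rightarrow> 'm list \<Rightarrow> ('v \<Rightarrow> 'm) \<Rightarrow> ('f, 'r, 'v) fm \<Rightarrow> bool" where
  "sat \<AA> s e Bot \<longleftrightarrow> False"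
| "sat \<AA> s e (Eq t u) \<longleftrightarrow> val \<AA> s e t = val \<AA> s e u"
| "sat \<AA> s e (Rel r ts) \<longleftrightarrow> rel_of \<AA> r (map (val \<AA> s e) ts)"
| "sat \<AA> s e (Imp \<phi> \<psi>) \<longleftrightarrow> (sat \<AA> s e \<phi> \<longrightarrow> sat \<AA> s e \<psi>)"
| "sat \<AA> s e (All \<phi>) \<longleftrightarrow> (\<forall>a\<in>univ \<AA>. sat \<AA> (a # s) e \<phi>)"

definition holds :: "('f, 'r, 'm) struct \<Rightarrow> ('v \<Rightarrow> 'm) \<Rightarrow> ('f, 'r, 'v) fm \<Rightarrow> bool" where
  "holds \<AA> e \<phi> \<longleftrightarrow> sat \<AA> [] e \<phi>"

definition elem_sub ::
  "('f, 'r) language \<Rightarrow> 'm set \<Rightarrow> ('f, 'r, 'm) struct \<Rightarrow> bool" where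
  "elem_sub L M \<MM> \<longleftrightarrow> M \<subseteq> univ \<MM> \<and> is_struct L (\<MM>\<lparr>univ := M\<rparr>) \<and>
     (\<forall>\<phi>. wf_fm L 0 \<phi> \<and> names \<phi> \<subseteq> M \<longrightarrow>
        (holds (\<MM>\<lparr>univ := M\<rparr>) (\<lambda>m. m) \<phi> \<longleftrightarrow> holds \<MM> (\<lambda>m. m) \<phi>))"

definition automorphism ::
  "('f, 'r) language \<Rightarrow> ('f, 'r, 'm) struct \<Rightarrow> ('m \<Rightarrow> 'm) \<Rightarrow> bool" where
  "automorphism L \<MM> g \<longleftrightarrow> bij_betw g (univ \<MM>) (univ \<MM>) \<and>
     (\<forall>f xs. farity L f = Some (length xs) \<and> set xs \<subseteq> univ \<MM> \<longrightarrow>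
        g (fun_of \<MM> f xs) = fun_of \<MM> f (map g xs)) \<and>
     (\<forall>r xs. rarity L r = Some (length xs) \<and> set xs \<subseteq> univ \<MM> \<longrightarrow>
        (rel_of \<MM> r (map g xs) \<longleftrightarrow> rel_of \<MM> r xs))"


section \<open>Theories\<close>

definition sentence :: "('f, 'r) language \<Rightarrow> ('f, 'r, nat) fm \<Rightarrow> bool" where
  "sentence L \<phi> \<longleftrightarrow> wf_fm L 0 \<phi> \<and> names \<phi> = {}"

text \<open>The valuation is irrelevant for sentences.\<close>

definition is_model ::
  "('f, 'r) language \<Rightarrow> ('f, 'r, nat) fm set \<Rightarrow> ('f, 'r, 'm) struct \<Rightarrow> bool" where
  "is_model L T \<AA> \<longleftrightarrow> is_struct L \<AA> \<and> (\<forall>\<phi>\<in>T. holds \<AA> (\<lambda>_. undefined) \<phi>)"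

text \<open>
  A definition cannot quantify over the types that carry models. Since there are at least
  \<open>|L| + \<aleph>\<^sub>0\<close> formulas, by downward Loewenheim-Skolem every satisfiable set of sentences has a
  model whose universe is a set of formulas. Hence it suffices to consider such models, both for
  consequence and for satisfiability.
\<close>

definition entails ::
  "('f, 'r) language \<Rightarrow> ('f, 'r, nat) fm set \<Rightarrow> ('f, 'r, nat) fm \<Rightarrow> bool" where
  "entails L T \<phi> \<longleftrightarrow> (\<forall>\<AA> :: ('f, 'r, ('f, 'r, nat) fm) struct.
     is_model L T \<AA> \<longrightarrow> holds \<AA> (\<lambda>_. undefined) \<phi>)"

definition complete_theory ::
  "('f, 'r) language \<Rightarrow> ('f, 'r, nat) fm set \<Rightarrow> bool" where
  "complete_theory L T \<longleftrightarrow> (\<forall>\<phi>\<in>T. sentence L \<phi>) \<and> \<not> entails L T Bot \<and>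
     (\<forall>\<phi>. sentence L \<phi> \<longrightarrow> entails L T \<phi> \<or> entails L T (Neg \<phi>))"


section \<open>Formulas with parameters and types\<close>

text \<open>
  A formula with variables in \<open>V\<close> and parameters in \<open>A\<close> is a formula with names in the disjoint
  sum \<open>V <+> A\<close>. More generally, the right summand may contain further variables \<open>y\<close>, for which
  \<open>inst b\<close> substitutes parameters, turning \<open>\<phi>(x,y)\<close> into \<open>\<phi>(x,b)\<close>.
\<close>

definition fms ::
  "('f, 'r) language \<Rightarrow> 'v set \<Rightarrow> 'p set \<Rightarrow> ('f, 'r, 'v + 'p) fm set" where
  "fms L V A = {\<phi>. wf_fm L 0 \<phi> \<and> names \<phi> \<subseteq> V <+> A}"

definition inst :: "('p \<Rightarrow> 'm) \<Rightarrow> ('f, 'r, 'v + 'p) fm \<Rightarrow> ('f, 'r, 'v + 'm) fm" where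
  "inst b \<phi> = map_fm (map_sum (\<lambda>v. v) b) \<phi>"

text \<open>
  If \<open>\<phi>(x,y)\<close> has itself parameters from the model, then its names are in
  \<open>'x + ('y + 'm)\<close>, and \<open>inst_over b\<close> leaves those parameters unchanged.
\<close>

definition inst_over ::
  "('y \<Rightarrow> 'm) \<Rightarrow> ('f, 'r, 'x + ('y + 'm)) fm \<Rightarrow> ('f, 'r, 'x + 'm) fm" where
  "inst_over b \<phi> = inst (case_sum b (\<lambda>m. m)) \<phi>"

definition realizes ::
  "('f, 'r, 'm) struct \<Rightarrow> ('v \<Rightarrow> 'm) \<Rightarrow> ('f, 'r, 'v + 'm) fm set \<Rightarrow> bool" where
  "realizes \<MM> a p \<longleftrightarrow> (\<forall>\<phi>\<in>p. holds \<MM> (case_sum a (\<lambda>m. m)) \<phi>)"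

text \<open>Consistency with the elementary diagram, i.e. finite satisfiability.\<close>

definition consistent ::
  "('f, 'r, 'm) struct \<Rightarrow> ('f, 'r, 'v + 'm) fm set \<Rightarrow> bool" where
  "consistent \<MM> p \<longleftrightarrow>
     (\<forall>F \<subseteq> p. finite F \<longrightarrow> (\<exists>a. range a \<subseteq> univ \<MM> \<and> realizes \<MM> a F))"

text \<open>The type over \<open>A\<close> of the tuple \<open>(a v)\<^sub>v\<close> with index set \<open>V\<close>.\<close>

definition tp ::
  "('f, 'r) language \<Rightarrow> ('f, 'r, 'm) struct \<Rightarrow> 'v set \<Rightarrow> ('v \<Rightarrow> 'm) \<Rightarrow> 'm set
    \<Rightarrow> ('f, 'r, 'v + 'm) fm set" where
  "tp L \<MM> V a A = {\<phi> \<in> fms L V A. holds \<MM> (case_sum a (\<lambda>m. m)) \<phi>}"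

definition global_type ::
  "('f, 'r) language \<Rightarrow> ('f, 'r, 'm) struct \<Rightarrow> 'v set \<Rightarrow> ('f, 'r, 'v + 'm) fm set \<Rightarrow> bool" where
  "global_type L \<MM> V p \<longleftrightarrow> p \<subseteq> fms L V (univ \<MM>) \<and> consistent \<MM> p \<and>
     (\<forall>\<phi> \<in> fms L V (univ \<MM>). \<phi> \<in> p \<or> Neg \<phi> \<in> p)"


section \<open>Monster models\<close>

text \<open>
  A monster model is \<open>\<kappa>\<close>-saturated and strongly \<open>\<kappa>\<close>-homogeneous, where \<open>\<kappa>\<close> is a strong limit
  cardinal above \<open>|L| + \<aleph>\<^sub>0\<close>; small means of cardinality less than \<open>\<kappa>\<close>. Realizing types in one
  variable is enough for saturation.
\<close>

definition small :: "'k rel \<Rightarrow> 'a set \<Rightarrow> bool" where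
  "small \<kappa> A \<longleftrightarrow> |A| <o \<kappa>"

definition strong_limit :: "'k rel \<Rightarrow> bool" where
  "strong_limit \<kappa> \<longleftrightarrow> Card_order \<kappa> \<and> natLeq <o \<kappa> \<and>
     (\<forall>X \<subseteq> Field \<kappa>. small \<kappa> X \<longrightarrow> small \<kappa> (Pow X))"

definition saturated ::
  "('f, 'r) language \<Rightarrow> 'k rel \<Rightarrow> ('f, 'r, 'm) struct \<Rightarrow> bool" where
  "saturated L \<kappa> \<MM> \<longleftrightarrow>
     (\<forall>A p. A \<subseteq> univ \<MM> \<and> small \<kappa> A \<and> p \<subseteq> fms L (UNIV :: unit set) A \<and> consistent \<MM> p \<longrightarrow>
        (\<exists>a. range a \<subseteq> univ \<MM> \<and> realizes \<MM> a p))"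

definition strongly_homogeneous ::
  "('f, 'r) language \<Rightarrow> 'k rel \<Rightarrow> ('f, 'r, 'm) struct \<Rightarrow> bool" where
  "strongly_homogeneous L \<kappa> \<MM> \<longleftrightarrow>
     (\<forall>A h. A \<subseteq> univ \<MM> \<and> small \<kappa> A \<and> h ` A \<subseteq> univ \<MM> \<and>
        tp L \<MM> A h {} = tp L \<MM> A (\<lambda>m. m) {} \<longrightarrow>
        (\<exists>g. automorphism L \<MM> g \<and> (\<forall>a\<in>A. g a = h a)))"

definition monster_model ::
  "('f, 'r) language \<Rightarrow> ('f, 'r, nat) fm set \<Rightarrow> 'k rel \<Rightarrow> ('f, 'r, 'm) struct \<Rightarrow> bool" where
  "monster_model L T \<kappa> \<MM> \<longleftrightarrow> is_model L T \<MM> \<and> strong_limit \<kappa> \<and>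
     small \<kappa> (dom (farity L) <+> dom (rarity L)) \<and>
     saturated L \<kappa> \<MM> \<and> strongly_homogeneous L \<kappa> \<MM>"

definition small_model ::
  "('f, 'r) language \<Rightarrow> 'k rel \<Rightarrow> ('f, 'r, 'm) struct \<Rightarrow> 'm set \<Rightarrow> bool" where
  "small_model L \<kappa> \<MM> M \<longleftrightarrow> elem_sub L M \<MM> \<and> small \<kappa> M"


section \<open>Invariant types and the Kim-dividing order\<close>

definition invariant ::
  "('f, 'r) language \<Rightarrow> ('f, 'r, 'm) struct \<Rightarrow> 'm set \<Rightarrow> 'v set
    \<Rightarrow> ('f, 'r, 'v + 'm) fm set \<Rightarrow> bool" where
  "invariant L \<MM> M V p \<longleftrightarrow>
     (\<forall>n b b'. \<forall>\<phi> \<in> fms L V {..<n::nat}.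
        b ` {..<n} \<subseteq> univ \<MM> \<and> b' ` {..<n} \<subseteq> univ \<MM> \<and>
        tp L \<MM> {..<n} b M = tp L \<MM> {..<n} b' M \<longrightarrow>
        (inst b \<phi> \<in> p \<longleftrightarrow> inst b' \<phi> \<in> p))"

definition inv_type ::
  "('f, 'r) language \<Rightarrow> ('f, 'r, 'm) struct \<Rightarrow> 'm set \<Rightarrow> 'v set
    \<Rightarrow> ('f, 'r, 'v + 'm) fm set \<Rightarrow> bool" where
  "inv_type L \<MM> M V p \<longleftrightarrow> global_type L \<MM> V p \<and> invariant L \<MM> M V p"

definition morley_seq ::
  "('f, 'r) language \<Rightarrow> ('f, 'r, 'm) struct \<Rightarrow> 'm set \<Rightarrow> 'v set
    \<Rightarrow> ('f, 'r, 'v + 'm) fm set \<Rightarrow> ('i::linorder \<Rightarrow> 'v \<Rightarrow> 'm) \<Rightarrow> bool" where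
  "morley_seq L \<MM> M V p b \<longleftrightarrow>
     (\<forall>i. b i ` V \<subseteq> univ \<MM> \<and> realizes \<MM> (b i) (p \<inter> fms L V (M \<union> (\<Union>j\<in>{..<i}. b j ` V))))"

text \<open>
  \<open>\<phi>(x,b)\<close> divides along Morley sequences in \<open>p\<close>. If \<open>b\<close> realizes the restriction of \<open>p\<close> to \<open>M\<close>,
  then Morley sequences in \<open>p\<close> starting with \<open>b\<close> exist, and they all have the same type over \<open>M\<close>, so
  the universal quantifier may equivalently be read as an existential one.
\<close>

definition divides_along ::
  "('f, 'r) language \<Rightarrow> ('f, 'r, 'm) struct \<Rightarrow> 'm set \<Rightarrow> 'v set
    \<Rightarrow> ('f, 'r, 'v + 'm) fm set \<Rightarrow> ('f, 'r, nat + ('v + 'm)) fm \<Rightarrow> ('v \<Rightarrow> 'm) \<Rightarrow> bool" where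
  "divides_along L \<MM> M V p \<phi> b \<longleftrightarrow>
     (\<forall>c :: nat \<Rightarrow> 'v \<Rightarrow> 'm. morley_seq L \<MM> M V p c \<and> (\<forall>v\<in>V. c 0 v = b v) \<longrightarrow>
        \<not> consistent \<MM> (range (\<lambda>i. inst_over (c i) \<phi>)))"

text \<open>
  \<open>kim_ge \<dots> p q\<close> is \<open>p \<ge> q\<close>, for \<open>M\<close>-invariant \<open>p\<close> and \<open>q\<close> with the same restriction to \<open>M\<close>.
  As usual when working over \<open>M\<close>, the formula \<open>\<phi>(x,y)\<close> may have parameters in \<open>M\<close>.
\<close>

definition kim_ge ::
  "('f, 'r) language \<Rightarrow> ('f, 'r, 'm) struct \<Rightarrow> 'm set \<Rightarrow> 'v set
    \<Rightarrow> ('f, 'r, 'v + 'm) fm set \<Rightarrow> ('f, 'r, 'v + 'm) fm set \<Rightarrow> bool" where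
  "kim_ge L \<MM> M V p q \<longleftrightarrow>
     (\<forall>\<phi> b. \<phi> \<in> fms L UNIV (V <+> M) \<and> b ` V \<subseteq> univ \<MM> \<and> realizes \<MM> b (q \<inter> fms L V M) \<longrightarrow>
        divides_along L \<MM> M V q \<phi> b \<longrightarrow> divides_along L \<MM> M V p \<phi> b)"

definition least_type ::
  "('f, 'r) language \<Rightarrow> ('f, 'r, 'm) struct \<Rightarrow> 'm set \<Rightarrow> 'v set
    \<Rightarrow> ('f, 'r, 'v + 'm) fm set \<Rightarrow> bool" where
  "least_type L \<MM> M V p \<longleftrightarrow> inv_type L \<MM> M V p \<and>
     (\<forall>q. inv_type L \<MM> M V q \<and> q \<inter> fms L V M = p \<inter> fms L V M \<longrightarrow> kim_ge L \<MM> M V q p)"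

text \<open>
  The variable of \<open>P\<close> belonging to \<open>m \<in> univ \<MM>\<close> is the name \<open>Inl m\<close>, while \<open>Inr m\<close> is the
  parameter \<open>m\<close>.
\<close>

definition strong_witnessing ::
  "('f, 'r) language \<Rightarrow> 'k rel \<Rightarrow> ('f, 'r, 'm) struct \<Rightarrow> bool" where
  "strong_witnessing L \<kappa> \<MM> \<longleftrightarrow>
     (\<forall>M. small_model L \<kappa> \<MM> M \<longrightarrow>
        (\<exists>P. global_type L \<MM> (univ \<MM>) P \<and> tp L \<MM> (univ \<MM>) (\<lambda>m. m) M \<subseteq> P \<and>
           (\<forall>X \<subseteq> univ \<MM>. small \<kappa> X \<longrightarrow> least_type L \<MM> M X (P \<inter> fms L X (univ \<MM>)))))"


section \<open>Simplicity and the tree property of the second kind\<close>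

definition indiscernible ::
  "('f, 'r) language \<Rightarrow> ('f, 'r, 'm) struct \<Rightarrow> 'm set \<Rightarrow> 'v set \<Rightarrow> (nat \<Rightarrow> 'v \<Rightarrow> 'm) \<Rightarrow> bool" where
  "indiscernible L \<MM> M V b \<longleftrightarrow> (\<forall>i. b i ` V \<subseteq> univ \<MM>) \<and>
     (\<forall>n (i :: nat \<Rightarrow> nat) (j :: nat \<Rightarrow> nat).
        strict_mono_on {..<n} i \<and> strict_mono_on {..<n} j \<longrightarrow>
        tp L \<MM> ({..<n} \<times> V) (\<lambda>(k, v). b (i k) v) M = tp L \<MM> ({..<n} \<times> V) (\<lambda>(k, v). b (j k) v) M)"

text \<open>The tuple \<open>a\<close> is indexed by \<open>I\<close>, the tuple \<open>b\<close> by \<open>J\<close>.\<close>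

definition dividing_indep ::
  "('f, 'r) language \<Rightarrow> ('f, 'r, 'm) struct \<Rightarrow> 'm set \<Rightarrow> 'i set \<Rightarrow> ('i \<Rightarrow> 'm)
    \<Rightarrow> 'j set \<Rightarrow> ('j \<Rightarrow> 'm) \<Rightarrow> bool" where
  "dividing_indep L \<MM> M I a J b \<longleftrightarrow>
     \<not> (\<exists>\<phi> \<in> fms L I (J <+> M).
          inst_over b \<phi> \<in> tp L \<MM> I a (M \<union> b ` J) \<and>
          (\<exists>c. indiscernible L \<MM> M J c \<and> (\<forall>j\<in>J. c 0 j = b j) \<and>
             \<not> consistent \<MM> (range (\<lambda>i. inst_over (c i) \<phi>))))"

text \<open>Every small tuple can be indexed by a small set of elements of \<open>\<kappa>\<close>.\<close>

definition simple ::
  "('f, 'r) language \<Rightarrow> 'k rel \<Rightarrow> ('f, 'r, 'm) struct \<Rightarrow> bool" where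
  "simple L \<kappa> \<MM> \<longleftrightarrow>
     (\<forall>M (I :: 'k set) a (J :: 'k set) b.
        small_model L \<kappa> \<MM> M \<and> small \<kappa> I \<and> a ` I \<subseteq> univ \<MM> \<and> small \<kappa> J \<and> b ` J \<subseteq> univ \<MM> \<and>
        dividing_indep L \<MM> M I a J b \<longrightarrow> dividing_indep L \<MM> M J b I a)"

text \<open>
  The tuples \<open>x\<close>, \<open>y\<close> are indexed by \<open>nat\<close>; only the finitely many coordinates that occur in
  \<open>\<phi>\<close> matter.
\<close>

definition TP2 :: "('f, 'r) language \<Rightarrow> ('f, 'r, 'm) struct \<Rightarrow> bool" where
  "TP2 L \<MM> \<longleftrightarrow>
     (\<exists>(\<phi> :: ('f, 'r, nat + nat) fm) k (b :: nat \<Rightarrow> nat \<Rightarrow> nat \<Rightarrow> 'm).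
        \<phi> \<in> fms L UNIV UNIV \<and> k \<ge> 2 \<and> (\<forall>i j. range (b i j) \<subseteq> univ \<MM>) \<and>
        (\<forall>i J. card J = k \<longrightarrow> \<not> consistent \<MM> ((\<lambda>j. inst (b i j) \<phi>) ` J)) \<and>
        (\<forall>\<sigma> :: nat \<Rightarrow> nat. consistent \<MM> (range (\<lambda>i. inst (b i (\<sigma> i)) \<phi>))))"

end

theory Submission
  imports Defs "HOL-Library.Infinite_Set"
begin

text \<open>
  Suppose that \<open>T\<close> has the strong witnessing property and is not \<open>TP2\<close>. If \<open>R(x,b)\<close> divides over a
  model \<open>M\<close>, stretch a witnessing sequence so far that infinitely many members receive the same
  restriction \<open>p\<close> of the type \<open>P\<close>. A Morley sequence in the joint restriction is an array with
  inconsistent rows, all of whose paths are Morley sequences in \<open>p\<close>. As there is no \<open>TP2\<close>, \<open>R\<close> divides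
  along \<open>p\<close>, and since \<open>p\<close> is least, along every invariant type: Kim's lemma holds for all invariant
  types. Hence dividing independence has the extension property. If it failed to be symmetric, Kim's
  construction would give arbitrarily long dividing chains, hence a tree of dividing instances. Choosing
  siblings of the same type in a tree with large branching, one obtains a chain of models \<open>N n\<close> and
  tuples \<open>m n\<close> in \<open>N (n + 1)\<close> such that \<open>R(x, m n)\<close> divides over \<open>N n\<close> and all \<open>R(x, m n)\<close> are jointly
  consistent. The limit of the types of the \<open>m n\<close> is finitely satisfiable in the union \<open>N\<close>, so that
  \<open>R\<close> is consistent along its Morley sequences although it divides over \<open>N\<close>, against Kim's lemma.
\<close>

section \<open>Syntax and satisfaction\<close>

text \<open>Two obstacles shape the proof. The least type \<open>P\<close> can only be compared with
  invariant types in variables indexed by elements of the monster, and only if the restrictions to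
  the model agree. Hence tuples are presented as sets listed by themselves, \<open>self X\<close>,
  and agreement is obtained by relabelling along a conjugate of the tuple. The other obstacle is to
  obtain uniform sequences. An invariant type is coded by a subset of a small set, so there are few
  of them, and a sufficiently long sequence has an infinite subsequence to which \<open>P\<close>
  assigns one type; it inherits k-inconsistency. The same pigeonhole, for types over a small model,
  makes siblings in the tree conjugate. Where indiscernibility is wanted, a Morley sequence in an
  ultrafilter limit supplies it instead of a Ramsey argument. Extension uses that Kim's lemma makes
  finitely many dividing formulas inconsistent along one common sequence, so that a disjunction is
  refuted by counting. The union of models works as a base because it contains all
  \<open>m n\<close>, while each formula over it has its parameters in a single stage, so that
  dividing passes to the limit.\<close>

lemma val_cong:
  "(\<And>v. v \<in> trm_names t \<Longrightarrow> e v = e' v) \<Longrightarrow> val \<AA> s e t = val \<AA> s e' t"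
proof (induction t)
  case (Fn f ts)
  have "val \<AA> s e t = val \<AA> s e' t" if "t \<in> set ts" for t
    using that Fn.prems by (intro Fn.IH) auto
  then have "map (val \<AA> s e) ts = map (val \<AA> s e') ts" by simp
  then show ?case by (simp only: val.simps)
qed auto

lemma sat_cong:
  "(\<And>v. v \<in> names \<phi> \<Longrightarrow> e v = e' v) \<Longrightarrow> sat \<AA> s e \<phi> = sat \<AA> s e' \<phi>"
proof (induction \<phi> arbitrary: s)
  case (Eq t u)
  then show ?case using val_cong[of t e e' \<AA> s] val_cong[of u e e' \<AA> s] by auto
next
  case (Rel r ts)
  have "val \<AA> s e t = val \<AA> s e' t" if "t \<in> set ts" for t
    using that Rel.prems by (intro val_cong) auto
  then have "map (val \<AA> s e) ts = map (val \<AA> s e') ts" by simp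
  then show ?case by (simp only: sat.simps)
next
  case (Imp \<phi> \<psi>)
  then show ?case by (simp add: Imp.IH)
next
  case (All \<phi>)
  then show ?case by simp
qed simp

lemma val_map_trm: "val \<AA> s e (map_trm f t) = val \<AA> s (e \<circ> f) t"
  by (induction t) (auto intro!: arg_cong[where f = "fun_of \<AA> _"])

lemma sat_map_fm: "sat \<AA> s e (map_fm f \<phi>) = sat \<AA> s (e \<circ> f) \<phi>"
proof (induction \<phi> arbitrary: s)
  case (Rel r ts)
  have "map (val \<AA> s e \<circ> map_trm f) ts = map (val \<AA> s (e \<circ> f)) ts"
    by (simp add: val_map_trm)
  then show ?case by (simp only: fm.map sat.simps list.map_comp)
qed (auto simp: val_map_trm)

lemma holds_map_fm: "holds \<AA> e (map_fm f \<phi>) = holds \<AA> (e \<circ> f) \<phi>"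
  by (simp add: holds_def sat_map_fm)

lemma holds_cong:
  "(\<And>v. v \<in> names \<phi> \<Longrightarrow> e v = e' v) \<Longrightarrow> holds \<AA> e \<phi> = holds \<AA> e' \<phi>"
  unfolding holds_def by (rule sat_cong)

lemma wf_map_trm [simp]: "wf_trm L k (map_trm f t) = wf_trm L k t"
  by (induction t) (auto simp: list_all_iff)

lemma wf_map_fm [simp]: "wf_fm L k (map_fm f \<phi>) = wf_fm L k \<phi>"
  by (induction \<phi> arbitrary: k) (auto simp: list_all_iff)

lemma map_fm_cong_names:
  "(\<And>v. v \<in> names \<phi> \<Longrightarrow> f v = g v) \<Longrightarrow> map_fm f \<phi> = map_fm g \<phi>"
  by (rule fm.map_cong0)

section \<open>Binding a free variable\<close>

primrec abs_trm :: "'v \<Rightarrow> nat \<Rightarrow> ('f, 'v) trm \<Rightarrow> ('f, 'v) trm" where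
  "abs_trm v k (Var w) = (if w = v then Bnd k else Var w)"
| "abs_trm v k (Bnd i) = Bnd i"
| "abs_trm v k (Fn f ts) = Fn f (map (abs_trm v k) ts)"

primrec abs_fm :: "'v \<Rightarrow> nat \<Rightarrow> ('f, 'r, 'v) fm \<Rightarrow> ('f, 'r, 'v) fm" where
  "abs_fm v k Bot = Bot"
| "abs_fm v k (Eq s t) = Eq (abs_trm v k s) (abs_trm v k t)"
| "abs_fm v k (Rel r ts) = Rel r (map (abs_trm v k) ts)"
| "abs_fm v k (Imp \<phi> \<psi>) = Imp (abs_fm v k \<phi>) (abs_fm v k \<psi>)"
| "abs_fm v k (All \<phi>) = All (abs_fm v (Suc k) \<phi>)"

lemma wf_abs_trm: "wf_trm L k t \<Longrightarrow> wf_trm L (Suc k) (abs_trm v k t)"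
  by (induction t) (auto simp: list_all_iff)

lemma wf_abs_fm: "wf_fm L k \<phi> \<Longrightarrow> wf_fm L (Suc k) (abs_fm v k \<phi>)"
  by (induction \<phi> arbitrary: k) (auto simp: list_all_iff wf_abs_trm)

lemma names_abs_trm: "trm_names (abs_trm v k t) = trm_names t - {v}"
  by (induction t) auto

lemma names_abs_fm: "names (abs_fm v k \<phi>) = names \<phi> - {v}"
  by (induction \<phi> arbitrary: k) (auto simp: names_abs_trm)

lemma val_abs_trm:
  "wf_trm L (length s) t \<Longrightarrow> val \<AA> (s @ [x]) e (abs_trm v (length s) t) = val \<AA> s (e(v := x)) t"
  by (induction t)
    (auto simp: list_all_iff nth_append intro!: arg_cong[where f = "fun_of \<AA> _"])

text \<open>The quantifier that will be put in front encloses all others, so at depth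
  \<open>length s\<close> its index is \<open>length s\<close> and its value sits at the far end of
  the stack. Hence no other index has to be shifted.\<close>

lemma sat_abs_fm:
  "wf_fm L (length s) \<phi> \<Longrightarrow>
    sat \<AA> (s @ [x]) e (abs_fm v (length s) \<phi>) = sat \<AA> s (e(v := x)) \<phi>"
proof (induction \<phi> arbitrary: s)
  case (Eq t u)
  then show ?case using val_abs_trm[of L s t \<AA> x e v] val_abs_trm[of L s u \<AA> x e v]
    by (simp only: abs_fm.simps sat.simps wf_fm.simps)
next
  case (Rel r ts)
  then have "map (val \<AA> (s @ [x]) e \<circ> abs_trm v (length s)) ts = map (val \<AA> s (e(v := x))) ts"
    by (auto simp: list_all_iff val_abs_trm)
  then show ?case by (simp only: abs_fm.simps sat.simps list.map_comp)
next
  case (Imp \<phi> \<psi>)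
  then show ?case using Imp.IH(1)[of s] Imp.IH(2)[of s] by simp
next
  case (All \<phi>)
  have "sat \<AA> ((a # s) @ [x]) e (abs_fm v (length (a # s)) \<phi>) = sat \<AA> (a # s) (e(v := x)) \<phi>" for a
    by (rule All.IH) (use All.prems in simp)
  then show ?case by (simp only: abs_fm.simps sat.simps append_Cons list.size add_0_right add_Suc_right)
qed simp

section \<open>Automorphisms preserve satisfaction\<close>

lemma automorphism_val:
  assumes "automorphism L \<MM> g" "wf_trm L (length s) t" "set s \<subseteq> univ \<MM>" "range e \<subseteq> univ \<MM>"
    "is_struct L \<MM>"
  shows "val \<MM> (map g s) (\<lambda>v. g (e v)) t = g (val \<MM> s e t) \<and> val \<MM> s e t \<in> univ \<MM>"
  using assms(2)
proof (induction t)
  case (Fn f ts)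
  have *: "val \<MM> (map g s) (\<lambda>v. g (e v)) t = g (val \<MM> s e t) \<and> val \<MM> s e t \<in> univ \<MM>"
    if "t \<in> set ts" for t
    using Fn.IH[OF that] Fn.prems that by (simp add: list_all_iff)
  then have "map (val \<MM> (map g s) (\<lambda>v. g (e v))) ts = map g (map (val \<MM> s e) ts)"
    by auto
  moreover have "set (map (val \<MM> s e) ts) \<subseteq> univ \<MM>" using * by auto
  moreover have "farity L f = Some (length (map (val \<MM> s e) ts))" using Fn.prems by simp
  ultimately show ?case
    using assms(1,5) unfolding automorphism_def is_struct_def
    by (simp only: val.simps)
qed (use assms in \<open>auto simp: subset_iff\<close>)

lemma automorphism_sat:
  assumes g: "automorphism L \<MM> g" "is_struct L \<MM>" "range e \<subseteq> univ \<MM>"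
  shows "wf_fm L (length s) \<phi> \<Longrightarrow> set s \<subseteq> univ \<MM> \<Longrightarrow>
    sat \<MM> (map g s) (\<lambda>v. g (e v)) \<phi> = sat \<MM> s e \<phi>"
proof (induction \<phi> arbitrary: s)
  case (Eq t u)
  then have "val \<MM> (map g s) (\<lambda>v. g (e v)) t = g (val \<MM> s e t)" "val \<MM> s e t \<in> univ \<MM>"
    "val \<MM> (map g s) (\<lambda>v. g (e v)) u = g (val \<MM> s e u)" "val \<MM> s e u \<in> univ \<MM>"
    using automorphism_val[OF g(1) _ _ g(3,2)] by auto
  then show ?case using g(1) by (auto simp: automorphism_def bij_betw_def inj_on_def)
next
  case (Rel r ts)
  have *: "val \<MM> (map g s) (\<lambda>v. g (e v)) t = g (val \<MM> s e t) \<and> val \<MM> s e t \<in> univ \<MM>"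
    if "t \<in> set ts" for t
    using automorphism_val[OF g(1) _ _ g(3,2)] Rel that by (auto simp: list_all_iff)
  then have "map (val \<MM> (map g s) (\<lambda>v. g (e v))) ts = map g (map (val \<MM> s e) ts)"
    by auto
  moreover have "set (map (val \<MM> s e) ts) \<subseteq> univ \<MM>" using * by auto
  moreover have "rarity L r = Some (length (map (val \<MM> s e) ts))" using Rel.prems by simp
  ultimately show ?case
    using g(1) unfolding automorphism_def
    by (simp only: sat.simps)
next
  case (Imp \<phi> \<psi>)
  then show ?case using Imp.IH(1)[of s] Imp.IH(2)[of s] by simp
next
  case (All \<phi>)
  have *: "sat \<MM> (map g (a # s)) (\<lambda>v. g (e v)) \<phi> = sat \<MM> (a # s) e \<phi>" if "a \<in> univ \<MM>" for a
    by (rule All.IH) (use All.prems that in auto)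
  \<comment> \<open>Surjectivity lets the universal quantifier range over the images
    \<open>g a\<close>.\<close>
  have "g ` univ \<MM> = univ \<MM>" using g(1) by (simp add: automorphism_def bij_betw_def)
  then have "(\<forall>a\<in>univ \<MM>. sat \<MM> (a # map g s) (\<lambda>v. g (e v)) \<phi>) =
      (\<forall>a\<in>univ \<MM>. sat \<MM> (g a # map g s) (\<lambda>v. g (e v)) \<phi>)"
    by (metis (no_types, lifting) image_iff)
  then show ?case using * by auto
qed simp

section \<open>Definable predicates on tuples\<close>

text \<open>
  Formulas are replaced by the predicates that they define on total tuples with values in the
  universe, so that quantification, renaming and instantiation become operations on functions.
\<close>

locale fo_struct =
  fixes L :: "('f, 'r) language" and \<MM> :: "('f, 'r, 'm) struct"
  assumes is_struct: "is_struct L \<MM>"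
begin

abbreviation U :: "'m set" where "U \<equiv> univ \<MM>"

abbreviation holds_at :: "('v \<Rightarrow> 'm) \<Rightarrow> ('f, 'r, 'v + 'm) fm \<Rightarrow> bool" where
  "holds_at a \<phi> \<equiv> holds \<MM> (case_sum a (\<lambda>m. m)) \<phi>"

definition tup :: "('v \<Rightarrow> 'm) \<Rightarrow> bool" where
  "tup a \<longleftrightarrow> range a \<subseteq> U"

text \<open>Agreement is required only at tuples with values in the universe, since only there do
  quantifiers and automorphisms control satisfaction. The defining formula is kept as a witness
  because types are sets of formulas, while constructions are carried out on predicates.\<close>

definition rep :: "'v set \<Rightarrow> 'm set \<Rightarrow> ('f, 'r, 'v + 'm) fm \<Rightarrow> (('v \<Rightarrow> 'm) \<Rightarrow> bool) \<Rightarrow> bool" where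
  "rep V A \<phi> R \<longleftrightarrow> \<phi> \<in> fms L V A \<and>
    (\<forall>a. tup a \<longrightarrow> (R a \<longleftrightarrow> holds_at a \<phi>))"

definition defn :: "'v set \<Rightarrow> 'm set \<Rightarrow> (('v \<Rightarrow> 'm) \<Rightarrow> bool) \<Rightarrow> bool" where
  "defn V A R \<longleftrightarrow> (\<exists>\<phi>. rep V A \<phi> R)"

definition defn2 :: "'v set \<Rightarrow> 'w set \<Rightarrow> 'm set \<Rightarrow> (('v \<Rightarrow> 'm) \<Rightarrow> ('w \<Rightarrow> 'm) \<Rightarrow> bool) \<Rightarrow> bool" where
  "defn2 V W A R \<longleftrightarrow> defn (V <+> W) A (\<lambda>e. R (\<lambda>v. e (Inl v)) (\<lambda>w. e (Inr w)))"

definition pt :: 'm where "pt = (SOME u. u \<in> U)"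

lemma pt_in [simp]: "pt \<in> U"
  unfolding pt_def using is_struct by (meson ex_in_conv is_struct_def someI_ex)

text \<open>Coordinates outside \<open>V\<close> receive the default value \<open>pt\<close>, so
  that every tuple is a total function into the universe; a predicate definable with variables in
  \<open>V\<close> does not see the default.\<close>

definition tot :: "'v set \<Rightarrow> ('v \<Rightarrow> 'm) \<Rightarrow> 'v \<Rightarrow> 'm" where
  "tot V a = (\<lambda>v. if v \<in> V then a v else pt)"

text \<open>A set listed by its own elements, the indexing in which strong witnessing supplies its
  types.\<close>

abbreviation self :: "'m set \<Rightarrow> 'm \<Rightarrow> 'm" where
  "self Z \<equiv> tot Z (\<lambda>m. m)"

abbreviation joint :: "(('v \<Rightarrow> 'm) \<Rightarrow> ('w \<Rightarrow> 'm) \<Rightarrow> bool) \<Rightarrow> 'l set \<Rightarrow> ('l \<Rightarrow> 'w \<Rightarrow> 'm) \<Rightarrow> bool" where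
  "joint R K c \<equiv> \<exists>x. tup x \<and> (\<forall>l\<in>K. R x (c l))"

lemma tup_tot: "a ` V \<subseteq> U \<Longrightarrow> tup (tot V a)"
  by (auto simp: tup_def tot_def)

lemma tot_in [simp]: "v \<in> V \<Longrightarrow> tot V a v = a v"
  by (simp add: tot_def)

lemma tup_in [simp, intro]: "tup a \<Longrightarrow> a v \<in> U"
  by (auto simp: tup_def)

lemma tupI: "(\<And>v. a v \<in> U) \<Longrightarrow> tup a"
  by (auto simp: tup_def)

lemma tup_pt [simp]: "tup (\<lambda>_. pt)"
  by (simp add: tup_def)

lemma tup_image: "tup a \<Longrightarrow> a ` V \<subseteq> U"
  by auto

lemma sum_eta: "case_sum (\<lambda>v. e (Inl v)) (\<lambda>w. e (Inr w)) = e"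
  by (auto simp: fun_eq_iff split: sum.split)

lemma fms_mono: "V \<subseteq> V' \<Longrightarrow> A \<subseteq> A' \<Longrightarrow> fms L V A \<subseteq> fms L V' A'"
  unfolding fms_def by blast

lemma holds_fms_cong:
  assumes "\<phi> \<in> fms L V A" "\<And>v. v \<in> V \<Longrightarrow> a v = b v"
  shows "holds_at a \<phi> = holds_at b \<phi>"
  by (rule holds_cong) (use assms in \<open>auto simp: fms_def split: sum.split\<close>)

lemma repD: "rep V A \<phi> R \<Longrightarrow> tup a \<Longrightarrow> R a = holds_at a \<phi>"
  unfolding rep_def by blast

lemma rep_fms: "rep V A \<phi> R \<Longrightarrow> \<phi> \<in> fms L V A"
  unfolding rep_def by blast

lemma rep_cong: "rep V A \<phi> R \<Longrightarrow> (\<And>a. tup a \<Longrightarrow> R a = R' a) \<Longrightarrow> rep V A \<phi> R'"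
  unfolding rep_def by simp

lemma defn_cong: "defn V A R \<Longrightarrow> (\<And>a. tup a \<Longrightarrow> R a = R' a) \<Longrightarrow> defn V A R'"
  unfolding defn_def using rep_cong by blast

lemma defn_local:
  assumes "defn V A R" "tup a" "tup b" "\<And>v. v \<in> V \<Longrightarrow> a v = b v"
  shows "R a = R b"
proof -
  obtain \<phi> where \<phi>: "rep V A \<phi> R" using assms(1) defn_def by blast
  then have "holds_at a \<phi> = holds_at b \<phi>"
    using assms(4) by (intro holds_fms_cong[of \<phi> V A]) (auto simp: rep_def)
  then show ?thesis using \<phi> assms(2,3) by (simp add: rep_def)
qed

lemma defn_mono: "defn V A R \<Longrightarrow> V \<subseteq> V' \<Longrightarrow> A \<subseteq> A' \<Longrightarrow> defn V' A' R"
  unfolding defn_def rep_def using fms_mono[of V V' A A'] by (elim exE) (intro exI, auto)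

lemma defn_holdsI:
  assumes "\<phi> \<in> fms L V A" "\<And>a. tup a \<Longrightarrow> R a = holds_at a \<phi>"
  shows "defn V A R"
  unfolding defn_def rep_def using assms by (intro exI[of _ \<phi>]) simp

lemma defnI: "\<phi> \<in> fms L V A \<Longrightarrow> defn V A (\<lambda>a. holds_at a \<phi>)"
  unfolding defn_def rep_def by blast

lemma defn_False: "defn V A (\<lambda>a. False)"
  using defnI[of Bot V A] by (simp add: fms_def holds_def)

lemma rep_imp:
  "rep V A \<phi> R \<Longrightarrow> rep V A \<psi> S \<Longrightarrow> rep V A (Imp \<phi> \<psi>) (\<lambda>a. R a \<longrightarrow> S a)"
  unfolding rep_def by (auto simp: fms_def holds_def)

lemma rep_not: "rep V A \<phi> R \<Longrightarrow> rep V A (Neg \<phi>) (\<lambda>a. \<not> R a)"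
  unfolding rep_def by (auto simp: fms_def holds_def Neg_def)

lemma defn_imp: "defn V A R \<Longrightarrow> defn V A S \<Longrightarrow> defn V A (\<lambda>a. R a \<longrightarrow> S a)"
  unfolding defn_def using rep_imp by blast

lemma defn_not: "defn V A R \<Longrightarrow> defn V A (\<lambda>a. \<not> R a)"
  unfolding defn_def using rep_not by blast

lemma defn_True: "defn V A (\<lambda>a. True)"
  using defn_not[OF defn_False] by simp

lemma defn_conj: "defn V A R \<Longrightarrow> defn V A S \<Longrightarrow> defn V A (\<lambda>a. R a \<and> S a)"
  using defn_not[OF defn_imp[OF _ defn_not[of V A S], of R]] by simp

lemma defn_ball:
  "finite K \<Longrightarrow> (\<And>k. k \<in> K \<Longrightarrow> defn V A (R k)) \<Longrightarrow> defn V A (\<lambda>a. \<forall>k\<in>K. R k a)"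
proof (induction K rule: finite_induct)
  case empty
  then show ?case using defn_True by simp
next
  case (insert k K)
  then have "defn V A (\<lambda>a. R k a \<and> (\<forall>k\<in>K. R k a))" by (intro defn_conj) auto
  then show ?case by simp
qed

text \<open>One rule covers renaming and identifying variables, enlarging the variable set and
  plugging in parameters. Each relevant coordinate is either a variable of the new tuple or a
  constant from \<open>A'\<close>; both are names, so the substitution is a map on the names of the
  formula.\<close>

lemma defn_subst:
  assumes R: "defn V A R" and A: "A \<subseteq> A'"
    and t: "\<And>v. v \<in> V \<Longrightarrow> (\<exists>w\<in>V'. \<forall>a. tup a \<longrightarrow> t v a = a w) \<or> (\<exists>m\<in>A'. \<forall>a. tup a \<longrightarrow> t v a = m)"
    and tU: "\<And>v a. tup a \<Longrightarrow> t v a \<in> U"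
  shows "defn V' A' (\<lambda>a. R (\<lambda>v. t v a))"
proof -
  obtain \<phi> where \<phi>: "rep V A \<phi> R" using R defn_def by blast
  define P where "P v n = (case n of Inl w \<Rightarrow> w \<in> V' \<and> (\<forall>a. tup a \<longrightarrow> t v a = a w)
      | Inr m \<Rightarrow> m \<in> A' \<and> (\<forall>a. tup a \<longrightarrow> t v a = m))" for v n
  have "\<exists>n. P v n" if v: "v \<in> V" for v
    using t[OF v]
  proof (elim disjE bexE)
    fix w assume "w \<in> V'" "\<forall>a. tup a \<longrightarrow> t v a = a w"
    then show ?thesis by (intro exI[of _ "Inl w"]) (simp add: P_def)
  next
    fix m assume "m \<in> A'" "\<forall>a. tup a \<longrightarrow> t v a = m"
    then show ?thesis by (intro exI[of _ "Inr m"]) (simp add: P_def)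
  qed
  then have "\<forall>v\<in>V. \<exists>n. P v n" by blast
  from bchoice[OF this] obtain s where s: "\<forall>v\<in>V. P v (s v)" by blast
  define h where "h = case_sum s Inr"
  have "map_fm h \<phi> \<in> fms L V' A'"
  proof -
    have "h n \<in> V' <+> A'" if "n \<in> names \<phi>" for n
    proof (cases n)
      case (Inl v)
      then have "v \<in> V" using that \<phi> by (auto simp: rep_def fms_def)
      then have "P v (s v)" using s by blast
      then show ?thesis using Inl by (cases "s v") (auto simp: h_def P_def)
    next
      case (Inr m)
      then show ?thesis using that \<phi> A by (auto simp: rep_def fms_def h_def)
    qed
    then show ?thesis using \<phi> by (auto simp: rep_def fms_def fm.set_map)
  qed
  moreover have "R (\<lambda>v. t v a) = holds_at a (map_fm h \<phi>)" if a: "tup a" for a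
  proof -
    have "R (\<lambda>v. t v a) = holds_at (\<lambda>v. t v a) \<phi>"
    proof -
      have "tup (\<lambda>v. t v a)" by (intro tupI tU a)
      then show ?thesis using \<phi> unfolding rep_def by blast
    qed
    also have "\<dots> = holds \<MM> (case_sum a (\<lambda>m. m) \<circ> h) \<phi>"
    proof (rule holds_cong)
      fix n assume n: "n \<in> names \<phi>"
      show "case_sum (\<lambda>v. t v a) (\<lambda>m. m) n = (case_sum a (\<lambda>m. m) \<circ> h) n"
      proof (cases n)
        case (Inl v)
        then have "v \<in> V" using n \<phi> by (auto simp: rep_def fms_def)
        then have "P v (s v)" using s by blast
        then show ?thesis using Inl a by (cases "s v") (auto simp: h_def P_def)
      qed (simp add: h_def)
    qed
    finally show ?thesis by (simp add: holds_map_fm)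
  qed
  ultimately show ?thesis by (rule defn_holdsI)
qed

text \<open>A formula has finitely many names. This finiteness feeds the unions of chains and the
  quantification over infinite tuples below.\<close>

lemma defn_finite:
  assumes "defn V A R"
  obtains V0 A0 where "finite V0" "V0 \<subseteq> V" "finite A0" "A0 \<subseteq> A" "defn V0 A0 R"
proof -
  obtain \<phi> where \<phi>: "rep V A \<phi> R" using assms defn_def by blast
  let ?V = "Inl -` names \<phi>" and ?A = "Inr -` names \<phi>"
  have "finite ?V" "finite ?A" by (simp_all add: finite_vimageI)
  moreover have "?V \<subseteq> V" "?A \<subseteq> A" using \<phi> by (auto simp: rep_def fms_def)
  moreover have "names \<phi> \<subseteq> ?V <+> ?A"
  proof
    fix x assume "x \<in> names \<phi>" then show "x \<in> ?V <+> ?A" by (cases x rule: sum.exhaust) auto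
  qed
  then have "\<phi> \<in> fms L ?V ?A" using \<phi> by (auto simp: rep_def fms_def)
  then have "defn ?V ?A R" using \<phi> unfolding rep_def defn_def by blast
  ultimately show ?thesis using that by blast
qed

lemma defn_ex1:
  assumes "defn (insert v V) A R"
  shows "defn V A (\<lambda>a. \<exists>u\<in>U. R (a(v := u)))"
proof -
  obtain \<phi> where \<phi>: "rep (insert v V) A \<phi> R" using assms defn_def by blast
  let ?\<psi> = "Neg (All (Neg (abs_fm (Inl v) 0 \<phi>)))"
  have "wf_fm L 1 (abs_fm (Inl v) 0 \<phi>)" using \<phi> wf_abs_fm[of L 0] by (auto simp: rep_def fms_def)
  then have "?\<psi> \<in> fms L V A" using \<phi> by (auto simp: rep_def fms_def names_abs_fm Neg_def)
  moreover have "(\<exists>u\<in>U. R (a(v := u))) = holds_at a ?\<psi>" if a: "tup a" for a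
  proof -
    have "R (a(v := u)) = sat \<MM> [u] (case_sum a (\<lambda>m. m)) (abs_fm (Inl v) 0 \<phi>)" if u: "u \<in> U" for u
    proof -
      have "tup (a(v := u))" using a u by (auto simp: tup_def)
      then have "R (a(v := u)) = sat \<MM> [] (case_sum (a(v := u)) (\<lambda>m. m)) \<phi>"
        using \<phi> unfolding rep_def holds_def by blast
      also have "case_sum (a(v := u)) (\<lambda>m. m) = (case_sum a (\<lambda>m. m))(Inl v := u)"
        by (auto simp: fun_eq_iff split: sum.split)
      also have "sat \<MM> [] \<dots> \<phi> = sat \<MM> ([] @ [u]) (case_sum a (\<lambda>m. m)) (abs_fm (Inl v) (length ([] :: 'm list)) \<phi>)"
        by (rule sat_abs_fm[symmetric, where L = L]) (use \<phi> in \<open>auto simp: rep_def fms_def\<close>)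
      finally show ?thesis by (simp only: append_Nil list.size)
    qed
    then show ?thesis by (simp add: holds_def Neg_def)
  qed
  ultimately show ?thesis by (rule defn_holdsI)
qed

lemma defn_eq: "v \<in> V \<Longrightarrow> w \<in> V \<Longrightarrow> defn V A (\<lambda>a. a v = a w)"
  using defnI[of "Eq (Var (Inl v)) (Var (Inl w))" V A] by (auto simp: fms_def holds_def)

lemma defn_eq_param: "v \<in> V \<Longrightarrow> m \<in> A \<Longrightarrow> defn V A (\<lambda>a. a v = m)"
  using defnI[of "Eq (Var (Inl v)) (Var (Inr m))" V A] by (auto simp: fms_def holds_def)

section \<open>Predicates of two tuples\<close>

lemma defn2_local:
  assumes "defn2 V W A R" "tup a" "tup b" "tup a'" "tup b'"
    "\<And>v. v \<in> V \<Longrightarrow> a v = a' v" "\<And>v. v \<in> W \<Longrightarrow> b v = b' v"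
  shows "R a b = R a' b'"
proof -
  have "tup (case_sum a b)" "tup (case_sum a' b')"
    using assms(2-5) by (auto intro!: tupI split: sum.split)
  moreover have "case_sum a b n = case_sum a' b' n" if "n \<in> V <+> W" for n
    using that assms(6,7) by auto
  ultimately have "(\<lambda>e. R (\<lambda>v. e (Inl v)) (\<lambda>w. e (Inr w))) (case_sum a b)
      = (\<lambda>e. R (\<lambda>v. e (Inl v)) (\<lambda>w. e (Inr w))) (case_sum a' b')"
    by (rule defn_local[OF assms(1)[unfolded defn2_def]])
  then show ?thesis by simp
qed

lemma defn2_mono: "defn2 V W A R \<Longrightarrow> V \<subseteq> V' \<Longrightarrow> W \<subseteq> W' \<Longrightarrow> A \<subseteq> A' \<Longrightarrow> defn2 V' W' A' R"
  unfolding defn2_def by (erule defn_mono) auto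

lemma defn2_swap: "defn2 V W A R \<Longrightarrow> defn2 W V A (\<lambda>x y. R y x)"
  unfolding defn2_def
  by (drule defn_subst[where V' = "W <+> V" and A' = A and
        t = "\<lambda>v e. e (case v of Inl x \<Rightarrow> Inr x | Inr x \<Rightarrow> Inl x)"]) auto

lemma defn2_fix:
  assumes "defn2 V W A R" "tup d" "A \<union> d ` W \<subseteq> A'"
  shows "defn V A' (\<lambda>x. R x d)"
proof -
  have "defn V A' (\<lambda>x. (\<lambda>e. R (\<lambda>v. e (Inl v)) (\<lambda>w. e (Inr w)))
      (\<lambda>n. (\<lambda>n x. case n of Inl v \<Rightarrow> x v | Inr w \<Rightarrow> d w) n x))"
    by (rule defn_subst[OF assms(1)[unfolded defn2_def]])
      (use assms(2,3) in \<open>auto split: sum.split\<close>)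
  then show ?thesis by simp
qed

text \<open>A converse of \<open>defn2_fix\<close>: parameters listed by \<open>d\<close> are turned
  back into variables. A parameter may occur at several places of \<open>d\<close>, so one index is
  chosen for it; parameters in \<open>A\<close> stay as they are.\<close>

lemma defn_params:
  fixes R :: "('v \<Rightarrow> 'm) \<Rightarrow> bool" and d :: "'w \<Rightarrow> 'm"
  assumes R: "defn V (A \<union> d ` W) R" and d: "tup d"
  obtains R' where "defn2 V W A R'" "\<And>x. tup x \<Longrightarrow> R' x d = R x"
proof -
  obtain \<phi> where \<phi>: "rep V (A \<union> d ` W) \<phi> R" using R defn_def by blast
  define h :: "'v + 'm \<Rightarrow> ('v + 'w) + 'm" where "h = case_sum (\<lambda>v. Inl (Inl v))
    (\<lambda>m. if m \<in> A then Inr m else Inl (Inr (SOME w. w \<in> W \<and> d w = m)))"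
  have some: "(SOME w. w \<in> W \<and> d w = m) \<in> W \<and> d (SOME w. w \<in> W \<and> d w = m) = m"
    if "m \<in> d ` W" for m
    using someI_ex[of "\<lambda>w. w \<in> W \<and> d w = m"] that by blast
  define R' where "R' x y = holds_at (case_sum x y) (map_fm h \<phi>)" for x y
  have "h n \<in> (V <+> W) <+> A" if "n \<in> names \<phi>" for n
    using that \<phi> some by (cases n rule: sum.exhaust) (auto simp: h_def rep_def fms_def)
  then have "map_fm h \<phi> \<in> fms L (V <+> W) A"
    using \<phi> by (auto simp: rep_def fms_def fm.set_map)
  from defnI[OF this] have "defn2 V W A R'"
    by (simp add: defn2_def R'_def sum_eta)
  moreover have "R' x d = R x" if x: "tup x" for x
  proof -
    have "R' x d = holds \<MM> (case_sum (case_sum x d) (\<lambda>m. m) \<circ> h) \<phi>"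
      by (simp add: R'_def holds_map_fm)
    also have "\<dots> = holds_at x \<phi>"
      by (rule holds_cong)
        (use \<phi> some in \<open>auto simp: h_def rep_def fms_def split: sum.split\<close>)
    finally show ?thesis using \<phi> x by (simp add: rep_def)
  qed
  ultimately show ?thesis using that by blast
qed

text \<open>The quantified tuple may be infinite, but only finitely many of its coordinates occur,
  and these are quantified away one at a time. When none is left, locality makes all values of
  \<open>x\<close> equivalent to the default tuple.\<close>

lemma defn2_ex:
  fixes R :: "('v \<Rightarrow> 'm) \<Rightarrow> ('w \<Rightarrow> 'm) \<Rightarrow> bool"
  assumes "defn2 V W A R"
  shows "defn W A (\<lambda>y. \<exists>x. tup x \<and> R x y)"
proof -
  obtain X A0 where X: "finite X" "X \<subseteq> V <+> W" "finite A0" "A0 \<subseteq> A"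
    "defn X A0 (\<lambda>e. R (\<lambda>v. e (Inl v)) (\<lambda>w. e (Inr w)))"
    by (rule defn_finite[OF assms[unfolded defn2_def]])
  have V0: "finite (Inl -` X)" using X(1) by (simp add: finite_vimageI)
  have "X \<subseteq> (Inl -` X) <+> W"
  proof
    fix x assume "x \<in> X" then show "x \<in> (Inl -` X) <+> W" using X(2) by (cases x rule: sum.exhaust) auto
  qed
  then have R: "defn2 (Inl -` X) W A R" unfolding defn2_def by (rule defn_mono[OF X(5)]) (rule X(4))
  have "defn W A (\<lambda>y. \<exists>x. tup x \<and> R x y)" if "finite V0" "defn2 V0 W A R"
    for V0 and R :: "('v \<Rightarrow> 'm) \<Rightarrow> ('w \<Rightarrow> 'm) \<Rightarrow> bool"
    using that
  proof (induction V0 arbitrary: R rule: finite_induct)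
    case empty
    have "defn W A (\<lambda>y. R (\<lambda>_. pt) y)"
      by (rule defn2_fix[OF defn2_swap[OF empty]]) auto
    then show ?case
    proof (rule defn_cong)
      fix y :: "'w \<Rightarrow> 'm" assume y: "tup y"
      have "R x y = R (\<lambda>_. pt) y" if "tup x" for x
        by (rule defn2_local[OF empty]) (use y that in auto)
      then show "R (\<lambda>_. pt) y = (\<exists>x. tup x \<and> R x y)" using tup_pt by blast
    qed
  next
    case (insert v V0)
    let ?R = "\<lambda>x y. \<exists>u\<in>U. R (x(v := u)) y"
    have "defn (insert (Inl v) (V0 <+> W)) A (\<lambda>e. R (\<lambda>v. e (Inl v)) (\<lambda>w. e (Inr w)))"
      using insert.prems unfolding defn2_def by (rule defn_mono) auto
    from defn_ex1[OF this] have "defn2 V0 W A ?R"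
      by (simp add: defn2_def fun_upd_def)
    from insert.IH[OF this] show ?case
    proof (rule defn_cong)
      fix y :: "'w \<Rightarrow> 'm" assume y: "tup y"
      show "(\<exists>x. tup x \<and> ?R x y) = (\<exists>x. tup x \<and> R x y)"
      proof
        assume "\<exists>x. tup x \<and> ?R x y"
        then obtain x u where "tup x" "u \<in> U" "R (x(v := u)) y" by blast
        moreover from this have "tup (x(v := u))" by (auto simp: tup_def)
        ultimately show "\<exists>x. tup x \<and> R x y" by blast
      next
        assume "\<exists>x. tup x \<and> R x y"
        then obtain x where "tup x" "R x y" by blast
        moreover from this have "x v \<in> U" "R (x(v := x v)) y" by auto
        ultimately show "\<exists>x. tup x \<and> ?R x y" by blast
      qed
    qed
  qed
  from this[OF V0 R] show ?thesis .
qed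

text \<open>Solvability of finitely many instances at once is first order, and therefore moves along
  equality of types. The terms \<open>t l w\<close> allow the tuples of the instances to be
  assembled from any coordinates of \<open>e\<close> and parameters.\<close>

lemma defn_joint:
  fixes R :: "('v \<Rightarrow> 'm) \<Rightarrow> ('w \<Rightarrow> 'm) \<Rightarrow> bool" and t :: "'l \<Rightarrow> 'w \<Rightarrow> ('z \<Rightarrow> 'm) \<Rightarrow> 'm"
  assumes R: "defn2 V W A R" and K: "finite K"
    and t: "\<And>l w. l \<in> K \<Longrightarrow> w \<in> W \<Longrightarrow>
      (\<exists>z\<in>Z. \<forall>a. tup a \<longrightarrow> t l w a = a z) \<or> (\<exists>m\<in>A'. \<forall>a. tup a \<longrightarrow> t l w a = m)"
    and tU: "\<And>l w a. tup a \<Longrightarrow> t l w a \<in> U" and A: "A \<subseteq> A'"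
  shows "defn Z A' (\<lambda>e. joint R K (\<lambda>l w. t l w e))"
proof (rule defn2_ex[where V = V], unfold defn2_def, rule defn_ball[OF K])
  fix l assume l: "l \<in> K"
  have "defn (V <+> Z) A' (\<lambda>e. (\<lambda>e. R (\<lambda>v. e (Inl v)) (\<lambda>w. e (Inr w)))
     (\<lambda>n. (\<lambda>n e. case n of Inl v \<Rightarrow> e (Inl v) | Inr w \<Rightarrow> t l w (\<lambda>z. e (Inr z))) n e))"
  proof (rule defn_subst[OF R[unfolded defn2_def] A])
    fix n assume n: "n \<in> V <+> W"
    show "(\<exists>w\<in>V <+> Z. \<forall>a. tup a \<longrightarrow> (case n of Inl v \<Rightarrow> a (Inl v) | Inr w \<Rightarrow> t l w (\<lambda>z. a (Inr z))) = a w) \<or>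
      (\<exists>m\<in>A'. \<forall>a. tup a \<longrightarrow> (case n of Inl v \<Rightarrow> a (Inl v) | Inr w \<Rightarrow> t l w (\<lambda>z. a (Inr z))) = m)"
    proof (cases n)
      case (Inl v)
      then show ?thesis using n by auto
    next
      case (Inr w)
      then have "w \<in> W" using n by auto
      from t[OF l this] show ?thesis
      proof (elim disjE bexE)
        fix z assume "z \<in> Z" "\<forall>a. tup a \<longrightarrow> t l w a = a z"
        moreover have "tup (\<lambda>z. a (Inr z))" if "tup a" for a :: "'v + 'z \<Rightarrow> 'm"
          using that by (intro tupI) blast
        ultimately show ?thesis using Inr by (intro disjI1 bexI[of _ "Inr z"]) auto
      next
        fix m assume "m \<in> A'" "\<forall>a. tup a \<longrightarrow> t l w a = m"
        moreover have "tup (\<lambda>z. a (Inr z))" if "tup a" for a :: "'v + 'z \<Rightarrow> 'm"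
          using that by (intro tupI) blast
        ultimately show ?thesis using Inr by (intro disjI2 bexI[of _ m]) auto
      qed
    qed
  next
    fix n and a :: "'v + 'z \<Rightarrow> 'm" assume a: "tup a"
    then have "tup (\<lambda>z. a (Inr z))" by (intro tupI) blast
    then show "(case n of Inl v \<Rightarrow> a (Inl v) | Inr w \<Rightarrow> t l w (\<lambda>z. a (Inr z))) \<in> U"
      using tU a by (auto split: sum.split)
  qed
  then show "defn (V <+> Z) A' (\<lambda>e. R (\<lambda>v. e (Inl v)) (\<lambda>w. t l w (\<lambda>w. e (Inr w))))"
    by simp
qed

section \<open>Equality of types\<close>

definition eqtp :: "'v set \<Rightarrow> 'm set \<Rightarrow> ('v \<Rightarrow> 'm) \<Rightarrow> ('v \<Rightarrow> 'm) \<Rightarrow> bool" where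
  "eqtp V A b c \<longleftrightarrow> (\<forall>R. defn V A R \<longrightarrow> R b = R c)"

lemma eqtpD: "eqtp V A b c \<Longrightarrow> defn V A R \<Longrightarrow> R b = R c"
  unfolding eqtp_def by blast

lemma eqtp_sym: "eqtp V A b c \<Longrightarrow> eqtp V A c b"
  unfolding eqtp_def by metis

lemma eqtp_trans: "eqtp V A b c \<Longrightarrow> eqtp V A c d \<Longrightarrow> eqtp V A b d"
  unfolding eqtp_def by metis

lemma eqtp_mono: "eqtp V' A' b c \<Longrightarrow> V \<subseteq> V' \<Longrightarrow> A \<subseteq> A' \<Longrightarrow> eqtp V A b c"
  unfolding eqtp_def using defn_mono by blast

lemma eqtp_agree: "tup b \<Longrightarrow> tup c \<Longrightarrow> (\<And>v. v \<in> V \<Longrightarrow> b v = c v) \<Longrightarrow> eqtp V A b c"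
  unfolding eqtp_def using defn_local by blast

lemma eqtpI:
  assumes "\<And>R. defn V A R \<Longrightarrow> R b \<Longrightarrow> R c"
  shows "eqtp V A b c"
  unfolding eqtp_def using assms defn_not by blast

lemma eqtp_subst:
  assumes "eqtp V A b c" "\<And>w. w \<in> W \<Longrightarrow> s w \<in> V"
  shows "eqtp W A (\<lambda>w. b (s w)) (\<lambda>w. c (s w))"
  unfolding eqtp_def
proof (intro allI impI)
  fix R assume R: "defn W A R"
  have "defn V A (\<lambda>a. R (\<lambda>w. a (s w)))"
    by (rule defn_subst[OF R]) (use assms(2) in auto)
  from eqtpD[OF assms(1) this] show "R (\<lambda>w. b (s w)) = R (\<lambda>w. c (s w))" .
qed

lemma eqtp_iff_tp:
  assumes "tup b" "tup c"
  shows "eqtp V A b c \<longleftrightarrow> tp L \<MM> V b A = tp L \<MM> V c A"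
proof
  assume e: "eqtp V A b c"
  show "tp L \<MM> V b A = tp L \<MM> V c A"
    unfolding tp_def using eqtpD[OF e defnI] by blast
next
  assume e: "tp L \<MM> V b A = tp L \<MM> V c A"
  show "eqtp V A b c"
    unfolding eqtp_def defn_def rep_def using e assms unfolding tp_def by blast
qed

lemma tp_cong: "(\<And>v. v \<in> V \<Longrightarrow> b v = c v) \<Longrightarrow> tp L \<MM> V b A = tp L \<MM> V c A"
  unfolding tp_def using holds_fms_cong by blast

text \<open>A predicate of \<open>b\<close> with parameters from \<open>d\<close> is a predicate of
  the pair, so the type of the pair over \<open>A\<close> decides it.\<close>

lemma eqtp_add_params:
  assumes "eqtp (V <+> W) A (case_sum b d) (case_sum c d)" "tup b" "tup c" "tup d"
  shows "eqtp V (A \<union> d ` W) b c"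
  unfolding eqtp_def
proof (intro allI impI)
  fix R assume "defn V (A \<union> d ` W) R"
  then obtain R' where R': "defn2 V W A R'" "\<And>x. tup x \<Longrightarrow> R' x d = R x"
    using defn_params[OF _ assms(4)] by blast
  from eqtpD[OF assms(1) R'(1)[unfolded defn2_def]] show "R b = R c"
    using R'(2) assms(2,3) by simp
qed

lemma automorphism_defn:
  assumes g: "automorphism L \<MM> g" and fixed: "\<And>a. a \<in> A \<Longrightarrow> g a = a" and R: "defn V A R"
    and a: "tup a" and A: "A \<subseteq> U"
  shows "R (\<lambda>v. g (a v)) = R a"
proof -
  obtain \<phi> where \<phi>: "rep V A \<phi> R" using R defn_def by blast
  have gU: "g u \<in> U" if "u \<in> U" for u using g that by (auto simp: automorphism_def bij_betw_def)
  \<comment> \<open>Parameters outside \<open>A\<close> do not occur; sending them to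
    \<open>pt\<close> puts all values into the universe, as preservation under automorphisms
    requires.\<close>
  let ?e = "case_sum a (\<lambda>m. if m \<in> A then m else pt)"
  have n: "names \<phi> \<subseteq> V <+> A" "wf_fm L 0 \<phi>" using rep_fms[OF \<phi>] by (auto simp: fms_def)
  have "tup (\<lambda>v. g (a v))" using a gU by (intro tupI) blast
  then have "R (\<lambda>v. g (a v)) = holds_at (\<lambda>v. g (a v)) \<phi>"
    by (rule repD[OF \<phi>])
  also have "\<dots> = holds \<MM> (\<lambda>n. g (?e n)) \<phi>"
    by (rule holds_cong) (use n fixed in \<open>auto split: sum.split\<close>)
  also have "\<dots> = holds \<MM> ?e \<phi>"
  proof -
    have "range ?e \<subseteq> U" using a A by (auto split: sum.splits)
    from automorphism_sat[OF g is_struct this, of "[]" \<phi>] n show ?thesis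
      by (simp only: holds_def list.map list.size list.set empty_subsetI)
  qed
  also have "\<dots> = holds_at a \<phi>"
    by (rule holds_cong) (use n in \<open>auto split: sum.split\<close>)
  also have "\<dots> = R a" by (rule repD[OF \<phi> a, symmetric])
  finally show ?thesis .
qed

end

section \<open>Cardinalities\<close>

lemma card_Un_ordLeq:
  "infinite S \<Longrightarrow> |A| \<le>o |S| \<Longrightarrow> |B| \<le>o |S| \<Longrightarrow> |A \<union> B| \<le>o |S|"
  by (rule card_of_Un_ordLeq_infinite_Field) (simp_all add: Field_card_of card_of_card_order_on)

lemma card_Times_ordLeq:
  "infinite S \<Longrightarrow> |A| \<le>o |S| \<Longrightarrow> |B| \<le>o |S| \<Longrightarrow> |A \<times> B| \<le>o |S|"
  by (rule card_of_Times_ordLeq_infinite_Field) (simp_all add: Field_card_of card_of_card_order_on)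

lemma card_image_ordLeq: "|A| \<le>o |S| \<Longrightarrow> |f ` A| \<le>o |S|"
  using card_of_image ordLeq_transitive by blast

lemma card_subset_ordLeq: "|B| \<le>o |S| \<Longrightarrow> A \<subseteq> B \<Longrightarrow> |A| \<le>o |S|"
  using card_of_mono1 ordLeq_transitive by blast

lemma card_nat_ordLeq: "infinite S \<Longrightarrow> |UNIV :: nat set| \<le>o |S|"
  using infinite_iff_card_of_nat by blast

lemma card_UN_nat_ordLeq:
  assumes "infinite S" "\<And>n :: nat. |A n| \<le>o |S|"
  shows "|\<Union>n. A n| \<le>o |S|"
  by (rule card_of_UNION_ordLeq_infinite) (use assms card_nat_ordLeq in auto)

lemma card_finite_ordLeq: "infinite S \<Longrightarrow> finite A \<Longrightarrow> |A| \<le>o |S|"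
  by (rule ordLess_imp_ordLeq, rule finite_ordLess_infinite)
    (simp_all add: card_of_well_order_on Field_card_of)

lemma card_lists_ordLeq:
  assumes S: "infinite S" and A: "|A| \<le>o |S|"
  shows "|lists A| \<le>o |S|"
proof -
  have "|{xs \<in> lists A. length xs = n}| \<le>o |S|" for n
  proof (induction n)
    case 0
    have "finite {xs \<in> lists A. length xs = 0}" by auto
    then show ?case using card_finite_ordLeq S by blast
  next
    case (Suc n)
    have "{xs \<in> lists A. length xs = Suc n} \<subseteq> (\<lambda>(x, xs). x # xs) ` (A \<times> {xs \<in> lists A. length xs = n})"
      by (auto simp: length_Suc_conv image_iff)
    then show ?case
      by (rule card_subset_ordLeq[OF card_image_ordLeq[OF card_Times_ordLeq[OF S A Suc.IH]]])
  qed
  from card_UN_nat_ordLeq[OF S this] show ?thesis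
    by (rule card_subset_ordLeq) auto
qed

text \<open>Terms are counted by size: each is a name, an index, or a symbol applied to a list of
  smaller terms. Quantifying the depth existentially treats terms under any number of quantifiers at
  once.\<close>

lemma card_wf_trm:
  assumes S: "infinite S" and F: "|dom (farity L)| \<le>o |S|" and W: "|W| \<le>o |S|"
  shows "|{t. (\<exists>k. wf_trm L k t) \<and> trm_names t \<subseteq> W}| \<le>o |S|"
proof -
  let ?T = "\<lambda>n. {t. (\<exists>k. wf_trm L k t) \<and> trm_names t \<subseteq> W \<and> size t < n}"
  have "|?T n| \<le>o |S|" for n
  proof (induction n)
    case 0
    have "?T 0 = {}" by simp
    then show ?case using card_finite_ordLeq[OF S, of "?T 0"] by simp
  next
    case (Suc n)
    have "t \<in> Var ` W \<union> range Bnd \<union> (\<lambda>(f, ts). Fn f ts) ` (dom (farity L) \<times> lists (?T n))"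
      if t: "t \<in> ?T (Suc n)" for t
    proof (cases t)
      case (Fn f ts)
      then obtain k where k: "wf_trm L k (Fn f ts)" using t by blast
      have "u \<in> ?T n" if u: "u \<in> set ts" for u
      proof -
        have "size u < size t" using u Fn by (simp add: size_list_estimation' less_Suc_eq_le)
        then show ?thesis using t k u Fn by (auto simp: list_all_iff)
      qed
      then show ?thesis using Fn k by (auto simp: image_iff)
    qed (use t in auto)
    then have "?T (Suc n) \<subseteq> Var ` W \<union> range Bnd \<union> (\<lambda>(f, ts). Fn f ts) ` (dom (farity L) \<times> lists (?T n))"
      by blast
    then show ?case
      by (rule card_subset_ordLeq[rotated])
        (intro card_Un_ordLeq card_image_ordLeq card_Times_ordLeq card_lists_ordLeq S F W Suc.IH card_nat_ordLeq)
  qed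
  from card_UN_nat_ordLeq[OF S this] show ?thesis
    by (rule card_subset_ordLeq) auto
qed

lemma card_wf_fm:
  fixes L :: "('f, 'r) language" and W :: "'v set"
  assumes S: "infinite S" and F: "|dom (farity L)| \<le>o |S|" and R: "|dom (rarity L)| \<le>o |S|"
    and W: "|W| \<le>o |S|"
  shows "|{\<phi>. (\<exists>k. wf_fm L k \<phi>) \<and> names \<phi> \<subseteq> W}| \<le>o |S|"
proof -
  let ?T = "{t. (\<exists>k. wf_trm L k t) \<and> trm_names t \<subseteq> W}"
  let ?F = "\<lambda>n. {\<phi>. (\<exists>k. wf_fm L k \<phi>) \<and> names \<phi> \<subseteq> W \<and> size \<phi> < n}"
  have T: "|?T| \<le>o |S|" by (rule card_wf_trm[OF S F W])
  have "|?F n| \<le>o |S|" for n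
  proof (induction n)
    case 0
    have "?F 0 = {}" by simp
    then show ?case using card_finite_ordLeq[OF S, of "?F 0"] by simp
  next
    case (Suc n)
    have "\<phi> \<in> {Bot} \<union> (\<lambda>(s, t). Eq s t) ` (?T \<times> ?T) \<union>
      (\<lambda>(r, ts). Rel r ts) ` (dom (rarity L) \<times> lists ?T) \<union>
      (\<lambda>(\<phi>, \<psi>). Imp \<phi> \<psi>) ` (?F n \<times> ?F n) \<union> All ` ?F n"
      if "\<phi> \<in> ?F (Suc n)" for \<phi>
      using that by (cases \<phi>) (fastforce simp: list_all_iff image_iff)+
    then have "?F (Suc n) \<subseteq> {Bot} \<union> (\<lambda>(s, t). Eq s t) ` (?T \<times> ?T) \<union>
      (\<lambda>(r, ts). Rel r ts) ` (dom (rarity L) \<times> lists ?T) \<union>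
      (\<lambda>(\<phi>, \<psi>). Imp \<phi> \<psi>) ` (?F n \<times> ?F n) \<union> All ` ?F n"
      by blast
    moreover have "|{Bot :: ('f, 'r, 'v) fm}| \<le>o |S|" by (rule card_finite_ordLeq[OF S]) simp
    ultimately show ?case
      by (elim card_subset_ordLeq[rotated])
        (intro card_Un_ordLeq card_image_ordLeq card_Times_ordLeq card_lists_ordLeq S T R Suc.IH)
  qed
  from card_UN_nat_ordLeq[OF S this] show ?thesis
    by (rule card_subset_ordLeq) auto
qed

lemma card_fms:
  assumes S: "infinite S" and "|dom (farity L)| \<le>o |S|" "|dom (rarity L)| \<le>o |S|"
    and "|V| \<le>o |S|" "|A| \<le>o |S|"
  shows "|fms L V A| \<le>o |S|"
proof -
  have "V <+> A = Inl ` V \<union> Inr ` A" by auto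
  then have "|V <+> A| \<le>o |S|"
    using card_Un_ordLeq[OF S card_image_ordLeq[OF assms(4)] card_image_ordLeq[OF assms(5)]] by metis
  from card_wf_fm[OF assms(1-3) this] show ?thesis
    by (rule card_subset_ordLeq) (auto simp: fms_def)
qed

text \<open>If all fibers were finite, \<open>A\<close> would be a union of at most
  \<open>|S|\<close> finite sets and so no larger than \<open>S\<close>. An infinite fiber suffices
  later, since subsequences of k-inconsistent sequences remain k-inconsistent.\<close>

lemma infinite_fiber:
  assumes A: "infinite S" "|f ` A| \<le>o |S|" "|S| <o |A|"
  obtains y where "infinite {x \<in> A. f x = y}"
proof -
  have False if fin: "\<And>y. finite {x \<in> A. f x = y}"
  proof -
    have "|\<Union>y\<in>f ` A. {x \<in> A. f x = y}| \<le>o |S|"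
      by (rule card_of_UNION_ordLeq_infinite[OF A(1,2)]) (use fin card_finite_ordLeq[OF A(1)] in blast)
    moreover have "A = (\<Union>y\<in>f ` A. {x \<in> A. f x = y})" by blast
    ultimately have "|A| \<le>o |S|" by metis
    then show False using A(3) not_ordLess_ordLeq by blast
  qed
  then show thesis using that by blast
qed

locale strong_limit_card =
  fixes \<kappa> :: "'k rel"
  assumes slim: "strong_limit \<kappa>"
begin

lemma Card_order_kappa: "Card_order \<kappa>" and natLeq_kappa: "natLeq <o \<kappa>"
  using slim by (simp_all add: strong_limit_def)

lemma infinite_kappa: "infinite (Field \<kappa>)"
proof
  assume "finite (Field \<kappa>)"
  then have "|Field \<kappa>| <o natLeq" using finite_iff_ordLess_natLeq by blast
  moreover have "|Field \<kappa>| =o \<kappa>" using Card_order_kappa card_of_Field_ordIso by blast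
  ultimately show False
    using natLeq_kappa not_ordLess_iff_ordLeq
    by (meson ordIso_iff_ordLeq ordLeq_ordLess_trans ordLess_irreflexive ordLess_transitive)
qed

lemma small_ordLeq: "|A| \<le>o |B| \<Longrightarrow> small \<kappa> B \<Longrightarrow> small \<kappa> A"
  unfolding small_def by (rule ordLeq_ordLess_trans)

lemma small_subset: "small \<kappa> B \<Longrightarrow> A \<subseteq> B \<Longrightarrow> small \<kappa> A"
  using small_ordLeq card_of_mono1 by blast

lemma small_image: "small \<kappa> A \<Longrightarrow> small \<kappa> (f ` A)"
  using small_ordLeq card_of_image by blast

lemma small_Un: "small \<kappa> A \<Longrightarrow> small \<kappa> B \<Longrightarrow> small \<kappa> (A \<union> B)"
  unfolding small_def
  by (rule card_of_Un_ordLess_infinite_Field[OF infinite_kappa Card_order_kappa])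

lemma small_Plus: "small \<kappa> A \<Longrightarrow> small \<kappa> B \<Longrightarrow> small \<kappa> (A <+> B)"
  unfolding small_def
  by (rule card_of_Plus_ordLess_infinite_Field[OF infinite_kappa Card_order_kappa])

lemma small_nat: "small \<kappa> (A :: nat set)"
proof (rule small_subset[OF _ subset_UNIV])
  show "small \<kappa> (UNIV :: nat set)"
    unfolding small_def using natLeq_kappa card_of_nat ordIso_ordLess_trans by blast
qed

lemma small_finite: "finite A \<Longrightarrow> small \<kappa> A"
  by (rule small_ordLeq[OF card_finite_ordLeq[OF infinite_UNIV_nat] small_nat])

lemma small_Times: 
  assumes "small \<kappa> A" "small \<kappa> B"
  shows "small \<kappa> (A \<times> B)"
proof -
  let ?S = "(A <+> B) <+> (UNIV :: nat set)"
  have "|A| \<le>o |?S|" "|B| \<le>o |?S|"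
    by (rule ordLeq_transitive[OF card_of_Plus1 card_of_Plus1],
        rule ordLeq_transitive[OF card_of_Plus2 card_of_Plus1])
  moreover have "infinite ?S" by (simp add: finite_Plus_iff)
  ultimately have "|A \<times> B| \<le>o |?S|" by (intro card_Times_ordLeq)
  moreover have "small \<kappa> ?S" by (intro small_Plus small_nat assms)
  ultimately show ?thesis by (rule small_ordLeq)
qed

text \<open>The strong limit condition speaks of subsets of \<open>Field \<kappa>\<close> only, so a
  small set is first copied there.\<close>

lemma small_Pow:
  assumes "small \<kappa> A"
  shows "small \<kappa> (Pow A)"
proof -
  have "|A| \<le>o \<kappa>" using assms ordLess_imp_ordLeq unfolding small_def by blast
  then obtain X where X: "X \<subseteq> Field \<kappa>" "|A| =o |X|"
    using internalize_card_of_ordLeq2[of A "Field \<kappa>"] card_of_Field_ordIso[OF Card_order_kappa]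
    by (meson ordIso_symmetric ordLeq_ordIso_trans)
  then obtain f where f: "bij_betw f A X" using card_of_ordIso by blast
  have "small \<kappa> X" using X assms unfolding small_def by (meson ordIso_ordLess_trans ordIso_symmetric)
  then have "small \<kappa> (Pow X)" using slim X unfolding strong_limit_def by blast
  moreover have "|Pow A| \<le>o |Pow X|"
    using bij_betw_Pow[OF f] card_of_ordIsoI ordIso_iff_ordLeq by blast
  ultimately show ?thesis using small_ordLeq by blast
qed

end

section \<open>Ultrafilters\<close>

definition ultra :: "'i set set \<Rightarrow> bool" where
  "ultra \<U> \<longleftrightarrow> UNIV \<in> \<U> \<and> (\<forall>A\<in>\<U>. \<forall>B\<in>\<U>. A \<inter> B \<in> \<U>) \<and> (\<forall>A\<in>\<U>. \<forall>B. A \<subseteq> B \<longrightarrow> B \<in> \<U>) \<and>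
    (\<forall>A. A \<in> \<U> \<longleftrightarrow> - A \<notin> \<U>)"

lemma ultra_Int: "ultra \<U> \<Longrightarrow> A \<in> \<U> \<Longrightarrow> B \<in> \<U> \<Longrightarrow> A \<inter> B \<in> \<U>"
  unfolding ultra_def by metis

lemma ultra_mono: "ultra \<U> \<Longrightarrow> A \<in> \<U> \<Longrightarrow> A \<subseteq> B \<Longrightarrow> B \<in> \<U>"
  unfolding ultra_def by metis

lemma ultra_UNIV: "ultra \<U> \<Longrightarrow> UNIV \<in> \<U>"
  unfolding ultra_def by metis

lemma ultra_Compl: "ultra \<U> \<Longrightarrow> - A \<in> \<U> \<longleftrightarrow> A \<notin> \<U>"
  unfolding ultra_def by metis

lemma ultra_nonempty: "ultra \<U> \<Longrightarrow> A \<in> \<U> \<Longrightarrow> A \<noteq> {}"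
  using ultra_Compl[of \<U> "{}"] ultra_UNIV[of \<U>] by auto

lemma ultra_conj:
  assumes "ultra \<U>"
  shows "{i. P i \<and> Q i} \<in> \<U> \<longleftrightarrow> {i. P i} \<in> \<U> \<and> {i. Q i} \<in> \<U>"
proof
  assume a: "{i. P i \<and> Q i} \<in> \<U>"
  show "{i. P i} \<in> \<U> \<and> {i. Q i} \<in> \<U>"
    by (intro conjI ultra_mono[OF assms a] Collect_mono) simp_all
next
  assume "{i. P i} \<in> \<U> \<and> {i. Q i} \<in> \<U>"
  then show "{i. P i \<and> Q i} \<in> \<U>"
    unfolding Collect_conj_eq by (intro ultra_Int[OF assms]) simp_all
qed

lemma ultra_ball:
  assumes u: "ultra \<U>" and "finite K" "\<And>k. k \<in> K \<Longrightarrow> {i. P k i} \<in> \<U>"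
  shows "{i. \<forall>k\<in>K. P k i} \<in> \<U>"
  using assms(2,3)
proof (induction K rule: finite_induct)
  case empty
  then show ?case using ultra_UNIV[OF u] by simp
next
  case (insert k K)
  then show ?case using ultra_conj[OF u, of "P k" "\<lambda>i. \<forall>k\<in>K. P k i"] by simp
qed

text \<open>Among the families extending \<open>\<F>\<close> with the finite intersection property,
  a maximal one contains every set that meets all its finite intersections. The ultrafilter axioms
  are read off from this criterion.\<close>

lemma ultra_exists:
  assumes fip: "\<And>G. finite G \<Longrightarrow> G \<subseteq> \<F> \<Longrightarrow> \<Inter>G \<noteq> {}"
  obtains \<U> where "ultra \<U>" "\<F> \<subseteq> \<U>"
proof -
  define P where "P H \<longleftrightarrow> \<F> \<subseteq> H \<and> (\<forall>G. finite G \<and> G \<subseteq> H \<longrightarrow> \<Inter>G \<noteq> {})" for H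
  have "P \<F>" using fip by (simp add: P_def)
  have "\<exists>H\<in>Collect P. \<forall>X\<in>Collect P. H \<subseteq> X \<longrightarrow> X = H"
  proof (rule subset_Zorn_nonempty)
    show "Collect P \<noteq> {}" using \<open>P \<F>\<close> by blast
  next
    fix \<C> assume C: "\<C> \<noteq> {}" "subset.chain (Collect P) \<C>"
    have "\<Inter>G \<noteq> {}" if G: "finite G" "G \<subseteq> \<Union>\<C>" for G
    proof -
      obtain H where "H \<in> \<C>" "G \<subseteq> H" using finite_subset_Union_chain[OF G C] by blast
      moreover have "P H" using C(2) \<open>H \<in> \<C>\<close> by (auto simp: subset.chain_def)
      ultimately show ?thesis using G(1) by (simp add: P_def)
    qed
    moreover have "\<F> \<subseteq> \<Union>\<C>"
    proof -
      obtain H where "H \<in> \<C>" using C(1) by blast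
      moreover from this have "P H" using C(2) by (auto simp: subset.chain_def)
      ultimately show ?thesis unfolding P_def by blast
    qed
    ultimately show "\<Union>\<C> \<in> Collect P" by (simp add: P_def)
  qed
  then obtain H where H: "P H" and max: "\<And>X. P X \<Longrightarrow> H \<subseteq> X \<Longrightarrow> X = H" by blast
  have add: "A \<in> H" if "\<And>G. finite G \<Longrightarrow> G \<subseteq> H \<Longrightarrow> A \<inter> \<Inter>G \<noteq> {}" for A
  proof -
    have "P (insert A H)"
    proof -
      have "\<Inter>G \<noteq> {}" if "finite G" "G \<subseteq> insert A H" for G
      proof -
        have "A \<inter> \<Inter>(G - {A}) \<noteq> {}" using that by (intro \<open>\<And>G. finite G \<Longrightarrow> G \<subseteq> H \<Longrightarrow> A \<inter> \<Inter>G \<noteq> {}\<close>) auto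
        moreover have "A \<inter> \<Inter>(G - {A}) \<subseteq> \<Inter>G" by blast
        ultimately show ?thesis by blast
      qed
      then show ?thesis using H by (auto simp: P_def)
    qed
    from max[OF this] show ?thesis by blast
  qed
  have fin: "\<Inter>G \<noteq> {}" if "finite G" "G \<subseteq> H" for G using H that by (simp add: P_def)
  have "ultra H"
    unfolding ultra_def
  proof (intro conjI ballI allI impI iffI)
    show "UNIV \<in> H" by (rule add) (use fin in auto)
  next
    fix A B assume AB: "A \<in> H" "B \<in> H"
    show "A \<inter> B \<in> H"
    proof (rule add)
      fix G assume "finite G" "G \<subseteq> H"
      then have "\<Inter>(insert A (insert B G)) \<noteq> {}" using AB by (intro fin) auto
      then show "A \<inter> B \<inter> \<Inter>G \<noteq> {}" by auto
    qed
  next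
    fix A B assume AB: "A \<in> H" "A \<subseteq> B"
    show "B \<in> H"
    proof (rule add)
      fix G assume "finite G" "G \<subseteq> H"
      then have "\<Inter>(insert A G) \<noteq> {}" using AB by (intro fin) auto
      then show "B \<inter> \<Inter>G \<noteq> {}" using AB by auto
    qed
  next
    fix A assume "A \<in> H"
    show "- A \<notin> H"
    proof
      assume "- A \<in> H"
      then have "\<Inter>{A, - A} \<noteq> {}" using \<open>A \<in> H\<close> by (intro fin) auto
      then show False by simp
    qed
  next
    fix A assume A: "- A \<notin> H"
    then obtain G where G: "finite G" "G \<subseteq> H" "- A \<inter> \<Inter>G = {}" using add[of "- A"] by metis
    show "A \<in> H"
    proof (rule add)
      fix G' assume "finite G'" "G' \<subseteq> H"
      then have "\<Inter>(G \<union> G') \<noteq> {}" using G by (intro fin) auto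
      then show "A \<inter> \<Inter>G' \<noteq> {}" using G by auto
    qed
  qed
  then show thesis using that H by (simp add: P_def)
qed

lemma nonprincipal_ultra:
  obtains \<U> :: "nat set set" where "ultra \<U>" "\<And>F. finite F \<Longrightarrow> - F \<in> \<U>"
proof -
  have "\<Inter>G \<noteq> {}" if "finite G" "G \<subseteq> {- F | F. finite F}" for G :: "nat set set"
  proof -
    have "finite (\<Union>(uminus ` G))" using that by auto
    then obtain x where "x \<notin> \<Union>(uminus ` G)" using ex_new_if_finite infinite_UNIV_nat by blast
    then show ?thesis by auto
  qed
  then obtain \<U> :: "nat set set" where "ultra \<U>" "{- F | F. finite F} \<subseteq> \<U>"
    by (rule ultra_exists)
  then show thesis using that by blast
qed

section \<open>Saturation and homogeneity for tuples\<close>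

locale monster = fo_struct L \<MM> + strong_limit_card \<kappa>
  for L :: "('f, 'r) language" and \<MM> :: "('f, 'r, 'm) struct" and \<kappa> :: "'k rel" +
  assumes small_lang: "small \<kappa> (dom (farity L) <+> dom (rarity L))"
    and saturated: "saturated L \<kappa> \<MM>"
    and homogeneous: "strongly_homogeneous L \<kappa> \<MM>"
begin

text \<open>Saturation is given for one variable, so a tuple is realized one coordinate at a time.
  To keep going, the family is enlarged along an ultrafilter on its finite subsets to the predicates
  true at almost all approximate solutions \<open>a F\<close>. This larger family is closed under
  finite conjunction and projection, which lets every partial realization be extended.\<close>

lemma saturation:
  fixes V :: "'v set" and \<R> :: "(('v \<Rightarrow> 'm) \<Rightarrow> bool) set"
  assumes V: "small \<kappa> V" and A: "small \<kappa> A" "A \<subseteq> U"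
    and R: "\<And>R. R \<in> \<R> \<Longrightarrow> defn V A R"
    and fin: "\<And>F. finite F \<Longrightarrow> F \<subseteq> \<R> \<Longrightarrow> \<exists>a. tup a \<and> (\<forall>R\<in>F. R a)"
  shows "\<exists>a. tup a \<and> (\<forall>R\<in>\<R>. R a)"
proof -
  have "\<exists>a. tup a \<and> (finite F \<and> F \<subseteq> \<R> \<longrightarrow> (\<forall>R\<in>F. R a))" for F
    using fin[of F] tup_pt by (cases "finite F \<and> F \<subseteq> \<R>") blast+
  then obtain a where a: "\<And>F. tup (a F)" "\<And>F R. finite F \<Longrightarrow> F \<subseteq> \<R> \<Longrightarrow> R \<in> F \<Longrightarrow> R (a F)"
    by metis
  \<comment> \<open>The cone of finite parts containing \<open>R\<close>; for each \<open>F\<close>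
    in it, \<open>a F\<close> satisfies \<open>R\<close>.\<close>
  define C where "C R = {F. finite F \<and> F \<subseteq> \<R> \<and> R \<in> F}" for R
  have "\<Inter>G \<noteq> {}" if G: "finite G" "G \<subseteq> C ` \<R>" for G
  proof -
    obtain F where "finite F" "F \<subseteq> \<R>" "G = C ` F" using finite_subset_image[OF G] by blast
    then have "F \<in> \<Inter>G" by (auto simp: C_def)
    then show ?thesis by blast
  qed
  then obtain \<U> where u: "ultra \<U>" and "C ` \<R> \<subseteq> \<U>" by (rule ultra_exists)
  define T where "T R \<longleftrightarrow> {F. R (a F)} \<in> \<U>" for R
  have T: "T R" if "R \<in> \<R>" for R
  proof -
    have "C R \<subseteq> {F. R (a F)}" using a by (auto simp: C_def)
    then show ?thesis using \<open>C ` \<R> \<subseteq> \<U>\<close> that ultra_mono[OF u] unfolding T_def by blast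
  qed
  \<comment> \<open>Partial assignments, as graphs, that satisfy every predicate in \<open>T\<close>
    mentioning assigned coordinates only. Zorn's lemma gives a maximal one.\<close>
  define ok where "ok G \<longleftrightarrow> single_valued G \<and> Domain G \<subseteq> V \<and> Range G \<subseteq> U \<and>
    (\<forall>R e. defn (Domain G) A R \<and> T R \<and> tup e \<and> (\<forall>v m. (v, m) \<in> G \<longrightarrow> e v = m) \<longrightarrow> R e)" for G
  have "ok {}"
  proof -
    have "R e" if "defn {} A R" "T R" "tup e" for R e
    proof -
      obtain F where "R (a F)" using \<open>T R\<close> ultra_nonempty[OF u] unfolding T_def by blast
      then show ?thesis using defn_local[OF that(1) that(3) a(1)] by simp
    qed
    then show ?thesis unfolding ok_def by (auto simp: single_valued_def)
  qed
  have "\<exists>G\<in>Collect ok. \<forall>X\<in>Collect ok. G \<subseteq> X \<longrightarrow> X = G"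
  proof (rule subset_Zorn_nonempty)
    show "Collect ok \<noteq> {}" using \<open>ok {}\<close> by blast
  next
    fix \<C> assume C: "\<C> \<noteq> {}" "subset.chain (Collect ok) \<C>"
    have okC: "ok G" if "G \<in> \<C>" for G using C(2) that by (auto simp: subset.chain_def)
    have "single_valued (\<Union>\<C>)"
    proof (rule single_valuedI)
      fix x y z assume "(x, y) \<in> \<Union>\<C>" "(x, z) \<in> \<Union>\<C>"
      then have "finite {(x, y), (x, z)}" "{(x, y), (x, z)} \<subseteq> \<Union>\<C>" by auto
      from finite_subset_Union_chain[OF this C] obtain G where "G \<in> \<C>" "{(x, y), (x, z)} \<subseteq> G" by blast
      then show "y = z" using okC[of G] by (auto simp: ok_def single_valued_def)
    qed
    moreover have "R e" if R: "defn (Domain (\<Union>\<C>)) A R" "T R" and e: "tup e"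
      "\<forall>v m. (v, m) \<in> \<Union>\<C> \<longrightarrow> e v = m" for R e
    proof -
      obtain V0 A0 where V0: "finite V0" "V0 \<subseteq> Domain (\<Union>\<C>)" "finite A0" "A0 \<subseteq> A" "defn V0 A0 R"
        by (rule defn_finite[OF R(1)])
      then have "V0 \<subseteq> fst ` \<Union>\<C>" by (simp add: Domain_fst)
      from finite_subset_image[OF V0(1) this]
      obtain G0 where "finite G0" "G0 \<subseteq> \<Union>\<C>" "V0 = fst ` G0" by blast
      moreover from this obtain G where G: "G \<in> \<C>" "G0 \<subseteq> G"
        using finite_subset_Union_chain[OF _ _ C] by blast
      ultimately have "V0 \<subseteq> Domain G" by (auto simp: Domain_fst)
      then have "defn (Domain G) A R" using defn_mono[OF V0(5)] V0(4) by blast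
      then show "R e" using okC[OF G(1)] R(2) e G(1) unfolding ok_def by blast
    qed
    moreover have "Domain (\<Union>\<C>) \<subseteq> V" "Range (\<Union>\<C>) \<subseteq> U"
    proof -
      have "Domain G \<subseteq> V" "Range G \<subseteq> U" if "G \<in> \<C>" for G
        using okC[OF that] by (simp_all add: ok_def)
      then show "Domain (\<Union>\<C>) \<subseteq> V" "Range (\<Union>\<C>) \<subseteq> U" by fast+
    qed
    ultimately show "\<Union>\<C> \<in> Collect ok" unfolding ok_def by blast
  qed
  then obtain G where G: "ok G" and max: "\<And>X. ok X \<Longrightarrow> G \<subseteq> X \<Longrightarrow> X = G" by blast
  define e where "e v = (if v \<in> Domain G then THE m. (v, m) \<in> G else pt)" for v
  have eG: "e v = m" if "(v, m) \<in> G" for v m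
    using that G by (auto simp: e_def ok_def single_valued_def)
  have eU: "e v \<in> U" for v
  proof (cases "v \<in> Domain G")
    case True
    then obtain m where "(v, m) \<in> G" by blast
    then show ?thesis using eG G by (auto simp: ok_def)
  next
    case False
    then show ?thesis using pt_in by (simp add: e_def)
  qed
  then have e: "tup e" by (rule tupI)
  have Gprop: "R e" if "defn (Domain G) A R" "T R" for R
    using G that e eG unfolding ok_def by blast
  have "V \<subseteq> Domain G"
  proof
    fix v assume v: "v \<in> V"
    show "v \<in> Domain G"
    proof (rule ccontr)
      assume vG: "v \<notin> Domain G"
      have "small \<kappa> (Domain G)" using V G small_subset by (auto simp: ok_def)
      then have A': "small \<kappa> (A \<union> e ` Domain G)" "A \<union> e ` Domain G \<subseteq> U"
        using A eU by (auto intro!: small_Un small_image)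
      \<comment> \<open>The type of the missing coordinate \<open>v\<close> over the values already
        assigned. Its finite parts are realized because \<open>T\<close> contains the projection of
        their conjunction.\<close>
      define p where "p = {\<phi> \<in> fms L (UNIV :: unit set) (A \<union> e ` Domain G).
        \<exists>R. defn (insert v (Domain G)) A R \<and> T R \<and>
          (\<forall>x. tup x \<longrightarrow> holds_at x \<phi> = R (e(v := x ())))}"
      have cons: "consistent \<MM> p"
        unfolding consistent_def
      proof (intro allI impI)
        fix F assume F: "F \<subseteq> p" "finite F"
        then have "\<forall>\<phi>\<in>F. \<exists>R. defn (insert v (Domain G)) A R \<and> T R \<and>
          (\<forall>x. tup x \<longrightarrow> holds_at x \<phi> = R (e(v := x ())))"
          by (auto simp: p_def)
        from bchoice[OF this] obtain R where R: "\<forall>\<phi>\<in>F. defn (insert v (Domain G)) A (R \<phi>) \<and> T (R \<phi>) \<and>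
          (\<forall>x. tup x \<longrightarrow> holds_at x \<phi> = R \<phi> (e(v := x ())))" ..
        let ?R = "\<lambda>a. \<forall>\<phi>\<in>F. R \<phi> a"
        have "T ?R" using R ultra_ball[OF u F(2)] by (simp add: T_def)
        then have "T (\<lambda>a. \<exists>u\<in>U. ?R (a(v := u)))"
          unfolding T_def
        proof (rule ultra_mono[OF u])
          have "a F v \<in> U" "(a F)(v := a F v) = a F" for F using a(1) by auto
          then show "{F'. ?R (a F')} \<subseteq> {F'. \<exists>u\<in>U. ?R ((a F')(v := u))}"
          proof (intro Collect_mono impI)
            fix F' assume "?R (a F')"
            then show "\<exists>u\<in>U. ?R ((a F')(v := u))"
              using \<open>a F' v \<in> U\<close> \<open>(a F')(v := a F' v) = a F'\<close> by (intro bexI[of _ "a F' v"]) simp_all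
          qed
        qed
        moreover have "defn (insert v (Domain G)) A ?R" using R F(2) by (intro defn_ball) auto
        then have "defn (Domain G) A (\<lambda>a. \<exists>u\<in>U. ?R (a(v := u)))" by (rule defn_ex1)
        ultimately obtain x where x: "x \<in> U" "?R (e(v := x))" using Gprop by blast
        have "holds_at (\<lambda>_. x) \<phi>" if "\<phi> \<in> F" for \<phi>
        proof -
          have "tup (\<lambda>_ :: unit. x)" using x by (simp add: tup_def)
          then have "holds_at (\<lambda>_. x) \<phi> = R \<phi> (e(v := x))" using R that by blast
          then show ?thesis using x that by blast
        qed
        then show "\<exists>a. range a \<subseteq> U \<and> realizes \<MM> a F"
          using x by (intro exI[of _ "\<lambda>_. x"]) (auto simp: realizes_def)
      qed
      have "p \<subseteq> fms L UNIV (A \<union> e ` Domain G)" by (auto simp: p_def)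
      then obtain b where b: "range b \<subseteq> U" "realizes \<MM> b p"
        using saturated[unfolded saturated_def] A' cons by meson
      define G' where "G' = insert (v, b ()) G"
      have "R e'" if R: "defn (Domain G') A R" "T R" and e': "tup e'"
        "\<forall>v m. (v, m) \<in> G' \<longrightarrow> e' v = m" for R e'
      proof -
        have R': "defn (insert v (Domain G)) A R" using R by (simp add: G'_def)
        have "defn UNIV (A \<union> e ` Domain G) (\<lambda>x :: unit \<Rightarrow> 'm. R (\<lambda>w. if w = v then x () else e w))"
          by (rule defn_subst[OF R']) (use eU in auto)
        then obtain \<phi> where \<phi>: "rep UNIV (A \<union> e ` Domain G) \<phi> (\<lambda>x :: unit \<Rightarrow> 'm. R (\<lambda>w. if w = v then x () else e w))"
          unfolding defn_def by blast
        have upd: "(\<lambda>w. if w = v then x () else e w) = e(v := x ())" for x :: "unit \<Rightarrow> 'm"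
          by (simp add: fun_eq_iff)
        have "\<phi> \<in> p"
          unfolding p_def using rep_fms[OF \<phi>] repD[OF \<phi>] R' R(2) unfolding upd by blast
        then have "R (e(v := b ()))"
          using b repD[OF \<phi>, of b] unfolding upd by (auto simp: realizes_def tup_def)
        moreover have "R e' = R (e(v := b ()))"
        proof (rule defn_local[OF R' e'(1)])
          show "tup (e(v := b ()))" using eU b by (intro tupI) auto
        next
          fix w assume "w \<in> insert v (Domain G)"
          then show "e' w = (e(v := b ())) w" using e'(2) eG vG by (auto simp: G'_def)
        qed
        ultimately show ?thesis by simp
      qed
      moreover have "single_valued G'" using G vG by (auto simp: ok_def G'_def single_valued_def)
      moreover have "Domain G' \<subseteq> V" "Range G' \<subseteq> U" using G v b by (auto simp: ok_def G'_def)
      ultimately have "ok G'" unfolding ok_def by blast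
      then have "G' = G" using max by (auto simp: G'_def)
      then show False using vG by (auto simp: G'_def)
    qed
  qed
  then have "R e" if "R \<in> \<R>" for R using Gprop T[OF that] R[OF that] defn_mono by blast
  then show ?thesis using e by blast
qed

text \<open>In the applications, \<open>\<F> i\<close> bundles all conditions belonging to a finite
  part of the index set. Directedness places any finite set of conditions into a single bundle,
  which one explicit tuple satisfies.\<close>

lemma saturation_directed:
  fixes V :: "'v set" and \<F> :: "'d \<Rightarrow> (('v \<Rightarrow> 'm) \<Rightarrow> bool) set"
  assumes V: "small \<kappa> V" and A: "small \<kappa> A" "A \<subseteq> U"
    and D: "D \<noteq> {}" "\<And>i j. i \<in> D \<Longrightarrow> j \<in> D \<Longrightarrow> \<exists>k\<in>D. \<F> i \<union> \<F> j \<subseteq> \<F> k"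
    and defn: "\<And>i Q. i \<in> D \<Longrightarrow> Q \<in> \<F> i \<Longrightarrow> defn V A Q"
    and sat: "\<And>i. i \<in> D \<Longrightarrow> \<exists>e. tup e \<and> (\<forall>Q\<in>\<F> i. Q e)"
  obtains e where "tup e" "\<And>i Q. i \<in> D \<Longrightarrow> Q \<in> \<F> i \<Longrightarrow> Q e"
proof -
  have "\<exists>e. tup e \<and> (\<forall>Q\<in>(\<Union>i\<in>D. \<F> i). Q e)"
  proof (rule saturation[OF V A])
    fix F assume F: "finite F" "F \<subseteq> (\<Union>i\<in>D. \<F> i)"
    then have "\<exists>k\<in>D. F \<subseteq> \<F> k"
    proof (induction F rule: finite_induct)
      case (insert Q F)
      then obtain i j where "i \<in> D" "F \<subseteq> \<F> i" "j \<in> D" "Q \<in> \<F> j" by auto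
      then show ?case using D(2)[of i j] by blast
    qed (use D(1) in blast)
    then show "\<exists>e. tup e \<and> (\<forall>Q\<in>F. Q e)" using sat by (meson subsetD)
  qed (use defn in blast)
  then obtain e where e: "tup e" "\<forall>Q\<in>(\<Union>i\<in>D. \<F> i). Q e" by (elim exE conjE)
  show thesis by (rule that[OF e(1)]) (use e(2) in blast)
qed

text \<open>Strong homogeneity concerns partial maps on the model, so the two tuples are turned into
  a map \<open>h\<close> on \<open>A\<close> and the range of \<open>b\<close>. It is well defined
  and fixes \<open>A\<close> because equalities among coordinates, and between coordinates and
  parameters, belong to the type.\<close>

lemma homogeneity:
  fixes V :: "'v set"
  assumes b: "tup b" and c: "tup c" and V: "small \<kappa> V" and A: "small \<kappa> A" "A \<subseteq> U"
    and e: "eqtp V A b c"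
  obtains g where "automorphism L \<MM> g" "\<And>a. a \<in> A \<Longrightarrow> g a = a" "\<And>v. v \<in> V \<Longrightarrow> g (b v) = c v"
proof -
  let ?A = "A \<union> b ` V"
  define s where "s x = (SOME v. v \<in> V \<and> b v = x)" for x
  have s: "s x \<in> V \<and> b (s x) = x" if "x \<in> b ` V" for x
    unfolding s_def using someI_ex[of "\<lambda>v. v \<in> V \<and> b v = x"] that by blast
  define h where "h x = (if x \<in> b ` V then c (s x) else x)" for x
  have hb: "h (b v) = c v" if "v \<in> V" for v
  proof -
    have "s (b v) \<in> V" "b (s (b v)) = b v" using s that by auto
    then have "c (s (b v)) = c v" using eqtpD[OF e defn_eq[of "s (b v)" V v]] that by blast
    then show ?thesis using that by (simp add: h_def)
  qed
  have hA: "h a = a" if "a \<in> A" for a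
  proof (cases "a \<in> b ` V")
    case True
    then have "c (s a) = a" using s[OF True] eqtpD[OF e defn_eq_param[of "s a" V a A]] that by blast
    then show ?thesis using True by (simp add: h_def)
  qed (simp add: h_def)
  have hU: "h ` ?A \<subseteq> U" using hb hA A(2) c by auto
  have AU: "?A \<subseteq> U" using A(2) b by auto
  \<comment> \<open>Reads a predicate in the elements of \<open>?A\<close> as a predicate of the
    tuple \<open>y\<close>: elements in the range of \<open>b\<close> become coordinates, the others
    stay parameters from \<open>A\<close>.\<close>
  let ?t = "\<lambda>x (y :: 'v \<Rightarrow> 'm). if x \<in> b ` V then y (s x) else self ?A x"
  have tt: "tup (self ?A)" "tup (tot ?A h)" using AU hU by (auto intro!: tup_tot)
  have "eqtp ?A {} (tot ?A h) (self ?A)"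
    unfolding eqtp_def
  proof (intro allI impI)
    fix R :: "('m \<Rightarrow> 'm) \<Rightarrow> bool" assume R: "defn ?A {} R"
    have "defn V A (\<lambda>y. R (\<lambda>x. ?t x y))"
    proof (rule defn_subst[OF R])
      fix x assume x: "x \<in> ?A"
      show "(\<exists>w\<in>V. \<forall>y. tup y \<longrightarrow> ?t x y = y w) \<or> (\<exists>m\<in>A. \<forall>y. tup y \<longrightarrow> ?t x y = m)"
      proof (cases "x \<in> b ` V")
        case True
        then show ?thesis using s[OF True] by (intro disjI1 bexI[of _ "s x"]) auto
      next
        case False
        then show ?thesis using x by (intro disjI2 bexI[of _ x]) auto
      qed
    qed (use tt(1) in auto)
    from eqtpD[OF e this] have "R (\<lambda>x. ?t x b) = R (\<lambda>x. ?t x c)" .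
    moreover have "(\<lambda>x. ?t x b) = self ?A" using s by (auto simp: fun_eq_iff tot_def)
    moreover have "(\<lambda>x. ?t x c) = tot ?A h" by (auto simp: fun_eq_iff tot_def h_def)
    ultimately show "R (tot ?A h) = R (self ?A)" by simp
  qed
  then have "tp L \<MM> ?A (tot ?A h) {} = tp L \<MM> ?A (self ?A) {}"
    using eqtp_iff_tp[OF tt(2,1)] by blast
  then have "tp L \<MM> ?A h {} = tp L \<MM> ?A (\<lambda>m. m) {}"
    using tp_cong[of ?A "tot ?A h" h] tp_cong[of ?A "self ?A" "\<lambda>m. m"] by simp
  moreover have "small \<kappa> ?A" using small_Un small_image V A by blast
  ultimately have "?A \<subseteq> U \<and> small \<kappa> ?A \<and> h ` ?A \<subseteq> U \<and> tp L \<MM> ?A h {} = tp L \<MM> ?A (\<lambda>m. m) {}"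
    using AU hU by (intro conjI)
  then have "\<exists>g. automorphism L \<MM> g \<and> (\<forall>a\<in>?A. g a = h a)"
    using homogeneous unfolding strongly_homogeneous_def by metis
  then obtain g where "automorphism L \<MM> g" "\<forall>a\<in>?A. g a = h a" by blast
  then show thesis using that hb hA by auto
qed

end

section \<open>Elementary substructures\<close>

lemma finite_subset_UN_chain:
  fixes N :: "nat \<Rightarrow> 'a set"
  assumes "finite X" "X \<subseteq> (\<Union>n. N n)" "\<And>n. N n \<subseteq> N (Suc n)"
  obtains n where "X \<subseteq> N n"
proof -
  have "\<exists>n. X \<subseteq> N n"
    using assms(1,2)
  proof (induction X rule: finite_induct)
    case (insert x X)
    then obtain m n where mn: "X \<subseteq> N m" "x \<in> N n" by auto
    have "N m \<subseteq> N (max m n)" "N n \<subseteq> N (max m n)"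
      using lift_Suc_mono_le[of N] assms(3) by auto
    then show ?case using mn by (intro exI[of _ "max m n"]) auto
  qed simp
  then show thesis using that by blast
qed

context fo_struct
begin

text \<open>Keeping the values of bound variables on a stack avoids substitution into formulas.\<close>

definition tarski_vaught :: "'m set \<Rightarrow> bool" where
  "tarski_vaught N \<longleftrightarrow> N \<subseteq> U \<and>
    (\<forall>\<phi> s. wf_fm L (Suc (length s)) \<phi> \<and> names \<phi> \<subseteq> N \<and> set s \<subseteq> N \<and>
      (\<exists>a\<in>U. sat \<MM> (a # s) (\<lambda>m. m) \<phi>) \<longrightarrow> (\<exists>a\<in>N. sat \<MM> (a # s) (\<lambda>m. m) \<phi>))"

lemma tarski_vaughtD:
  assumes "tarski_vaught N" "wf_fm L (Suc (length s)) \<phi>" "names \<phi> \<subseteq> N" "set s \<subseteq> N"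
    "a \<in> U" "sat \<MM> (a # s) (\<lambda>m. m) \<phi>"
  obtains a' where "a' \<in> N" "sat \<MM> (a' # s) (\<lambda>m. m) \<phi>"
  using assms unfolding tarski_vaught_def by metis

lemma tarski_vaught_elem_sub:
  assumes N: "tarski_vaught N"
  shows "elem_sub L N \<MM>"
proof -
  have NU: "N \<subseteq> U" using N by (simp add: tarski_vaught_def)
  \<comment> \<open>A valid formula has a witness in \<open>N\<close>, so \<open>N\<close> is
    nonempty.\<close>
  obtain n where "n \<in> N"
    by (rule tarski_vaughtD[OF N, of "[]" "Imp Bot Bot" pt]) auto
  moreover have "fun_of \<MM> f xs \<in> N" if f: "farity L f = Some (length xs)" "set xs \<subseteq> N" for f xs
  proof -
    \<comment> \<open>The equation has a solution in \<open>N\<close>, and its only solution is the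
      value of the function.\<close>
    let ?\<phi> = "Eq (Bnd 0) (Fn f (map Var xs)) :: ('f, 'r, 'm) fm"
    have fU: "fun_of \<MM> f xs \<in> U"
      using is_struct f NU by (auto simp: is_struct_def)
    obtain a where "a \<in> N" "sat \<MM> [a] (\<lambda>m. m) ?\<phi>"
      by (rule tarski_vaughtD[OF N, of "[]" ?\<phi> "fun_of \<MM> f xs"])
        (use f fU in \<open>auto simp: list_all_iff comp_def\<close>)
    then show ?thesis by (simp add: comp_def)
  qed
  ultimately have "is_struct L (\<MM>\<lparr>univ := N\<rparr>)" by (auto simp: is_struct_def)
  moreover have val: "val (\<MM>\<lparr>univ := N\<rparr>) s e t = val \<MM> s e t" for s and e :: "'m \<Rightarrow> 'm" and t
    by (induction t) (auto intro!: arg_cong[where f = "fun_of \<MM> _"])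
  have "sat (\<MM>\<lparr>univ := N\<rparr>) s (\<lambda>m. m) \<phi> = sat \<MM> s (\<lambda>m. m) \<phi>"
    if "wf_fm L (length s) \<phi>" "names \<phi> \<subseteq> N" "set s \<subseteq> N" for s \<phi>
    using that
  proof (induction \<phi> arbitrary: s)
    case (Rel r ts)
    have "map (val (\<MM>\<lparr>univ := N\<rparr>) s (\<lambda>m. m)) ts = map (val \<MM> s (\<lambda>m. m)) ts"
      using val by (intro map_cong refl)
    then show ?case by (simp only: sat.simps) simp
  next
    case (Imp \<phi> \<psi>)
    then show ?case using Imp.IH(1)[of s] Imp.IH(2)[of s] by simp
  next
    case (All \<phi>)
    have IH: "sat (\<MM>\<lparr>univ := N\<rparr>) (a # s) (\<lambda>m. m) \<phi> = sat \<MM> (a # s) (\<lambda>m. m) \<phi>" if "a \<in> N" for a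
      by (rule All.IH) (use All.prems that in auto)
    have "(\<forall>a\<in>N. sat \<MM> (a # s) (\<lambda>m. m) \<phi>) \<Longrightarrow> a \<in> U \<Longrightarrow> sat \<MM> (a # s) (\<lambda>m. m) \<phi>" for a
    proof (rule ccontr)
      assume *: "\<forall>a\<in>N. sat \<MM> (a # s) (\<lambda>m. m) \<phi>" "a \<in> U" "\<not> sat \<MM> (a # s) (\<lambda>m. m) \<phi>"
      obtain a' where "a' \<in> N" "sat \<MM> (a' # s) (\<lambda>m. m) (Neg \<phi>)"
        by (rule tarski_vaughtD[OF N, of s "Neg \<phi>" a]) (use All.prems * in \<open>auto simp: Neg_def\<close>)
      then show False using * by (simp add: Neg_def)
    qed
    then show ?case using IH NU by auto
  qed (simp_all add: val)
  ultimately show ?thesis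
    using NU by (auto simp: elem_sub_def holds_def)
qed

lemma tarski_vaught_UN_chain:
  fixes N :: "nat \<Rightarrow> 'm set"
  assumes N: "\<And>n. tarski_vaught (N n)" and chain: "\<And>n. N n \<subseteq> N (Suc n)"
  shows "tarski_vaught (\<Union>n. N n)"
  unfolding tarski_vaught_def
proof (intro conjI allI impI; (elim conjE bexE)?)
  show "(\<Union>n. N n) \<subseteq> U" using N unfolding tarski_vaught_def by blast
next
  fix \<phi> and s a
  assume *: "wf_fm L (Suc (length s)) \<phi>" "names \<phi> \<subseteq> (\<Union>n. N n)" "set s \<subseteq> (\<Union>n. N n)"
    "a \<in> U" "sat \<MM> (a # s) (\<lambda>m. m) \<phi>"
  have "finite (names \<phi> \<union> set s)" "names \<phi> \<union> set s \<subseteq> (\<Union>n. N n)" using * by auto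
  then obtain n where "names \<phi> \<union> set s \<subseteq> N n" by (rule finite_subset_UN_chain) (rule chain)
  then obtain a' where "a' \<in> N n" "sat \<MM> (a' # s) (\<lambda>m. m) \<phi>"
    using tarski_vaughtD[OF N *(1) _ _ *(4,5), of n] by auto
  then show "\<exists>a\<in>\<Union>n. N n. sat \<MM> (a # s) (\<lambda>m. m) \<phi>" by blast
qed

lemma loewenheim_skolem:
  fixes S :: "'s set"
  assumes S: "infinite S" "|dom (farity L)| \<le>o |S|" "|dom (rarity L)| \<le>o |S|"
    and A: "A \<subseteq> U" "|A| \<le>o |S|"
  obtains N where "A \<subseteq> N" "tarski_vaught N" "|N| \<le>o |S|"
proof -
  let ?F = "\<lambda>X. {\<phi> :: ('f, 'r, 'm) fm. (\<exists>k. wf_fm L k \<phi>) \<and> names \<phi> \<subseteq> X}"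
  \<comment> \<open>Skolem functions, one value for each formula and each stack of values.\<close>
  define w :: "('f, 'r, 'm) fm \<times> 'm list \<Rightarrow> 'm" where
    "w = (\<lambda>(\<phi>, s). if \<exists>a\<in>U. sat \<MM> (a # s) (\<lambda>m. m) \<phi>
      then SOME a. a \<in> U \<and> sat \<MM> (a # s) (\<lambda>m. m) \<phi> else pt)"
  have w: "w (\<phi>, s) \<in> U \<and> sat \<MM> (w (\<phi>, s) # s) (\<lambda>m. m) \<phi>"
    if "a \<in> U" "sat \<MM> (a # s) (\<lambda>m. m) \<phi>" for \<phi> s a
    using someI[of "\<lambda>a. a \<in> U \<and> sat \<MM> (a # s) (\<lambda>m. m) \<phi>" a] that by (auto simp: w_def)
  have wU: "w x \<in> U" for x
  proof (cases x)
    case (Pair \<phi> s)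
    then show ?thesis
    proof (cases "\<exists>a\<in>U. sat \<MM> (a # s) (\<lambda>m. m) \<phi>")
      case True
      then show ?thesis using w Pair by blast
    next
      case False
      then show ?thesis using Pair by (simp add: w_def)
    qed
  qed
  define step where "step X = X \<union> w ` (?F X \<times> lists X)" for X
  define N where "N n = (step ^^ n) A" for n
  have N: "N 0 = A" "N (Suc n) = step (N n)" for n by (simp_all add: N_def)
  have NU: "N n \<subseteq> U" for n
    by (induction n) (use A wU in \<open>auto simp: N step_def\<close>)
  have chain: "N n \<subseteq> N (Suc n)" for n by (auto simp: N step_def)
  have "|N n| \<le>o |S|" for n
  proof (induction n)
    case 0
    then show ?case using A N by simp
  next
    case (Suc n)
    then show ?case unfolding N step_def
      by (intro card_Un_ordLeq card_image_ordLeq card_Times_ordLeq card_lists_ordLeq card_wf_fm S)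
  qed
  then have "|\<Union>n. N n| \<le>o |S|" by (rule card_UN_nat_ordLeq[OF S(1)])
  moreover have "tarski_vaught (\<Union>n. N n)"
    unfolding tarski_vaught_def
  proof (intro conjI allI impI; (elim conjE bexE)?)
    show "(\<Union>n. N n) \<subseteq> U" using NU by blast
  next
    fix \<phi> and s a
    assume *: "wf_fm L (Suc (length s)) \<phi>" "names \<phi> \<subseteq> (\<Union>n. N n)" "set s \<subseteq> (\<Union>n. N n)"
      "a \<in> U" "sat \<MM> (a # s) (\<lambda>m. m) \<phi>"
    have "finite (names \<phi> \<union> set s)" "names \<phi> \<union> set s \<subseteq> (\<Union>n. N n)" using * by auto
    then obtain n where "names \<phi> \<union> set s \<subseteq> N n" by (rule finite_subset_UN_chain) (rule chain)
    then have "(\<phi>, s) \<in> ?F (N n) \<times> lists (N n)" using *(1) by auto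
    then have "w (\<phi>, s) \<in> N (Suc n)" unfolding N step_def by blast
    then show "\<exists>a\<in>\<Union>n. N n. sat \<MM> (a # s) (\<lambda>m. m) \<phi>" using w *(4,5) by blast
  qed
  moreover have "A \<subseteq> (\<Union>n. N n)" using N by blast
  ultimately show thesis using that by blast
qed

section \<open>Global types as ultrafilters of definable predicates\<close>

text \<open>A predicate may be defined by several formulas; \<open>forces_rep\<close> shows that it
  does not matter which of them is tested for membership in a global type.\<close>

definition forces :: "('f, 'r, 'v + 'm) fm set \<Rightarrow> (('v \<Rightarrow> 'm) \<Rightarrow> bool) \<Rightarrow> bool" where
  "forces p R \<longleftrightarrow> (\<exists>\<phi>\<in>p. \<forall>a. tup a \<longrightarrow> R a = holds_at a \<phi>)"

lemma forces_sat:
  assumes p: "global_type L \<MM> V p" and K: "finite K" "\<And>k. k \<in> K \<Longrightarrow> forces p (R k)"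
  shows "\<exists>a. tup a \<and> (\<forall>k\<in>K. R k a)"
proof -
  have "\<forall>k\<in>K. \<exists>\<phi>. \<phi> \<in> p \<and> (\<forall>a. tup a \<longrightarrow> R k a = holds_at a \<phi>)"
    using K(2) unfolding forces_def by blast
  from bchoice[OF this] obtain \<phi> where
    \<phi>: "\<forall>k\<in>K. \<phi> k \<in> p \<and> (\<forall>a. tup a \<longrightarrow> R k a = holds_at a (\<phi> k))" ..
  then have "\<phi> ` K \<subseteq> p" "finite (\<phi> ` K)" using K(1) by auto
  then have "\<exists>a. range a \<subseteq> U \<and> realizes \<MM> a (\<phi> ` K)"
    using p unfolding global_type_def consistent_def by simp
  then obtain a where a: "tup a" "realizes \<MM> a (\<phi> ` K)" by (auto simp: tup_def)
  have "R k a" if "k \<in> K" for k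
    using \<phi> a that by (auto simp: realizes_def)
  then show ?thesis using a by blast
qed

text \<open>If \<open>p\<close> contained one formula defining \<open>R\<close> and omitted another,
  it would contain the negation of the latter, and two formulas of \<open>p\<close> would have no
  common solution.\<close>

lemma forces_rep:
  assumes p: "global_type L \<MM> V p" and \<phi>: "rep V U \<phi> R"
  shows "forces p R \<longleftrightarrow> \<phi> \<in> p"
proof
  assume R: "forces p R"
  show "\<phi> \<in> p"
  proof (rule ccontr)
    assume "\<phi> \<notin> p"
    then have "Neg \<phi> \<in> p" using p rep_fms[OF \<phi>] by (auto simp: global_type_def)
    then have "forces p (\<lambda>a. \<not> R a)"
      unfolding forces_def using repD[OF rep_not[OF \<phi>]] by blast
    then have "\<exists>a. tup a \<and> (\<forall>S\<in>{R, \<lambda>a. \<not> R a}. S a)"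
      using R by (intro forces_sat[OF p]) auto
    then show False by auto
  qed
next
  assume "\<phi> \<in> p"
  then show "forces p R" unfolding forces_def using repD[OF \<phi>] by blast
qed

lemma forces_not:
  assumes p: "global_type L \<MM> V p" and R: "defn V U R"
  shows "forces p (\<lambda>a. \<not> R a) \<longleftrightarrow> \<not> forces p R"
proof -
  obtain \<phi> where \<phi>: "rep V U \<phi> R" using R defn_def by blast
  have "\<not> forces p (\<lambda>a. \<not> R a) \<Longrightarrow> forces p R"
    using forces_rep[OF p \<phi>] forces_rep[OF p rep_not[OF \<phi>]] rep_fms[OF \<phi>] p
    by (auto simp: global_type_def)
  moreover have False if "forces p R" "forces p (\<lambda>a. \<not> R a)"
  proof -
    have "\<exists>a. tup a \<and> (\<forall>S\<in>{R, \<lambda>a. \<not> R a}. S a)"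
      using that by (intro forces_sat[OF p]) auto
    then show False by auto
  qed
  ultimately show ?thesis by blast
qed

text \<open>Stated as an equivalence, so that the failure of a predicate at \<open>a\<close> is also
  read off from \<open>p\<close>; for a global type it agrees with realizing the restriction to
  \<open>A\<close>.\<close>

definition realizing :: "('f, 'r, 'v + 'm) fm set \<Rightarrow> 'v set \<Rightarrow> 'm set \<Rightarrow> ('v \<Rightarrow> 'm) \<Rightarrow> bool" where
  "realizing p V A a \<longleftrightarrow> (\<forall>R. defn V A R \<longrightarrow> R a = forces p R)"

lemma realizingD: "realizing p V A a \<Longrightarrow> defn V A R \<Longrightarrow> R a = forces p R"
  unfolding realizing_def by blast

lemma realizing_mono: "realizing p V A a \<Longrightarrow> B \<subseteq> A \<Longrightarrow> realizing p V B a"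
  unfolding realizing_def using defn_mono by blast

lemma realizingI:
  assumes p: "global_type L \<MM> V p" and A: "A \<subseteq> U"
    and "\<And>R. defn V A R \<Longrightarrow> forces p R \<Longrightarrow> R a"
  shows "realizing p V A a"
  unfolding realizing_def
proof (intro allI impI)
  fix R assume R: "defn V A R"
  show "R a = forces p R"
    using assms(3)[OF R] assms(3)[OF defn_not[OF R]] forces_not[OF p, of R] defn_mono[OF R order_refl A]
    by blast
qed

lemma realizing_iff_realizes:
  assumes p: "global_type L \<MM> V p" and A: "A \<subseteq> U" and a: "tup a"
  shows "realizing p V A a \<longleftrightarrow> realizes \<MM> a (p \<inter> fms L V A)"
proof
  assume r: "realizing p V A a"
  show "realizes \<MM> a (p \<inter> fms L V A)"
    unfolding realizes_def
  proof
    fix \<phi> assume \<phi>: "\<phi> \<in> p \<inter> fms L V A"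
    then have "forces p (\<lambda>a. holds_at a \<phi>)" by (auto simp: forces_def)
    then show "holds_at a \<phi>" using realizingD[OF r defnI] \<phi> by blast
  qed
next
  assume r: "realizes \<MM> a (p \<inter> fms L V A)"
  show "realizing p V A a"
  proof (rule realizingI[OF p A])
    fix R assume "defn V A R" and f: "forces p R"
    then obtain \<phi> where \<phi>: "rep V A \<phi> R" using defn_def by blast
    then have "rep V U \<phi> R" using fms_mono[of V V A U] A by (auto simp: rep_def)
    then have "\<phi> \<in> p \<inter> fms L V A" using forces_rep[OF p] f rep_fms[OF \<phi>] by blast
    then show "R a" using r repD[OF \<phi> a] by (auto simp: realizes_def)
  qed
qed

lemma realizes_cong:
  assumes "q \<subseteq> fms L V A" "\<And>v. v \<in> V \<Longrightarrow> a v = b v"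
  shows "realizes \<MM> a q = realizes \<MM> b q"
  unfolding realizes_def using holds_fms_cong[of _ V A a b] assms by (intro ball_cong) auto

text \<open>Brings the parameters of a predicate into the form used in the definition of \<^const>\<open>invariant\<close>.\<close>

lemma defn2_nat_params:
  fixes Q :: "('v \<Rightarrow> 'm) \<Rightarrow> ('w \<Rightarrow> 'm) \<Rightarrow> bool"
  assumes M: "M \<subseteq> U" and Q: "defn2 V W M Q"
  obtains n \<phi> and B :: "('w \<Rightarrow> 'm) \<Rightarrow> nat \<Rightarrow> 'm" where "\<phi> \<in> fms L V {..<n}"
    "\<And>a. tup a \<Longrightarrow> tup (B a)"
    "\<And>a. tup a \<Longrightarrow> rep V U (inst (B a) \<phi>) (\<lambda>x. Q x a)"
    "\<And>w w'. tup w \<Longrightarrow> tup w' \<Longrightarrow> eqtp W M w w' \<Longrightarrow> eqtp {..<n} M (B w) (B w')"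
proof -
  obtain \<phi> where \<phi>: "rep (V <+> W) M \<phi> (\<lambda>e. Q (\<lambda>v. e (Inl v)) (\<lambda>w. e (Inr w)))"
    using Q unfolding defn2_def defn_def by blast
  have nm: "names \<phi> \<subseteq> (V <+> W) <+> M" "wf_fm L 0 \<phi>" using rep_fms[OF \<phi>] by (auto simp: fms_def)
  \<comment> \<open>The places that receive natural numbers: the coordinates of the second tuple and
    the parameters from \<open>M\<close> that occur. The map \<open>h\<close> replaces them by their
    numbers, and \<open>b a\<close> restores their values.\<close>
  define Z :: "('w + 'm) set" where
    "Z = Inl ` {w. Inl (Inr w) \<in> names \<phi>} \<union> Inr ` {m. Inr m \<in> names \<phi>}"
  have "{w. Inl (Inr w) \<in> names \<phi>} = Inr -` (Inl -` names \<phi>)" "{m. Inr m \<in> names \<phi>} = Inr -` names \<phi>"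
    by auto
  then have "finite Z" unfolding Z_def by (auto intro!: finite_vimageI finite_imageI)
  then obtain \<beta> where \<beta>: "bij_betw \<beta> Z {0..<card Z}" using ex_bij_betw_finite_nat by blast
  define n where "n = card Z"
  have \<beta>n: "\<beta> z < n" "inv_into Z \<beta> (\<beta> z) = z" if "z \<in> Z" for z
    using \<beta> that by (auto simp: bij_betw_def n_def)
  have \<beta>i: "inv_into Z \<beta> k \<in> Z" if "k < n" for k
    using \<beta> that by (intro inv_into_into) (auto simp: bij_betw_def n_def)
  have ZWM: "Z \<subseteq> W <+> M" using nm by (auto simp: Z_def)
  define h :: "('v + 'w) + 'm \<Rightarrow> 'v + nat" where
    "h = case_sum (case_sum Inl (\<lambda>w. Inr (\<beta> (Inl w)))) (\<lambda>m. Inr (\<beta> (Inr m)))"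
  define b :: "('w \<Rightarrow> 'm) \<Rightarrow> nat \<Rightarrow> 'm" where
    "b a k = (if k < n then case inv_into Z \<beta> k of Inl w \<Rightarrow> a w | Inr m \<Rightarrow> m else pt)" for a k
  have ZD: "Inl w \<in> Z" if "Inl (Inr w) \<in> names \<phi>" for w using that by (auto simp: Z_def)
  have ZD': "Inr m \<in> Z" if "Inr m \<in> names \<phi>" for m using that by (auto simp: Z_def)
  have bU: "b a k \<in> U" if "tup a" for a k
    using that \<beta>i[of k] ZWM M by (auto simp: b_def split: sum.split)
  have hn: "h x \<in> V <+> {..<n}" if "x \<in> names \<phi>" for x
  proof (cases x)
    case (Inl y)
    show ?thesis
    proof (cases y)
      case (Inl v)
      then show ?thesis using \<open>x = Inl y\<close> nm that by (auto simp: h_def)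
    next
      case (Inr w)
      then show ?thesis using \<open>x = Inl y\<close> ZD[of w] \<beta>n(1)[of "Inl w"] that by (auto simp: h_def)
    qed
  next
    case (Inr m)
    then show ?thesis using ZD'[of m] \<beta>n(1)[of "Inr m"] that by (auto simp: h_def)
  qed
  then have \<phi>': "map_fm h \<phi> \<in> fms L V {..<n}" using nm by (auto simp: fms_def fm.set_map)
  have rep: "rep V U (inst (b a) (map_fm h \<phi>)) (\<lambda>x. Q x a)" if a: "tup a" for a
    unfolding rep_def
  proof (intro conjI allI impI)
    have "map_sum (\<lambda>v. v) (b a) (h x) \<in> V <+> U" if "x \<in> names \<phi>" for x
      using hn[OF that] bU[OF a] by auto
    then show "inst (b a) (map_fm h \<phi>) \<in> fms L V U"
      using nm by (auto simp: fms_def inst_def fm.set_map)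
  next
    fix x :: "'v \<Rightarrow> 'm" assume x: "tup x"
    have xa: "tup (case_sum x a)" using x a by (intro tupI) (auto split: sum.split)
    have "holds_at x (inst (b a) (map_fm h \<phi>)) =
      holds \<MM> ((case_sum x (\<lambda>m. m) \<circ> map_sum (\<lambda>v. v) (b a)) \<circ> h) \<phi>"
      by (simp only: inst_def holds_map_fm)
    also have "\<dots> = holds_at (case_sum x a) \<phi>"
    proof (rule holds_cong)
      fix y assume y: "y \<in> names \<phi>"
      have 1: "b a (\<beta> (Inl w)) = a w" if "y = Inl (Inr w)" for w
        using \<beta>n[OF ZD[of w]] y that by (simp add: b_def)
      have 2: "b a (\<beta> (Inr m)) = m" if "y = Inr m" for m
        using \<beta>n[OF ZD'[of m]] y that by (simp add: b_def)
      show "((case_sum x (\<lambda>m. m) \<circ> map_sum (\<lambda>v. v) (b a)) \<circ> h) y = case_sum (case_sum x a) (\<lambda>m. m) y"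
        using 1 2 by (auto simp: h_def split: sum.split)
    qed
    also have "\<dots> = Q x a" using repD[OF \<phi> xa] by simp
    finally show "Q x a = holds_at x (inst (b a) (map_fm h \<phi>))" ..
  qed
  have "eqtp {..<n} M (b w) (b w')" if w: "tup w" "tup w'" "eqtp W M w w'" for w w'
    unfolding eqtp_def
  proof (intro allI impI)
    fix R assume R: "defn {..<n} M R"
    have "defn W M (\<lambda>a. R (\<lambda>k. if tup a then b a k else pt))"
    proof (rule defn_subst[OF R order_refl])
      fix k assume k: "k \<in> {..<n}"
      then have "inv_into Z \<beta> k \<in> W <+> M" using \<beta>i ZWM by blast
      then show "(\<exists>w\<in>W. \<forall>a. tup a \<longrightarrow> (if tup a then b a k else pt) = a w) \<or>
        (\<exists>m\<in>M. \<forall>a. tup a \<longrightarrow> (if tup a then b a k else pt) = m)"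
        using k by (auto simp: b_def)
    qed (use bU in auto)
    from eqtpD[OF w(3) this] show "R (b w) = R (b w')" using w(1,2) by simp
  qed
  moreover have "tup (b a)" if "tup a" for a using bU[OF that] by (rule tupI)
  ultimately show thesis using that[OF \<phi>' _ rep] by blast
qed

text \<open>Invariance is defined for formulas with a finite numbered tuple of parameters; here it
  becomes available for predicates whose parameters form a tuple over any index set.\<close>

lemma invariant_forces:
  fixes Q :: "('v \<Rightarrow> 'm) \<Rightarrow> ('w \<Rightarrow> 'm) \<Rightarrow> bool"
  assumes p: "inv_type L \<MM> M V p" and M: "M \<subseteq> U" and Q: "defn2 V W M Q"
    and w: "tup w" "tup w'" "eqtp W M w w'"
  shows "forces p (\<lambda>x. Q x w) \<longleftrightarrow> forces p (\<lambda>x. Q x w')"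
proof -
  have gt: "global_type L \<MM> V p" and inv: "invariant L \<MM> M V p"
    using p by (simp_all add: inv_type_def)
  obtain n \<phi> and B :: "('w \<Rightarrow> 'm) \<Rightarrow> nat \<Rightarrow> 'm" where \<phi>: "\<phi> \<in> fms L V {..<n}"
    and B: "\<And>a. tup a \<Longrightarrow> tup (B a)"
    and rep: "\<And>a. tup a \<Longrightarrow> rep V U (inst (B a) \<phi>) (\<lambda>x. Q x a)"
    and eq: "\<And>w w'. tup w \<Longrightarrow> tup w' \<Longrightarrow> eqtp W M w w' \<Longrightarrow> eqtp {..<n} M (B w) (B w')"
    by (rule defn2_nat_params[OF M Q]) blast
  have "tp L \<MM> {..<n} (B w) M = tp L \<MM> {..<n} (B w') M"
    using eq[OF w] eqtp_iff_tp[OF B[OF w(1)] B[OF w(2)]] by blast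
  moreover have "B w ` {..<n} \<subseteq> U \<and> B w' ` {..<n} \<subseteq> U" using B[OF w(1)] B[OF w(2)] by auto
  ultimately have "inst (B w) \<phi> \<in> p \<longleftrightarrow> inst (B w') \<phi> \<in> p"
    using inv \<phi> unfolding invariant_def by metis
  then show ?thesis using forces_rep[OF gt rep[OF w(1)]] forces_rep[OF gt rep[OF w(2)]] by blast
qed

lemma realizing_eqtp: "realizing p V A a \<Longrightarrow> eqtp V A a b \<Longrightarrow> realizing p V A b"
  unfolding realizing_def eqtp_def by metis

section \<open>Morley sequences\<close>

definition morley :: "('f, 'r, 'v + 'm) fm set \<Rightarrow> 'v set \<Rightarrow> 'm set \<Rightarrow> (nat \<Rightarrow> 'v \<Rightarrow> 'm) \<Rightarrow> bool" where
  "morley p V M d \<longleftrightarrow> (\<forall>i. tup (d i) \<and> realizing p V (M \<union> (\<Union>j\<in>{..<i}. d j ` V)) (d i))"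

lemma morley_tup: "morley p V M d \<Longrightarrow> tup (d i)"
  and morley_realizing: "morley p V M d \<Longrightarrow> realizing p V (M \<union> (\<Union>j\<in>{..<i}. d j ` V)) (d i)"
  by (simp_all add: morley_def)

lemma morley_realizing_base: "morley p V M d \<Longrightarrow> realizing p V M (d i)"
  using morley_realizing realizing_mono by blast

lemma morley_iff_morley_seq:
  assumes p: "global_type L \<MM> V p" and M: "M \<subseteq> U" and d: "\<And>i. tup (d i)"
  shows "morley p V M d \<longleftrightarrow> morley_seq L \<MM> M V p d"
proof -
  have "M \<union> (\<Union>j\<in>{..<i}. d j ` V) \<subseteq> U" for i using M d by auto
  from realizing_iff_realizes[OF p this d] show ?thesis
    using d by (auto simp: morley_def morley_seq_def)
qed

lemma morley_seq_tot:
  assumes "morley_seq L \<MM> M V p c"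
  shows "morley_seq L \<MM> M V p (\<lambda>i. tot V (c i))" "tup (tot V (c i))"
proof -
  have c: "c i ` V \<subseteq> U" for i using assms by (simp add: morley_seq_def)
  then show "tup (tot V (c i))" by (rule tup_tot)
  have im: "tot V (c j) ` V = c j ` V" for j by auto
  have "realizes \<MM> (tot V (c i)) (p \<inter> fms L V A) = realizes \<MM> (c i) (p \<inter> fms L V A)" for i A
    by (rule realizes_cong[of _ V A]) auto
  then show "morley_seq L \<MM> M V p (\<lambda>i. tot V (c i))"
    using assms unfolding morley_seq_def im by simp
qed

lemma morley_subseq:
  assumes d: "morley p V M d" and s: "strict_mono s"
  shows "morley p V M (\<lambda>i. d (s i))"
  unfolding morley_def
proof (intro allI conjI)
  fix i
  show "tup (d (s i))" using d by (rule morley_tup)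
  have sub: "M \<union> (\<Union>j\<in>{..<i}. d (s j) ` V) \<subseteq> M \<union> (\<Union>j\<in>{..<s i}. d j ` V)"
    using s by (auto simp: strict_mono_def)
  show "realizing p V (M \<union> (\<Union>j\<in>{..<i}. d (s j) ` V)) (d (s i))"
    by (rule realizing_mono[OF morley_realizing[OF d] sub])
qed

lemma defn_split_last:
  fixes Q :: "(nat \<times> 'v \<Rightarrow> 'm) \<Rightarrow> bool"
  assumes Q: "defn ({..<Suc n} \<times> V) M Q"
  shows "defn2 V ({..<n} \<times> V) M (\<lambda>x y. Q (\<lambda>(l, v). if l = n then x v else y (l, v)))"
proof -
  have "defn (V <+> {..<n} \<times> V) M
    (\<lambda>e. Q (\<lambda>z. (\<lambda>z e. case z of (l, v) \<Rightarrow> if l = n then e (Inl v) else e (Inr (l, v))) z e))"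
  proof (rule defn_subst[OF Q order_refl])
    fix z assume z: "z \<in> {..<Suc n} \<times> V"
    let ?t = "\<lambda>z e. case z of (l, v) \<Rightarrow> if l = n then e (Inl v) else e (Inr (l, v))"
    have "\<exists>w\<in>V <+> {..<n} \<times> V. \<forall>e :: 'v + nat \<times> 'v \<Rightarrow> 'm. ?t z e = e w"
    proof (cases "fst z = n")
      case True
      then show ?thesis using z by (intro bexI[of _ "Inl (snd z)"]) (auto split: prod.split)
    next
      case False
      then show ?thesis using z by (intro bexI[of _ "Inr z"]) (auto split: prod.split)
    qed
    then show "(\<exists>w\<in>V <+> {..<n} \<times> V. \<forall>e :: 'v + nat \<times> 'v \<Rightarrow> 'm. tup e \<longrightarrow> ?t z e = e w) \<or>
        (\<exists>m\<in>M. \<forall>e :: 'v + nat \<times> 'v \<Rightarrow> 'm. tup e \<longrightarrow> ?t z e = m)" by blast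
  qed (auto split: prod.split)
  then show ?thesis by (simp add: defn2_def)
qed

text \<open>With the last row split off, the truth of \<open>Q\<close> along a sequence is the
  question whether \<open>p\<close> forces a predicate with parameters in the earlier rows. By
  induction these rows have the same type over \<open>M\<close> in both sequences, so invariance
  gives the same answer.\<close>

lemma morley_eqtp:
  assumes p: "inv_type L \<MM> M V p" and M: "M \<subseteq> U" and d: "morley p V M d" "morley p V M d'"
  shows "eqtp ({..<n} \<times> V) M (\<lambda>(l, v). d l v) (\<lambda>(l, v). d' l v)"
proof (induction n)
  case 0
  show ?case
    by (rule eqtp_agree) (use morley_tup[OF d(1)] morley_tup[OF d(2)] in \<open>auto intro!: tupI\<close>)
next
  case (Suc n)
  show ?case
    unfolding eqtp_def
  proof (intro allI impI)
    fix Q assume Q: "defn ({..<Suc n} \<times> V) M Q"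
    let ?Q = "\<lambda>x y. Q (\<lambda>(l, v). if l = n then x v else y (l, v))"
    have key: "Q (\<lambda>(l, v). d l v) = forces p (\<lambda>x. ?Q x (\<lambda>(l, v). d l v))" if d: "morley p V M d" for d
    proof -
      have "tup (\<lambda>(l, v). d l v)" using morley_tup[OF d] by (auto intro!: tupI)
      from defn2_fix[OF defn_split_last[OF Q] this order_refl]
      have "defn V (M \<union> (\<lambda>(l, v). d l v) ` ({..<n} \<times> V)) (\<lambda>x. ?Q x (\<lambda>(l, v). d l v))" .
      moreover have "(\<lambda>(l, v). d l v) ` ({..<n} \<times> V) = (\<Union>j\<in>{..<n}. d j ` V)" by auto
      ultimately have "?Q (d n) (\<lambda>(l, v). d l v) = forces p (\<lambda>x. ?Q x (\<lambda>(l, v). d l v))"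
        using realizingD[OF morley_realizing[OF d]] by simp
      moreover have "(\<lambda>(l, v). if l = n then d n v else (\<lambda>(l, v). d l v) (l, v)) = (\<lambda>(l, v). d l v)"
        by auto
      ultimately show ?thesis by (simp only:)
    qed
    have "tup (\<lambda>(l, v). d l v)" "tup (\<lambda>(l, v). d' l v)"
      using morley_tup[OF d(1)] morley_tup[OF d(2)] by (auto intro!: tupI)
    from invariant_forces[OF p M defn_split_last[OF Q] this Suc.IH]
    show "Q (\<lambda>(l, v). d l v) = Q (\<lambda>(l, v). d' l v)" using key[OF d(1)] key[OF d(2)] by simp
  qed
qed

text \<open>Morley sequences are indiscernible because a subsequence is again a Morley sequence in
  the same type.\<close>

lemma morley_seq_eqtp:
  assumes p: "inv_type L \<MM> M V p" and M: "M \<subseteq> U" and d: "morley p V M d"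
    and s: "strict_mono_on {..<n} s"
  shows "eqtp ({..<n} \<times> V) M (\<lambda>(l, v). d (s l) v) (\<lambda>(l, v). d l v)"
proof -
  \<comment> \<open>A finite increasing map is continued to all of \<open>nat\<close>; the values
    \<open>s (n - 1) + l\<close> for \<open>l \<ge> n\<close> lie above all earlier ones.\<close>
  define s' where "s' l = (if l < n then s l else s (n - 1) + l)" for l
  have "strict_mono s'"
  proof (rule strict_monoI)
    fix x y :: nat assume "x < y"
    moreover have "s x \<le> s (n - 1)" if "x < n"
      using strict_mono_on_leD[OF s, of x "n - 1"] that by auto
    ultimately show "s' x < s' y"
      using s by (auto simp: s'_def strict_mono_on_def)
  qed
  from morley_eqtp[OF p M morley_subseq[OF d this] d]
  have "eqtp ({..<n} \<times> V) M (\<lambda>(l, v). d (s' l) v) (\<lambda>(l, v). d l v)" .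
  moreover have "eqtp ({..<n} \<times> V) M (\<lambda>(l, v). d (s l) v) (\<lambda>(l, v). d (s' l) v)"
    by (rule eqtp_agree) (use morley_tup[OF d] in \<open>auto intro!: tupI simp: s'_def\<close>)
  ultimately show ?thesis using eqtp_trans by blast
qed

section \<open>Limits of sequences of tuples along an ultrafilter\<close>

text \<open>The average type of the sequence, finitely satisfiable in its members.\<close>

definition limt :: "nat set set \<Rightarrow> 'v set \<Rightarrow> (nat \<Rightarrow> 'v \<Rightarrow> 'm) \<Rightarrow> ('f, 'r, 'v + 'm) fm set" where
  "limt \<U> V c = {\<phi> \<in> fms L V U. {n. holds_at (c n) \<phi>} \<in> \<U>}"

lemma limt_global:
  assumes u: "ultra \<U>" and c: "\<And>n. tup (c n)"
  shows "global_type L \<MM> V (limt \<U> V c)"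
  unfolding global_type_def consistent_def
proof (intro conjI ballI allI impI)
  show "limt \<U> V c \<subseteq> fms L V U" by (auto simp: limt_def)
next
  fix F assume F: "F \<subseteq> limt \<U> V c" "finite F"
  then have "{n. \<forall>\<phi>\<in>F. holds_at (c n) \<phi>} \<in> \<U>"
    by (intro ultra_ball[OF u]) (auto simp: limt_def)
  then obtain n where "\<forall>\<phi>\<in>F. holds_at (c n) \<phi>"
    using ultra_nonempty[OF u] by blast
  then show "\<exists>a. range a \<subseteq> U \<and> realizes \<MM> a F"
    using c[of n] by (intro exI[of _ "c n"]) (simp add: tup_def realizes_def)
next
  fix \<phi> assume \<phi>: "\<phi> \<in> fms L V U"
  then have "Neg \<phi> \<in> fms L V U" by (simp add: fms_def Neg_def)
  moreover have "{n. holds_at (c n) (Neg \<phi>)} = - {n. holds_at (c n) \<phi>}"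
    by (auto simp: holds_def Neg_def)
  ultimately show "\<phi> \<in> limt \<U> V c \<or> Neg \<phi> \<in> limt \<U> V c"
    using \<phi> ultra_Compl[OF u] by (auto simp: limt_def)
qed

lemma forces_limt:
  assumes u: "ultra \<U>" and c: "\<And>n. tup (c n)" and R: "defn V U R"
  shows "forces (limt \<U> V c) R \<longleftrightarrow> {n. R (c n)} \<in> \<U>"
proof -
  obtain \<phi> where \<phi>: "rep V U \<phi> R" using R defn_def by blast
  then have "forces (limt \<U> V c) R \<longleftrightarrow> \<phi> \<in> limt \<U> V c" using forces_rep[OF limt_global[where c = c, OF u c]] by blast
  also have "\<dots> \<longleftrightarrow> {n. R (c n)} \<in> \<U>" using repD[OF \<phi>, of "c _"] c rep_fms[OF \<phi>] by (simp add: limt_def)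
  finally show ?thesis .
qed

text \<open>As each \<open>c n\<close> lies in \<open>M\<close>, the truth of an instance at
  \<open>c n\<close> depends only on the type over \<open>M\<close> of the remaining parameters, and
  membership in the average type is determined by these truth values.\<close>

lemma limt_inv_type:
  fixes c :: "nat \<Rightarrow> 'v \<Rightarrow> 'm"
  assumes u: "ultra \<U>" and c: "\<And>n. tup (c n)" and M: "\<And>n. c n ` V \<subseteq> M" "M \<subseteq> U"
  shows "inv_type L \<MM> M V (limt \<U> V c)"
  unfolding inv_type_def invariant_def
proof (intro conjI allI ballI impI limt_global[OF u c]; (elim conjE)?)
  fix k :: nat and b b' :: "nat \<Rightarrow> 'm" and \<phi>
  assume \<phi>: "\<phi> \<in> fms L V {..<k}" and b: "b ` {..<k} \<subseteq> U" "b' ` {..<k} \<subseteq> U"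
    and eq: "tp L \<MM> {..<k} b M = tp L \<MM> {..<k} b' M"
  have in_fms: "inst b \<phi> \<in> fms L V U" if "b ` {..<k} \<subseteq> U" for b
  proof -
    have "map_sum (\<lambda>v. v) b x \<in> V <+> U" if "x \<in> names \<phi>" for x
    proof -
      have "x \<in> V <+> {..<k}" using \<phi> that by (auto simp: fms_def)
      then show ?thesis using \<open>b ` {..<k} \<subseteq> U\<close> by auto
    qed
    then show ?thesis using \<phi> by (auto simp: fms_def inst_def fm.set_map)
  qed
  have "holds_at (c n) (inst b \<phi>) = holds_at (c n) (inst b' \<phi>)" for n
  proof -
    \<comment> \<open>Exchanges the roles: the variables become the parameters \<open>c n v\<close>
      from \<open>M\<close>, the numbered parameters become variables.\<close>
    define f :: "'v + nat \<Rightarrow> nat + 'm" where "f = case_sum (\<lambda>v. Inr (c n v)) Inl"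
    have "f x \<in> {..<k} <+> M" if "x \<in> names \<phi>" for x
    proof -
      have "x \<in> V <+> {..<k}" using \<phi> that by (auto simp: fms_def)
      then show ?thesis using M(1)[of n] by (auto simp: f_def)
    qed
    then have f: "map_fm f \<phi> \<in> fms L {..<k} M" using \<phi> by (auto simp: fms_def fm.set_map)
    have *: "holds_at (c n) (inst b \<phi>) = holds_at b (map_fm f \<phi>)" for b
      unfolding inst_def holds_map_fm
      by (rule holds_cong) (auto simp: f_def split: sum.split)
    have "map_fm f \<phi> \<in> tp L \<MM> {..<k} b M \<longleftrightarrow> map_fm f \<phi> \<in> tp L \<MM> {..<k} b' M" using eq by simp
    then show ?thesis using f * by (simp add: tp_def)
  qed
  then show "inst b \<phi> \<in> limt \<U> V c \<longleftrightarrow> inst b' \<phi> \<in> limt \<U> V c"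
    using in_fms b by (simp add: limt_def)
qed

text \<open>
  Whatever holds along a Morley sequence of the limit type holds along some distinct members of the
  original sequence; their order is lost, which is harmless for joint consistency.
\<close>

lemma limt_morley_reflect:
  assumes u: "ultra \<U>" "\<And>F. finite F \<Longrightarrow> - F \<in> \<U>" and c: "\<And>n. tup (c n)"
    and M: "\<And>n. c n ` V \<subseteq> M" "M \<subseteq> U" and d: "morley (limt \<U> V c) V M d"
    and Q: "defn ({..<j} \<times> V) M Q" "Q (\<lambda>(l, v). d l v)" and A: "A \<in> \<U>"
  shows "\<exists>\<nu>. inj_on \<nu> {..<j} \<and> \<nu> ` {..<j} \<subseteq> A \<and> Q (\<lambda>(l, v). c (\<nu> l) v)"
  using Q A
proof (induction j arbitrary: Q A)
  case 0
  have "Q (\<lambda>(l, v). d l v) = Q (\<lambda>(l, v). c (id l) v)"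
    by (rule defn_local[OF 0(1)]) (use morley_tup[OF d] c in \<open>auto intro!: tupI\<close>)
  then show ?case using 0 by (intro exI[of _ id]) simp
next
  case (Suc j)
  let ?d = "\<lambda>(l, v). d l v"
  let ?Q = "\<lambda>x y. Q (\<lambda>(l, v). if l = j then x v else y (l, v))"
  note Q2 = defn_split_last[OF Suc.prems(1)]
  have td: "tup ?d" using morley_tup[OF d] by (auto intro!: tupI)
  have im: "?d ` ({..<j} \<times> V) = (\<Union>i\<in>{..<j}. d i ` V)" by auto
  have D: "defn V (M \<union> (\<Union>i\<in>{..<j}. d i ` V)) (\<lambda>x. ?Q x ?d)"
    using defn2_fix[OF Q2 td order_refl] unfolding im .
  have "(\<lambda>(l, v). if l = j then d j v else ?d (l, v)) = ?d" by auto
  then have "?Q (d j) ?d" using Suc.prems(2) by simp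
  then have "forces (limt \<U> V c) (\<lambda>x. ?Q x ?d)" using realizingD[OF morley_realizing[OF d] D] by simp
  moreover have "defn V U (\<lambda>x. ?Q x ?d)"
    by (rule defn_mono[OF D]) (use M(2) morley_tup[OF d] in auto)
  \<comment> \<open>The last row is replaced before the others: over them it realizes the limit
    type, so almost every \<open>c n\<close> can stand in for it.\<close>
  ultimately have "{n. ?Q (c n) ?d} \<in> \<U>" using forces_limt[where c = c, OF u(1) c] by blast
  from ultra_Int[OF u(1) this Suc.prems(3)] obtain n where n: "n \<in> A" "?Q (c n) ?d"
    using ultra_nonempty[OF u(1)] by blast
  have "defn ({..<j} \<times> V) M (\<lambda>y. ?Q (c n) y)"
    by (rule defn2_fix[OF defn2_swap[OF Q2] c]) (use M in auto)
  \<comment> \<open>Removing \<open>n\<close> from the admissible indices keeps the chosen members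
    distinct.\<close>
  moreover have "A \<inter> - {n} \<in> \<U>" using ultra_Int[OF u(1) Suc.prems(3)] u(2) by simp
  ultimately obtain \<nu> where \<nu>: "inj_on \<nu> {..<j}" "\<nu> ` {..<j} \<subseteq> A \<inter> - {n}"
    "?Q (c n) (\<lambda>(l, v). c (\<nu> l) v)"
    using Suc.IH n(2) by blast
  have "(\<lambda>(l, v). if l = j then c n v else (\<lambda>(l, v). c (\<nu> l) v) (l, v)) = (\<lambda>(l, v). c ((\<nu>(j := n)) l) v)"
    by auto
  then have "Q (\<lambda>(l, v). c ((\<nu>(j := n)) l) v)" using \<nu>(3) by simp
  moreover have "inj_on (\<nu>(j := n)) {..<Suc j}"
    using \<nu>(1,2) unfolding lessThan_Suc by (auto simp: inj_on_def)
  moreover have "(\<nu>(j := n)) ` {..<Suc j} \<subseteq> A" using \<nu>(2) n(1) unfolding lessThan_Suc by auto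
  ultimately show ?case by blast
qed

section \<open>Pulling back types along maps of variables\<close>

text \<open>The type of the tuple of all \<open>a (f x)\<close>, for \<open>a\<close> realizing
  \<open>p\<close>. It combines restriction to a subtuple with relabelling of the variables.\<close>

definition pull :: "'x set \<Rightarrow> ('x \<Rightarrow> 'y) \<Rightarrow> ('f, 'r, 'y + 'm) fm set \<Rightarrow> ('f, 'r, 'x + 'm) fm set" where
  "pull X f p = {\<theta> \<in> fms L X U. map_fm (map_sum f (\<lambda>m. m)) \<theta> \<in> p}"

lemma holds_rename:
  "holds_at a (map_fm (map_sum f (\<lambda>m. m)) \<theta>) =
    holds_at (\<lambda>x. a (f x)) \<theta>"
  unfolding holds_map_fm by (rule holds_cong) (auto split: sum.split)

lemma rename_fms:
  assumes "\<theta> \<in> fms L X A" "f ` X \<subseteq> Y"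
  shows "map_fm (map_sum f (\<lambda>m. m)) \<theta> \<in> fms L Y A"
proof -
  have "map_sum f (\<lambda>m. m) x \<in> Y <+> A" if "x \<in> names \<theta>" for x
  proof -
    have "x \<in> X <+> A" using assms(1) that by (auto simp: fms_def)
    then show ?thesis using assms(2) by auto
  qed
  then show ?thesis using assms(1) by (auto simp: fms_def fm.set_map)
qed

lemma pull_global:
  assumes p: "global_type L \<MM> Y p" and f: "f ` X \<subseteq> Y"
  shows "global_type L \<MM> X (pull X f p)"
  unfolding global_type_def consistent_def
proof (intro conjI ballI allI impI)
  show "pull X f p \<subseteq> fms L X U" by (auto simp: pull_def)
next
  fix F assume F: "F \<subseteq> pull X f p" "finite F"
  let ?F = "map_fm (map_sum f (\<lambda>m. m)) ` F"
  have "?F \<subseteq> p" "finite ?F" using F by (auto simp: pull_def)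
  then have "\<exists>a. range a \<subseteq> U \<and> realizes \<MM> a ?F"
    using p unfolding global_type_def consistent_def by simp
  then obtain a where a: "range a \<subseteq> U" "realizes \<MM> a ?F" by blast
  then show "\<exists>a. range a \<subseteq> U \<and> realizes \<MM> a F"
    by (intro exI[of _ "\<lambda>x. a (f x)"]) (auto simp: realizes_def holds_rename)
next
  fix \<theta> assume \<theta>: "\<theta> \<in> fms L X U"
  then have "Neg \<theta> \<in> fms L X U" by (simp add: fms_def Neg_def)
  moreover have "map_fm (map_sum f (\<lambda>m. m)) (Neg \<theta>) = Neg (map_fm (map_sum f (\<lambda>m. m)) \<theta>)"
    by (simp add: Neg_def)
  ultimately show "\<theta> \<in> pull X f p \<or> Neg \<theta> \<in> pull X f p"
    using p \<theta> rename_fms[OF \<theta> f] by (auto simp: pull_def global_type_def)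
qed

lemma forces_pull:
  fixes f :: "'x \<Rightarrow> 'y"
  assumes p: "global_type L \<MM> Y p" and f: "f ` X \<subseteq> Y" and R: "defn X U R"
  shows "forces (pull X f p) R \<longleftrightarrow> forces p (\<lambda>a. R (\<lambda>x. a (f x)))"
proof -
  obtain \<theta> where \<theta>: "rep X U \<theta> R" using R defn_def by blast
  have "rep Y U (map_fm (map_sum f (\<lambda>m. m)) \<theta>) (\<lambda>a. R (\<lambda>x. a (f x)))"
    unfolding rep_def
  proof (intro conjI allI impI rename_fms[OF rep_fms[OF \<theta>] f])
    fix a :: "'y \<Rightarrow> 'm" assume "tup a"
    then have "tup (\<lambda>x. a (f x))" by (intro tupI) blast
    then show "R (\<lambda>x. a (f x)) = holds_at a (map_fm (map_sum f (\<lambda>m. m)) \<theta>)"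
      unfolding holds_rename by (rule repD[OF \<theta>])
  qed
  then show ?thesis
    using forces_rep[OF pull_global[OF p f] \<theta>] forces_rep[OF p] rep_fms[OF \<theta>] by (simp add: pull_def)
qed

lemma pull_inv_type:
  assumes p: "inv_type L \<MM> M Y p" and f: "f ` X \<subseteq> Y"
  shows "inv_type L \<MM> M X (pull X f p)"
  unfolding inv_type_def invariant_def
proof (intro conjI allI ballI impI; (elim conjE)?)
  show "global_type L \<MM> X (pull X f p)" using pull_global p f by (auto simp: inv_type_def)
next
  fix n :: nat and b b' :: "nat \<Rightarrow> 'm" and \<phi>
  assume \<phi>: "\<phi> \<in> fms L X {..<n}" and b: "b ` {..<n} \<subseteq> U" "b' ` {..<n} \<subseteq> U"
    and eq: "tp L \<MM> {..<n} b M = tp L \<MM> {..<n} b' M"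
  let ?r = "map_fm (map_sum f (\<lambda>m. m))"
  have comm: "map_fm (map_sum f (\<lambda>m. m)) (inst b \<phi>) = inst b (map_fm (map_sum f (\<lambda>m. m)) \<phi>)" for b
    unfolding inst_def fm.map_comp by (rule map_fm_cong_names) (simp add: sum.map_comp comp_def)
  have in_fms: "inst b \<phi> \<in> fms L X U" if "b ` {..<n} \<subseteq> U" for b
  proof -
    have "map_sum (\<lambda>v. v) b x \<in> X <+> U" if "x \<in> names \<phi>" for x
    proof -
      have "x \<in> X <+> {..<n}" using \<phi> that by (auto simp: fms_def)
      then show ?thesis using \<open>b ` {..<n} \<subseteq> U\<close> by auto
    qed
    then show ?thesis using \<phi> by (auto simp: fms_def inst_def fm.set_map)
  qed
  have "inst b (map_fm (map_sum f (\<lambda>m. m)) \<phi>) \<in> p \<longleftrightarrow> inst b' (map_fm (map_sum f (\<lambda>m. m)) \<phi>) \<in> p"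
  proof -
    have "\<forall>\<phi>\<in>fms L Y {..<n}. b ` {..<n} \<subseteq> U \<and> b' ` {..<n} \<subseteq> U \<and>
        tp L \<MM> {..<n} b M = tp L \<MM> {..<n} b' M \<longrightarrow> (inst b \<phi> \<in> p \<longleftrightarrow> inst b' \<phi> \<in> p)"
      using p unfolding inv_type_def invariant_def by blast
    then show ?thesis using rename_fms[OF \<phi> f] b eq by blast
  qed
  then show "inst b \<phi> \<in> pull X f p \<longleftrightarrow> inst b' \<phi> \<in> pull X f p"
    using in_fms b by (simp add: pull_def comm)
qed

end

context monster
begin

lemma realizing_exists:
  assumes p: "global_type L \<MM> V p" and V: "small \<kappa> V" and A: "small \<kappa> A" "A \<subseteq> U"
  shows "\<exists>a. tup a \<and> realizing p V A a"
proof -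
  have "\<exists>a. tup a \<and> (\<forall>R\<in>{R. defn V A R \<and> forces p R}. R a)"
  proof (rule saturation[OF V A])
    fix F assume F: "finite F" "F \<subseteq> {R. defn V A R \<and> forces p R}"
    show "\<exists>a. tup a \<and> (\<forall>R\<in>F. R a)"
      using forces_sat[OF p F(1), of "\<lambda>R. R"] F(2) by auto
  qed auto
  then obtain a where "tup a" "\<And>R. defn V A R \<Longrightarrow> forces p R \<Longrightarrow> R a" by blast
  then show ?thesis using realizingI[OF p A(2)] by blast
qed

lemma morley_exists:
  assumes p: "global_type L \<MM> V p" and V: "small \<kappa> V" and M: "small \<kappa> M" "M \<subseteq> U"
  shows "\<exists>d. morley p V M d"
proof -
  have "\<exists>a. small \<kappa> A \<and> A \<subseteq> U \<longrightarrow> tup a \<and> realizing p V A a" for A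
    using realizing_exists[OF p V, of A] by blast
  then obtain r where r: "\<And>A. small \<kappa> A \<Longrightarrow> A \<subseteq> U \<Longrightarrow> tup (r A) \<and> realizing p V A (r A)"
    by metis
  define B where "B n = ((\<lambda>A. A \<union> r A ` V) ^^ n) M" for n
  have B: "B 0 = M" "B (Suc n) = B n \<union> r (B n) ` V" for n by (simp_all add: B_def)
  have B': "small \<kappa> (B n) \<and> B n \<subseteq> U" for n
    by (induction n) (use M V r in \<open>auto simp: B intro!: small_Un small_image\<close>)
  have "B n = M \<union> (\<Union>j\<in>{..<n}. r (B j) ` V)" for n
    by (induction n) (auto simp: B lessThan_Suc)
  then have "morley p V M (\<lambda>n. r (B n))"
    unfolding morley_def using r B' by metis
  then show ?thesis by blast
qed

end

section \<open>Dividing\<close>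

context fo_struct
begin

definition kinc :: "'l set \<Rightarrow> nat \<Rightarrow> (('x \<Rightarrow> 'm) \<Rightarrow> ('v \<Rightarrow> 'm) \<Rightarrow> bool) \<Rightarrow> ('l \<Rightarrow> 'v \<Rightarrow> 'm) \<Rightarrow> bool" where
  "kinc I k R c \<longleftrightarrow> (\<forall>K\<subseteq>I. card K = k \<longrightarrow> \<not> joint R K c)"

text \<open>Dividing with a fixed bound, witnessed by a sequence of conjugates that is merely
  k-inconsistent. In this form it passes easily through compactness, subsequences and limits, and
  one \<open>k\<close> serves for whole trees and chains.\<close>

definition kdiv :: "nat \<Rightarrow> 'm set \<Rightarrow> 'v set \<Rightarrow> (('x \<Rightarrow> 'm) \<Rightarrow> ('v \<Rightarrow> 'm) \<Rightarrow> bool) \<Rightarrow> ('v \<Rightarrow> 'm) \<Rightarrow> bool" where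
  "kdiv k C V R b \<longleftrightarrow> (\<exists>c :: nat \<Rightarrow> 'v \<Rightarrow> 'm. (\<forall>l. tup (c l) \<and> eqtp V C (c l) b) \<and> kinc UNIV k R c)"

text \<open>The empty set of instances is always solvable. Because \<open>card\<close> of an
  infinite set is 0, positivity of \<open>k\<close> also ensures that every set of cardinality
  \<open>k\<close> is finite.\<close>

lemma kinc_pos: "kinc I k R c \<Longrightarrow> 0 < k"
  using tup_pt unfolding kinc_def by (metis card.empty empty_iff empty_subsetI gr0I)

lemma kinc_mono:
  assumes "kinc I k R c" "k \<le> k'"
  shows "kinc I k' R c"
  unfolding kinc_def
proof (intro allI impI)
  fix K assume K: "K \<subseteq> I" "card K = k'"
  then obtain K' where "K' \<subseteq> K" "card K' = k" using assms(2) obtain_subset_with_card_n by metis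
  then show "\<not> joint R K c" using assms(1) K unfolding kinc_def by blast
qed

lemma kinc_reindex:
  assumes c: "kinc I k R c" and h: "inj_on h J" "h ` J \<subseteq> I"
  shows "kinc J k R (\<lambda>l. c (h l))"
  unfolding kinc_def
proof (intro allI impI)
  fix K assume K: "K \<subseteq> J" "card K = k"
  then have "card (h ` K) = k" "h ` K \<subseteq> I"
    using card_image[OF inj_on_subset[OF h(1)]] h(2) by auto
  then have "\<not> joint R (h ` K) c" using c unfolding kinc_def by blast
  then show "\<not> joint R K (\<lambda>l. c (h l))" by simp
qed

lemma kinc_cong:
  assumes "defn2 X V A R" "\<And>l. tup (c l)" "\<And>l. tup (c' l)" "\<And>l v. l \<in> I \<Longrightarrow> v \<in> V \<Longrightarrow> c l v = c' l v"
  shows "kinc I k R c = kinc I k R c'"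
proof -
  have "R x (c l) = R x (c' l)" if "tup x" "l \<in> I" for x l
    using assms that by (intro defn2_local[OF assms(1)]) auto
  then show ?thesis unfolding kinc_def by (metis (no_types, lifting) subsetD)
qed

lemma defn_joint_rows:
  fixes R :: "('x \<Rightarrow> 'm) \<Rightarrow> ('v \<Rightarrow> 'm) \<Rightarrow> bool"
  assumes "defn2 X V M R" "finite K" "K \<subseteq> I" "M \<subseteq> A"
  shows "defn (I \<times> V) A (\<lambda>e. joint R K (\<lambda>l v. e (l, v)))"
  by (rule defn_joint[OF assms(1,2) _ _ assms(4)]) (use assms(3) in auto)

lemma fm_of_defn2:
  assumes "defn2 V W M R"
  obtains \<phi> where "\<phi> \<in> fms L V (W <+> M)"
    "\<And>x y. tup x \<Longrightarrow> tup y \<Longrightarrow> holds_at x (inst_over y \<phi>) = R x y"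
proof -
  obtain \<phi> where \<phi>: "rep (V <+> W) M \<phi> (\<lambda>e. R (\<lambda>v. e (Inl v)) (\<lambda>w. e (Inr w)))"
    using assms unfolding defn2_def defn_def by blast
  define h :: "('a + 'b) + 'm \<Rightarrow> 'a + ('b + 'm)" where
    "h = case_sum (case_sum Inl (\<lambda>w. Inr (Inl w))) (\<lambda>m. Inr (Inr m))"
  have "h n \<in> V <+> (W <+> M)" if "n \<in> names \<phi>" for n
  proof -
    have "n \<in> (V <+> W) <+> M" using that rep_fms[OF \<phi>] by (auto simp: fms_def)
    then show ?thesis by (auto simp: h_def)
  qed
  then have "map_fm h \<phi> \<in> fms L V (W <+> M)"
    using rep_fms[OF \<phi>] by (auto simp: fms_def fm.set_map)
  moreover have "holds_at x (inst_over y (map_fm h \<phi>)) = R x y"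
    if x: "tup x" "tup y" for x y
  proof -
    have "tup (case_sum x y)" using x by (intro tupI) (auto split: sum.split)
    from repD[OF \<phi> this] have "R x y = holds_at (case_sum x y) \<phi>" by simp
    also have "\<dots> = holds_at x (inst_over y (map_fm h \<phi>))"
      unfolding inst_over_def inst_def holds_map_fm
      by (rule holds_cong) (auto simp: h_def split: sum.split)
    finally show ?thesis ..
  qed
  ultimately show thesis using that by blast
qed

lemma defn2_of_fm:
  assumes "\<phi> \<in> fms L V (W <+> M)"
  shows "defn2 V W M (\<lambda>x y. holds_at x (inst_over y \<phi>))"
proof -
  define h :: "'a + ('b + 'm) \<Rightarrow> ('a + 'b) + 'm" where
    "h = case_sum (\<lambda>v. Inl (Inl v)) (case_sum (\<lambda>w. Inl (Inr w)) Inr)"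
  have "h n \<in> (V <+> W) <+> M" if "n \<in> names \<phi>" for n
  proof -
    have "n \<in> V <+> (W <+> M)" using that assms by (auto simp: fms_def)
    then show ?thesis by (auto simp: h_def)
  qed
  then have h: "map_fm h \<phi> \<in> fms L (V <+> W) M" using assms by (auto simp: fms_def fm.set_map)
  show ?thesis
    unfolding defn2_def
  proof (rule defn_holdsI[OF h])
    fix e :: "'a + 'b \<Rightarrow> 'm"
    show "holds_at (\<lambda>v. e (Inl v)) (inst_over (\<lambda>w. e (Inr w)) \<phi>) =
        holds_at e (map_fm h \<phi>)"
      unfolding inst_over_def inst_def holds_map_fm
      by (rule holds_cong) (auto simp: h_def split: sum.split)
  qed
qed

lemma consistent_insts:
  fixes c :: "nat \<Rightarrow> 'w \<Rightarrow> 'm"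
  shows "consistent \<MM> (range (\<lambda>i. inst_over (c i) \<phi>)) \<longleftrightarrow>
    (\<forall>K. finite K \<longrightarrow> (\<exists>x. tup x \<and> (\<forall>i\<in>K. holds_at x (inst_over (c i) \<phi>))))"
  unfolding consistent_def
proof (intro iffI allI impI)
  fix K :: "nat set" assume c: "\<forall>F\<subseteq>range (\<lambda>i. inst_over (c i) \<phi>). finite F \<longrightarrow> (\<exists>a. range a \<subseteq> U \<and> realizes \<MM> a F)"
    and K: "finite K"
  from c[THEN spec, of "(\<lambda>i. inst_over (c i) \<phi>) ` K"] K
  obtain a where "range a \<subseteq> U" "realizes \<MM> a ((\<lambda>i. inst_over (c i) \<phi>) ` K)" by auto
  then show "\<exists>x. tup x \<and> (\<forall>i\<in>K. holds_at x (inst_over (c i) \<phi>))"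
    unfolding tup_def realizes_def by auto
next
  fix F assume c: "\<forall>K :: nat set. finite K \<longrightarrow> (\<exists>x. tup x \<and> (\<forall>i\<in>K. holds_at x (inst_over (c i) \<phi>)))"
    and F: "F \<subseteq> range (\<lambda>i. inst_over (c i) \<phi>)" "finite F"
  obtain K where "finite K" "F = (\<lambda>i. inst_over (c i) \<phi>) ` K" using finite_subset_image[OF F(2,1)] by blast
  moreover from c this(1) obtain x where "tup x" "\<forall>i\<in>K. holds_at x (inst_over (c i) \<phi>)"
    by blast
  ultimately show "\<exists>a. range a \<subseteq> U \<and> realizes \<MM> a F" unfolding tup_def realizes_def by auto
qed

lemma inst_over_cong:
  assumes "\<phi> \<in> fms L V (W <+> M)" "\<And>w. w \<in> W \<Longrightarrow> y w = y' w"
  shows "inst_over y \<phi> = inst_over y' \<phi>"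
  unfolding inst_over_def inst_def
proof (rule map_fm_cong_names)
  fix n assume "n \<in> names \<phi>"
  then have "n \<in> V <+> (W <+> M)" using assms(1) by (auto simp: fms_def)
  then show "map_sum (\<lambda>v. v) (case_sum y (\<lambda>m. m)) n = map_sum (\<lambda>v. v) (case_sum y' (\<lambda>m. m)) n"
    using assms(2) by auto
qed

text \<open>The definition of \<open>TP2\<close> works with tuples indexed by \<open>nat\<close> and
  bounds at least 2, so the finitely many parameters that occur are numbered and the bound is raised
  to \<open>max 2 k\<close>.\<close>

lemma TP2I:
  fixes R :: "(nat \<Rightarrow> 'm) \<Rightarrow> ('v \<Rightarrow> 'm) \<Rightarrow> bool" and b :: "nat \<Rightarrow> nat \<Rightarrow> 'v \<Rightarrow> 'm"
  assumes M: "M \<subseteq> U" and R: "defn2 UNIV X M R" and b: "\<And>i j. tup (b i j)"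
    and rows: "\<And>i. kinc (UNIV :: nat set) k R (b i)"
    and paths: "\<And>\<sigma> K. finite K \<Longrightarrow> joint R K (\<lambda>i. b i (\<sigma> i))"
  shows "TP2 L \<MM>"
proof -
  obtain n \<phi> and B :: "('v \<Rightarrow> 'm) \<Rightarrow> nat \<Rightarrow> 'm" where \<phi>: "\<phi> \<in> fms L UNIV {..<n}"
    and B: "\<And>a. tup a \<Longrightarrow> tup (B a)"
    and rep: "\<And>a. tup a \<Longrightarrow> rep UNIV U (inst (B a) \<phi>) (\<lambda>x. R x a)"
    by (rule defn2_nat_params[OF M R]) blast
  have h: "holds_at x (inst (B (b i j)) \<phi>) = R x (b i j)" if "tup x" for x i j
    using repD[OF rep[OF b] that] by simp
  have 1: "\<phi> \<in> fms L UNIV UNIV" by (rule subsetD[OF fms_mono \<phi>]) simp_all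
  have 2: "range (B (b i j)) \<subseteq> U" for i j using B[OF b] by (simp add: tup_def)
  have 3: "\<not> consistent \<MM> ((\<lambda>j. inst (B (b i j)) \<phi>) ` J)" if J: "card J = max 2 k" for i J
  proof
    assume c: "consistent \<MM> ((\<lambda>j. inst (B (b i j)) \<phi>) ` J)"
    have "finite J" using J card.infinite[of J] by fastforce
    then obtain x where "range x \<subseteq> U" "realizes \<MM> x ((\<lambda>j. inst (B (b i j)) \<phi>) ` J)"
      using c unfolding consistent_def by blast
    then have "tup x \<and> (\<forall>j\<in>J. R x (b i j))" using h by (auto simp: realizes_def tup_def)
    moreover have "kinc UNIV (max 2 k) R (b i)" by (rule kinc_mono[OF rows]) simp
    ultimately show False using J unfolding kinc_def by blast
  qed
  have 4: "consistent \<MM> (range (\<lambda>i. inst (B (b i (\<sigma> i))) \<phi>))" for \<sigma>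
    unfolding consistent_def
  proof (intro allI impI)
    fix F assume F: "F \<subseteq> range (\<lambda>i. inst (B (b i (\<sigma> i))) \<phi>)" "finite F"
    obtain K where K: "finite K" "F = (\<lambda>i. inst (B (b i (\<sigma> i))) \<phi>) ` K"
      using finite_subset_image[OF F(2,1)] by blast
    obtain x where "tup x" "\<forall>i\<in>K. R x (b i (\<sigma> i))" using paths[OF K(1)] by blast
    then show "\<exists>a. range a \<subseteq> U \<and> realizes \<MM> a F"
      using K(2) h by (intro exI[of _ x]) (auto simp: realizes_def tup_def)
  qed
  show ?thesis
    unfolding TP2_def
    by (intro exI[of _ \<phi>] exI[of _ "max 2 k"] exI[of _ "\<lambda>i j. B (b i j)"] conjI allI impI 1 2 3 4) simp
qed

lemma pull_restrict: "f ` X \<subseteq> Y \<Longrightarrow> pull X f (p \<inter> fms L Y U) = pull X f p"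
  using rename_fms[of _ X U f Y] by (auto simp: pull_def)

text \<open>The coordinates may be picked by a different map in each row, as long as every
  \<open>f i\<close> pulls \<open>p\<close> back to the same type. This is what makes all paths
  through the array in Kim's lemma Morley sequences in one type.\<close>

lemma morley_pull:
  assumes p: "global_type L \<MM> Y p" and d: "morley p Y M d" and M: "M \<subseteq> U"
    and f: "\<And>i. f i ` X \<subseteq> Y" "\<And>i. pull X (f i) p = p'"
  shows "morley p' X M (\<lambda>i x. d i (f i x))"
  unfolding morley_def
proof (intro allI conjI)
  fix i
  show "tup (\<lambda>x. d i (f i x))" using morley_tup[OF d, of i] by (intro tupI) blast
  let ?A = "M \<union> (\<Union>j\<in>{..<i}. (\<lambda>x. d j (f j x)) ` X)" and ?B = "M \<union> (\<Union>j\<in>{..<i}. d j ` Y)"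
  have "?A \<subseteq> ?B" using f(1) by auto
  moreover have "?B \<subseteq> U" using M morley_tup[OF d] by auto
  ultimately have AU: "?A \<subseteq> U" by (rule order_trans)
  show "realizing p' X ?A (\<lambda>x. d i (f i x))"
    unfolding realizing_def
  proof (intro allI impI)
    fix S assume S: "defn X ?A S"
    have "defn Y ?B (\<lambda>a. S (\<lambda>x. a (f i x)))"
      by (rule defn_subst[OF S \<open>?A \<subseteq> ?B\<close>]) (use f(1)[of i] in auto)
    from realizingD[OF morley_realizing[OF d] this]
    have "S (\<lambda>x. d i (f i x)) = forces p (\<lambda>a. S (\<lambda>x. a (f i x)))" .
    also have "\<dots> = forces (pull X (f i) p) S"
      using forces_pull[OF p f(1) defn_mono[OF S order_refl AU]] by simp
    finally show "S (\<lambda>x. d i (f i x)) = forces p' S" using f(2) by simp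
  qed
qed

lemma realizing_pull:
  assumes p: "global_type L \<MM> Y p" and a: "realizing p Y M a" and M: "M \<subseteq> U" and f: "f ` X \<subseteq> Y"
  shows "realizing (pull X f p) X M (\<lambda>x. a (f x))"
  unfolding realizing_def
proof (intro allI impI)
  fix S assume S: "defn X M S"
  have "defn Y M (\<lambda>a. S (\<lambda>x. a (f x)))"
    by (rule defn_subst[OF S order_refl]) (use f in auto)
  from realizingD[OF a this] show "S (\<lambda>x. a (f x)) = forces (pull X f p) S"
    using forces_pull[OF p f defn_mono[OF S order_refl M]] by simp
qed

lemma restrict_eq_of_realizing:
  assumes p: "global_type L \<MM> V p" "global_type L \<MM> V q" and M: "M \<subseteq> U"
    and a: "realizing p V M a" "realizing q V M a"
  shows "p \<inter> fms L V M = q \<inter> fms L V M"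
proof -
  have "\<phi> \<in> p \<longleftrightarrow> \<phi> \<in> q" if \<phi>: "\<phi> \<in> fms L V M" for \<phi>
  proof -
    have "rep V U \<phi> (\<lambda>a. holds_at a \<phi>)"
      using \<phi> fms_mono[OF order_refl M] by (auto simp: rep_def)
    then show ?thesis
      using forces_rep[OF p(1)] forces_rep[OF p(2)] realizingD[OF a(1) defnI[OF \<phi>]] realizingD[OF a(2) defnI[OF \<phi>]]
      by blast
  qed
  then show ?thesis by blast
qed

text \<open>Any \<open>n\<close> members look like the first \<open>n\<close>, and for large
  \<open>n\<close> these include the inconsistent part \<open>K\<close>. So a bound on
  \<open>K\<close> becomes a bound of inconsistency.\<close>

lemma kinc_of_inconsistent:
  fixes R :: "('x \<Rightarrow> 'm) \<Rightarrow> ('v \<Rightarrow> 'm) \<Rightarrow> bool" and d :: "nat \<Rightarrow> 'v \<Rightarrow> 'm"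
  assumes R: "defn2 X V M R"
    and seq: "\<And>n s. strict_mono_on {..<n} s \<Longrightarrow>
      eqtp ({..<n} \<times> V) M (\<lambda>(l, v). d (s l) v) (\<lambda>(l, v). d l v)"
    and K: "finite K" "\<not> joint R K d"
  shows "\<exists>n. kinc UNIV n R d"
proof -
  obtain n where n: "K \<subseteq> {..<n}" using K(1) by (auto simp: finite_nat_set_iff_bounded)
  have joint: "defn ({..<n} \<times> V) M (\<lambda>e. joint R {..<n} (\<lambda>l v. e (l, v)))"
    by (rule defn_joint_rows[OF R]) auto
  have "\<exists>x :: 'x \<Rightarrow> 'm. tup x" using tup_pt by blast
  then have "0 < n" using K(2) n by (cases n) auto
  have "kinc UNIV n R d"
    unfolding kinc_def
  proof (intro allI impI)
    fix K' :: "nat set" assume K': "card K' = n"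
    then have fin: "finite K'" using \<open>0 < n\<close> card.infinite by fastforce
    obtain s where s: "bij_betw s {..<card K'} K'" "strict_mono_on {..<card K'} s"
      using ex_bij_betw_strict_mono_card[OF fin] by blast
    from eqtpD[OF seq[OF s(2)[unfolded K']] joint]
    have "joint R {..<n} (\<lambda>l. d (s l)) = joint R {..<n} d" by simp
    moreover have "\<not> joint R {..<n} d" using K(2) n by blast
    moreover have "s ` {..<n} = K'" using s(1) K' by (simp add: bij_betw_def)
    ultimately show "\<not> joint R K' d" by (auto simp: image_iff)
  qed
  then show ?thesis by blast
qed

lemma morley_kinc:
  assumes p: "inv_type L \<MM> M V p" and M: "M \<subseteq> U" and d: "morley p V M d" and R: "defn2 X V M R"
    and K: "finite K" "\<not> joint R K d"
  shows "\<exists>n. kinc UNIV n R d"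
  by (rule kinc_of_inconsistent[OF R morley_seq_eqtp[OF p M d] K])

end

section \<open>The number of invariant types\<close>

context fo_struct
begin

text \<open>An invariant type is determined by which formulas it contains at which types of
  parameters over \<open>M\<close>. Recording this leaves the large model out of the count: the code
  is a subset of a small set when \<open>X\<close> and \<open>M\<close> are small.\<close>

definition inv_code :: "'m set \<Rightarrow> 'v set \<Rightarrow> ('f, 'r, 'v + 'm) fm set \<Rightarrow>
    (nat \<times> ('f, 'r, 'v + nat) fm \<times> ('f, 'r, nat + 'm) fm set) set" where
  "inv_code M X p = {(n, \<phi>, t). \<phi> \<in> fms L X {..<n} \<and>
    (\<exists>b. b ` {..<n} \<subseteq> U \<and> tp L \<MM> {..<n} b M = t \<and> inst b \<phi> \<in> p)}"

lemma inv_code_subset: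
  "inv_code M X p \<subseteq> UNIV \<times> fms L X UNIV \<times> Pow (fms L UNIV M)"
proof -
  have "fms L X {..<n} \<subseteq> fms L X UNIV" "fms L {..<n} M \<subseteq> fms L UNIV M" for n :: nat
    by (rule fms_mono; simp)+
  then show ?thesis unfolding inv_code_def tp_def by blast
qed

lemma inv_code_inj:
  assumes p: "inv_type L \<MM> M X p" "inv_type L \<MM> M X q" and pq: "inv_code M X p = inv_code M X q"
  shows "p = q"
proof -
  have "\<theta> \<in> q" if p: "inv_type L \<MM> M X p" "inv_type L \<MM> M X q" "inv_code M X p = inv_code M X q" "\<theta> \<in> p"
    for p q \<theta>
  proof -
    have \<theta>: "\<theta> \<in> fms L X U" using p by (auto simp: inv_type_def global_type_def)
    \<comment> \<open>Numbering the parameters of \<open>\<theta>\<close> exhibits it as an instance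
      of a formula recorded in the code.\<close>
    define Z where "Z = Inr -` names \<theta>"
    have Z: "finite Z" "Z \<subseteq> U" using \<theta> by (auto simp: Z_def fms_def intro!: finite_vimageI)
    obtain \<beta> where \<beta>: "bij_betw \<beta> Z {0..<card Z}" using ex_bij_betw_finite_nat[OF Z(1)] by blast
    define b where "b = inv_into Z \<beta>"
    let ?\<phi> = "map_fm (map_sum (\<lambda>v. v) \<beta>) \<theta>"
    have "map_sum (\<lambda>v. v) \<beta> x \<in> X <+> {..<card Z}" if "x \<in> names \<theta>" for x
    proof -
      have "x \<in> X <+> U" using \<theta> that by (auto simp: fms_def)
      moreover have "\<beta> m < card Z" if "x = Inr m" for m
        using \<beta> \<open>x \<in> names \<theta>\<close> that by (auto simp: bij_betw_def Z_def)
      ultimately show ?thesis by auto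
    qed
    then have \<phi>: "?\<phi> \<in> fms L X {..<card Z}" using \<theta> by (auto simp: fms_def fm.set_map)
    have "map_fm (map_sum (\<lambda>v. v) b \<circ> map_sum (\<lambda>v. v) \<beta>) \<theta> = map_fm (\<lambda>x. x) \<theta>"
    proof (rule map_fm_cong_names)
      fix x assume x: "x \<in> names \<theta>"
      have "b (\<beta> m) = m" if "x = Inr m" for m
        using \<beta> x that by (auto simp: b_def bij_betw_def Z_def)
      then show "(map_sum (\<lambda>v. v) b \<circ> map_sum (\<lambda>v. v) \<beta>) x = x" by (cases x rule: sum.exhaust) auto
    qed
    then have inst: "inst b ?\<phi> = \<theta>" by (simp add: inst_def fm.map_comp fm.map_ident)
    have "b ` {..<card Z} \<subseteq> Z"
      using \<beta> by (auto simp: b_def bij_betw_def atLeast0LessThan intro!: inv_into_into)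
    then have b: "b ` {..<card Z} \<subseteq> U" using Z(2) by blast
    have "(card Z, ?\<phi>, tp L \<MM> {..<card Z} b M) \<in> inv_code M X p"
      unfolding inv_code_def mem_Collect_eq prod.case using \<phi> b inst p(4)
      by (intro conjI exI[of _ b] refl) simp_all
    then have "(card Z, ?\<phi>, tp L \<MM> {..<card Z} b M) \<in> inv_code M X q" by (simp only: p(3))
    then obtain b' where b': "b' ` {..<card Z} \<subseteq> U" "tp L \<MM> {..<card Z} b' M = tp L \<MM> {..<card Z} b M"
      "inst b' ?\<phi> \<in> q"
      unfolding inv_code_def by auto
    have "inst b' ?\<phi> \<in> q \<longleftrightarrow> inst b ?\<phi> \<in> q"
      using p(2) \<phi> b b'(1,2) unfolding inv_type_def invariant_def by metis
    then show ?thesis using b'(3) inst by simp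
  qed
  then show ?thesis using assms by (metis subsetI subset_antisym)
qed

end

context monster
begin

section \<open>Small bounds and stretching of dividing sequences\<close>

lemma small_bound:
  fixes V :: "'v set" and A :: "'a set"
  assumes "small \<kappa> V" "small \<kappa> A"
  obtains S :: "(('v + 'a) + 'f + 'r + nat) set" where "infinite S" "small \<kappa> S"
    "|dom (farity L)| \<le>o |S|" "|dom (rarity L)| \<le>o |S|" "|V| \<le>o |S|" "|A| \<le>o |S|"
proof
  let ?S = "(V <+> A) <+> dom (farity L) <+> dom (rarity L) <+> (UNIV :: nat set)"
  show "infinite ?S" by (simp add: finite_Plus_iff)
  show "small \<kappa> ?S" using small_lang assms
    by (intro small_Plus small_nat) (auto elim!: small_ordLeq[rotated] intro: card_of_Plus1 card_of_Plus2)
  have inj: "|B| \<le>o |C|" if "f ` B \<subseteq> C" "inj_on f B" for B C and f :: "'u \<Rightarrow> 'w"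
    using that card_of_ordLeq by blast
  show "|dom (farity L)| \<le>o |?S|" by (rule inj[of "\<lambda>x. Inr (Inl x)"]) (auto simp: inj_on_def)
  show "|dom (rarity L)| \<le>o |?S|" by (rule inj[of "\<lambda>x. Inr (Inr (Inl x))"]) (auto simp: inj_on_def)
  show "|V| \<le>o |?S|" by (rule inj[of "\<lambda>x. Inl (Inl x)"]) (auto simp: inj_on_def)
  show "|A| \<le>o |?S|" by (rule inj[of "\<lambda>x. Inl (Inr x)"]) (auto simp: inj_on_def)
qed

lemma small_fms:
  assumes "small \<kappa> V" "small \<kappa> A"
  shows "small \<kappa> (fms L V A)"
  by (rule small_bound[OF assms]) (rule small_ordLeq[OF card_fms])

text \<open>By compactness: a finite part of \<open>\<Lambda>\<close> embeds into
  \<open>nat\<close>, and the countable sequence reindexed along the embedding meets all conditions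
  on that part. Long sequences are what the pigeonhole on types acts on.\<close>

lemma kdiv_stretch:
  fixes R :: "('x \<Rightarrow> 'm) \<Rightarrow> ('v \<Rightarrow> 'm) \<Rightarrow> bool" and \<Lambda> :: "'l set"
  assumes div: "kdiv k C V R b" and b: "tup b" and V: "small \<kappa> V" and C: "small \<kappa> C" "C \<subseteq> U"
    and R: "defn2 X V M R" "M \<subseteq> C" and \<Lambda>: "small \<kappa> \<Lambda>"
  obtains c where "\<And>l. tup (c l)" "\<And>l. l \<in> \<Lambda> \<Longrightarrow> eqtp V C (c l) b" "kinc \<Lambda> k R c"
proof -
  obtain c0 :: "nat \<Rightarrow> 'v \<Rightarrow> 'm" where c0: "\<And>l. tup (c0 l)" "\<And>l. eqtp V C (c0 l) b" "kinc UNIV k R c0"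
    using div unfolding kdiv_def by blast
  define \<R> :: "'l set \<Rightarrow> (('l \<times> 'v \<Rightarrow> 'm) \<Rightarrow> bool) set" where
    "\<R> I = {\<lambda>e. S (\<lambda>v. e (l, v)) | l S. l \<in> I \<and> defn V C S \<and> S b} \<union>
      {\<lambda>e. \<not> joint R K (\<lambda>l v. e (l, v)) | K. K \<subseteq> I \<and> card K = k}" for I
  have mono: "I \<subseteq> J \<Longrightarrow> \<R> I \<subseteq> \<R> J" for I J unfolding \<R>_def by blast
  have finK: "finite K" if "card K = k" for K :: "'l set"
    using that kinc_pos[OF c0(3)] card.infinite by fastforce
  obtain e where e: "tup e" "\<And>I Q. I \<in> {I. finite I \<and> I \<subseteq> \<Lambda>} \<Longrightarrow> Q \<in> \<R> I \<Longrightarrow> Q e"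
  proof (rule saturation_directed)
    show "small \<kappa> (\<Lambda> \<times> V)" by (rule small_Times[OF \<Lambda> V])
    show "{I. finite I \<and> I \<subseteq> \<Lambda>} \<noteq> {}" using empty_subsetI by blast
  next
    fix I J assume "I \<in> {I. finite I \<and> I \<subseteq> \<Lambda>}" "J \<in> {I. finite I \<and> I \<subseteq> \<Lambda>}"
    then show "\<exists>K\<in>{I. finite I \<and> I \<subseteq> \<Lambda>}. \<R> I \<union> \<R> J \<subseteq> \<R> K"
      using mono[of I "I \<union> J"] mono[of J "I \<union> J"] by (intro bexI[of _ "I \<union> J"] Un_least) simp_all
  next
    fix I Q assume I: "I \<in> {I. finite I \<and> I \<subseteq> \<Lambda>}" and "Q \<in> \<R> I"
    then show "defn (\<Lambda> \<times> V) C Q"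
      unfolding \<R>_def
    proof (elim UnE CollectE exE conjE)
      fix l S assume *: "Q = (\<lambda>e. S (\<lambda>v. e (l, v)))" "l \<in> I" "defn V C S"
      show "defn (\<Lambda> \<times> V) C Q"
        unfolding *(1) by (rule defn_subst[OF *(3) order_refl]) (use I *(2) in auto)
    next
      fix K assume *: "Q = (\<lambda>e. \<not> joint R K (\<lambda>l v. e (l, v)))" "K \<subseteq> I" "card K = k"
      have "K \<subseteq> \<Lambda>" using I *(2) by blast
      then show "defn (\<Lambda> \<times> V) C Q"
        unfolding *(1) by (intro defn_not defn_joint_rows[OF R(1) finK[OF *(3)] _ R(2)])
    qed
  next
    fix I assume "I \<in> {I. finite I \<and> I \<subseteq> \<Lambda>}"
    then have "finite I" by simp
    then obtain h :: "'l \<Rightarrow> nat" where h: "inj_on h I" using finite_imp_inj_to_nat_seg[of I] by blast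
    let ?e = "\<lambda>(l, v). c0 (h l) v"
    have "Q ?e" if "Q \<in> \<R> I" for Q
      using that unfolding \<R>_def
    proof (elim UnE CollectE exE conjE)
      fix l S assume "Q = (\<lambda>e. S (\<lambda>v. e (l, v)))" "defn V C S" "S b"
      then show "Q ?e" using eqtpD[OF c0(2)[of "h l"], of S] by simp
    next
      fix K assume "Q = (\<lambda>e. \<not> joint R K (\<lambda>l v. e (l, v)))" "K \<subseteq> I" "card K = k"
      moreover have "kinc I k R (\<lambda>l. c0 (h l))" by (rule kinc_reindex[OF c0(3) h]) simp
      ultimately show "Q ?e" unfolding kinc_def by simp
    qed
    moreover have "tup ?e" using c0(1) by (auto intro!: tupI)
    ultimately show "\<exists>e. tup e \<and> (\<forall>Q\<in>\<R> I. Q e)" by blast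
  qed (use C in auto)
  show thesis
  proof
    show "tup (\<lambda>v. e (l, v))" for l using e(1) by (intro tupI) blast
    show "eqtp V C (\<lambda>v. e (l, v)) b" if "l \<in> \<Lambda>" for l
    proof (rule eqtp_sym, rule eqtpI)
      fix S assume "defn V C S" "S b"
      then have "(\<lambda>e. S (\<lambda>v. e (l, v))) \<in> \<R> {l}" unfolding \<R>_def by blast
      from e(2)[OF _ this] that show "S (\<lambda>v. e (l, v))" by blast
    qed
    show "kinc \<Lambda> k R (\<lambda>l v. e (l, v))"
      unfolding kinc_def
    proof (intro allI impI)
      fix K assume K: "K \<subseteq> \<Lambda>" "card K = k"
      then have "(\<lambda>e. \<not> joint R K (\<lambda>l v. e (l, v))) \<in> \<R> K" unfolding \<R>_def by blast
      from e(2)[OF _ this] show "\<not> joint R K (\<lambda>l v. e (l, v))" using K finK by blast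
    qed
  qed
qed

end

section \<open>Kim's lemma for all invariant types\<close>

context monster
begin

text \<open>When all members of a sequence are read off from one tuple, its k-inconsistency is
  expressed by predicates in the type of that tuple. This makes each row of the array as
  inconsistent as the original sequence.\<close>

lemma kinc_eqtp:
  fixes R :: "('x \<Rightarrow> 'm) \<Rightarrow> ('v \<Rightarrow> 'm) \<Rightarrow> bool" and f :: "nat \<Rightarrow> 'v \<Rightarrow> 'y"
  assumes R: "defn2 W X M R" and e: "eqtp Y M a b" and f: "\<And>j. f j ` X \<subseteq> Y" and t: "tup a" "tup b"
    and kinc: "kinc UNIV k R (\<lambda>j x. a (f j x))"
  shows "kinc UNIV k R (\<lambda>j x. b (f j x))"
  unfolding kinc_def
proof (intro allI impI)
  fix K :: "nat set" assume K: "card K = k"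
  have fin: "finite K" using kinc_pos[OF kinc] K card.infinite by fastforce
  have "defn Y M (\<lambda>e. joint R K (\<lambda>j v. (\<lambda>j v e. e (f j v)) j v e))"
  proof (rule defn_joint[OF R fin _ _ order_refl])
    fix l v assume "l \<in> K" "v \<in> X"
    then show "(\<exists>z\<in>Y. \<forall>e :: 'y \<Rightarrow> 'm. tup e \<longrightarrow> e (f l v) = e z) \<or> (\<exists>m\<in>M. \<forall>e :: 'y \<Rightarrow> 'm. tup e \<longrightarrow> e (f l v) = m)"
      using f[of l] by blast
  qed auto
  from eqtpD[OF e this]
  have "joint R K (\<lambda>j v. a (f j v)) = joint R K (\<lambda>j v. b (f j v))" .
  moreover have "\<not> joint R K (\<lambda>j v. a (f j v))"
    using kinc K unfolding kinc_def by blast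
  ultimately show "\<not> joint R K (\<lambda>j v. b (f j v))" by simp
qed

text \<open>Since \<open>P\<close> extends the type of the monster over \<open>M\<close>, the set
  \<open>Z\<close> itself realizes the restriction of \<open>P\<close> to \<open>M\<close> in the
  variables \<open>Z\<close>. This identifies the invariant types with which the least type can be
  compared.\<close>

lemma least_types:
  assumes sw: "strong_witnessing L \<kappa> \<MM>" and M: "small_model L \<kappa> \<MM> M"
  obtains P where "\<And>Z. Z \<subseteq> U \<Longrightarrow> small \<kappa> Z \<Longrightarrow> least_type L \<MM> M Z (P \<inter> fms L Z U)"
    "\<And>Z. Z \<subseteq> U \<Longrightarrow> small \<kappa> Z \<Longrightarrow> realizing (P \<inter> fms L Z U) Z M (self Z)"
proof -
  have MU: "M \<subseteq> U" using M by (auto simp: small_model_def elem_sub_def)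
  obtain P where P: "global_type L \<MM> U P" and tpP: "tp L \<MM> U (\<lambda>m. m) M \<subseteq> P"
    and least: "\<And>Z. Z \<subseteq> U \<Longrightarrow> small \<kappa> Z \<Longrightarrow> least_type L \<MM> M Z (P \<inter> fms L Z U)"
    using sw M unfolding strong_witnessing_def by blast
  have tup_id: "tup (self Z)" if "Z \<subseteq> U" for Z using that by (intro tup_tot) auto
  have gt: "global_type L \<MM> Z (P \<inter> fms L Z U)" if "Z \<subseteq> U" "small \<kappa> Z" for Z
    using least[OF that] by (simp add: least_type_def inv_type_def)
  have idP: "realizing (P \<inter> fms L Z U) Z M (self Z)" if Z: "Z \<subseteq> U" "small \<kappa> Z" for Z
    unfolding realizing_iff_realizes[OF gt[OF Z] MU tup_id[OF Z(1)]] realizes_def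
  proof
    fix \<phi> assume \<phi>: "\<phi> \<in> P \<inter> fms L Z U \<inter> fms L Z M"
    show "holds_at (self Z) \<phi>"
    proof (rule ccontr)
      assume "\<not> ?thesis"
      then have "\<not> holds_at (\<lambda>m. m) \<phi>"
        using holds_fms_cong[of \<phi> Z M "self Z" "\<lambda>m. m"] \<phi> by auto
      moreover have "\<phi> \<in> fms L U M" using \<phi> fms_mono[OF Z(1) order_refl, of M] by blast
      ultimately have "Neg \<phi> \<in> tp L \<MM> U (\<lambda>m. m) M"
        by (auto simp: tp_def fms_def Neg_def holds_def)
      then have "{\<phi>, Neg \<phi>} \<subseteq> P" using tpP \<phi> by blast
      then have "\<exists>a. range a \<subseteq> U \<and> realizes \<MM> a {\<phi>, Neg \<phi>}"
        using P unfolding global_type_def consistent_def by simp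
      then show False by (auto simp: realizes_def Neg_def holds_def)
    qed
  qed
  show thesis by (rule that[OF least idP])
qed

text \<open>An inconsistent path makes all Morley sequences in \<open>p\<close> inconsistent, since
  they have the same type over \<open>M\<close>. For the comparison with \<open>q\<close>, both
  types are relabelled from \<open>X\<close> to a set \<open>Z\<close> listing a conjugate of
  \<open>X\<close>: there \<open>p\<close> becomes the restriction of \<open>P\<close>, and
  \<open>q\<close> keeps the required restriction to \<open>M\<close>. The tuple \<open>x\<close> is
  indexed by \<open>nat\<close>, as in \<open>TP2\<close> and \<open>divides_along\<close>.\<close>

lemma kdiv_all_morley_nat:
  fixes R :: "(nat \<Rightarrow> 'm) \<Rightarrow> ('m \<Rightarrow> 'm) \<Rightarrow> bool"
  assumes nTP2: "\<not> TP2 L \<MM>" and sw: "strong_witnessing L \<kappa> \<MM>"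
    and M: "small_model L \<kappa> \<MM> M" and X: "X \<subseteq> U" "small \<kappa> X"
    and R: "defn2 UNIV X M R" and div: "kdiv k M X R (self X)"
    and q: "inv_type L \<MM> M X q" "realizing q X M (self X)" and d: "morley q X M d"
  shows "\<exists>n. kinc UNIV n R d"
proof -
  have MU: "M \<subseteq> U" and sM: "small \<kappa> M" using M by (auto simp: small_model_def elem_sub_def)
  obtain P where least: "\<And>Z. Z \<subseteq> U \<Longrightarrow> small \<kappa> Z \<Longrightarrow> least_type L \<MM> M Z (P \<inter> fms L Z U)"
    and idP: "\<And>Z. Z \<subseteq> U \<Longrightarrow> small \<kappa> Z \<Longrightarrow> realizing (P \<inter> fms L Z U) Z M (self Z)"
    using least_types[OF sw M] by metis
  have tup_id: "tup (self Z)" if "Z \<subseteq> U" for Z using that by (intro tup_tot) auto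
  have inv: "inv_type L \<MM> M Z (P \<inter> fms L Z U)" if "Z \<subseteq> U" "small \<kappa> Z" for Z
    using least[OF that] by (simp add: least_type_def)
  then have gt: "global_type L \<MM> Z (P \<inter> fms L Z U)" if "Z \<subseteq> U" "small \<kappa> Z" for Z
    using that by (simp add: inv_type_def)
  \<comment> \<open>All codes of invariant types are subsets of \<open>D\<close>, so there are at
    most \<open>|Pow D|\<close> of them, and the index set \<open>Pow (Pow D)\<close> is strictly
    larger.\<close>
  define D where "D = (UNIV :: nat set) \<times> (fms L X UNIV :: ('f, 'r, 'm + nat) fm set) \<times>
    Pow (fms L UNIV M :: ('f, 'r, nat + 'm) fm set)"
  have sD: "small \<kappa> D"
    unfolding D_def by (intro small_Times small_Pow small_fms small_nat X sM)
  have "inj (\<lambda>n. (n :: nat, Bot :: ('f, 'r, 'm + nat) fm, {} :: ('f, 'r, nat + 'm) fm set))"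
    by (simp add: inj_def)
  moreover have "range (\<lambda>n. (n :: nat, Bot :: ('f, 'r, 'm + nat) fm, {} :: ('f, 'r, nat + 'm) fm set)) \<subseteq> D"
    by (auto simp: D_def fms_def)
  ultimately have "infinite D" by (metis finite_imageD finite_subset infinite_UNIV_nat)
  define \<Lambda> where "\<Lambda> = Pow (Pow D)"
  have "small \<kappa> \<Lambda>" unfolding \<Lambda>_def by (intro small_Pow sD)
  then obtain c where c: "\<And>l. tup (c l)" "\<And>l. l \<in> \<Lambda> \<Longrightarrow> eqtp X M (c l) (self X)" "kinc \<Lambda> k R c"
    using kdiv_stretch[OF div tup_id[OF X(1)] X(2) sM MU R order_refl] by blast
  have cX: "c l ` X \<subseteq> U" "small \<kappa> (c l ` X)" for l using c(1) X(2) small_image by auto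
  have pinv: "inv_type L \<MM> M X (pull X (c l) P)" for l
    using pull_inv_type[OF inv[OF cX[of l]] order_refl] unfolding pull_restrict[OF order_refl] .
  have "infinite (Pow D)" using \<open>infinite D\<close> by simp
  moreover have "(\<lambda>l. inv_code M X (pull X (c l) P)) ` \<Lambda> \<subseteq> Pow D"
    unfolding D_def using inv_code_subset by blast
  then have "|(\<lambda>l. inv_code M X (pull X (c l) P)) ` \<Lambda>| \<le>o |Pow D|" by (rule card_of_mono1)
  moreover have "|Pow D| <o |\<Lambda>|" unfolding \<Lambda>_def by (rule card_of_Pow)
  ultimately obtain y where "infinite {l \<in> \<Lambda>. inv_code M X (pull X (c l) P) = y}"
    by (rule infinite_fiber)
  then obtain h :: "nat \<Rightarrow> _" where h: "inj h" "range h \<subseteq> {l \<in> \<Lambda>. inv_code M X (pull X (c l) P) = y}"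
    unfolding infinite_iff_countable_subset by blast
  define c' where "c' j = c (h j)" for j
  define p where "p = pull X (c' 0) P"
  have hl: "h j \<in> \<Lambda>" "inv_code M X (pull X (c (h j)) P) = y" for j using h(2) by auto
  have pp: "pull X (c' j) P = p" for j
    unfolding p_def c'_def by (rule inv_code_inj[OF pinv pinv]) (simp add: hl)
  have c'_tup: "tup (c' j)" for j by (simp add: c'_def c(1))
  have c'_eqtp: "eqtp X M (c' j) (self X)" for j by (simp add: c'_def c(2) hl)
  have c'_kinc: "kinc UNIV k R c'"
    unfolding c'_def by (rule kinc_reindex[OF c(3) h(1)]) (use hl in blast)
  define Y where "Y = (\<Union>j. c' j ` X)"
  have c'Y: "c' j ` X \<subseteq> Y" for j by (auto simp: Y_def)
  have YU: "Y \<subseteq> U" using c'_tup by (auto simp: Y_def)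
  have "Y = (\<lambda>(j, x). c' j x) ` (UNIV \<times> X)" by (auto simp: Y_def)
  then have sY: "small \<kappa> Y" using small_image small_Times[OF small_nat X(2)] by metis
  let ?PY = "P \<inter> fms L Y U"
  note gtY = gt[OF YU sY]
  obtain I where I: "morley ?PY Y M I" using morley_exists[OF gtY sY sM MU] by blast
  have pullY: "pull X (c' j) ?PY = p" for j using pull_restrict[OF c'Y] pp by simp
  have rows: "kinc UNIV k R (\<lambda>j x. I i (c' j x))" for i
  proof (rule kinc_eqtp[OF R _ c'Y tup_id[OF YU] morley_tup[OF I]])
    show "eqtp Y M (self Y) (I i)"
      using idP[OF YU sY] morley_realizing_base[OF I, of i] unfolding eqtp_def realizing_def by metis
    have "kinc UNIV k R (\<lambda>j x. self Y (c' j x)) = kinc UNIV k R c'"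
    proof (rule kinc_cong[OF R])
      show "tup (\<lambda>x. self Y (c' l x))" for l using tup_id[OF YU] by (intro tupI) blast
      show "self Y (c' l x) = c' l x" if "x \<in> X" for l x using c'Y[of l] that by (intro tot_in) blast
    qed (rule c'_tup)
    then show "kinc UNIV k R (\<lambda>j x. self Y (c' j x))" using c'_kinc by simp
  qed
  \<comment> \<open>If all paths were consistent, the array would witness
    \<open>TP2\<close>.\<close>
  obtain \<sigma> K where K: "finite K" "\<not> joint R K (\<lambda>i v. I i (c' (\<sigma> i) v))"
  proof (rule ccontr)
    assume "\<not> thesis"
    then have paths: "joint R K (\<lambda>i v. I i (c' (\<sigma> i) v))" if "finite K" for \<sigma> K
      using that \<open>\<And>\<sigma> K. \<lbrakk>finite K; \<nexists>x. tup x \<and> (\<forall>i\<in>K. R x (\<lambda>v. I i (c' (\<sigma> i) v)))\<rbrakk> \<Longrightarrow> thesis\<close> by blast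
    have "TP2 L \<MM>"
    proof (rule TP2I[OF MU R])
      show "tup (\<lambda>x. I i (c' j x))" for i j using morley_tup[OF I, of i] by (intro tupI) blast
    qed (rule rows, rule paths)
    then show False using nTP2 by blast
  qed
  have d0: "morley p X M (\<lambda>i x. I i (c' (\<sigma> i) x))"
    by (rule morley_pull[OF gtY I MU c'Y pullY])
  \<comment> \<open>The first selected conjugate provides the relabelling. It is injective because
    \<open>self X\<close> lists \<open>X\<close> without repetition and has the same type over
    \<open>M\<close>.\<close>
  define f where "f = c' 0"
  have "inj_on f X"
  proof (rule inj_onI)
    fix x x' assume x: "x \<in> X" "x' \<in> X" "f x = f x'"
    then have "self X x = self X x'"
      using eqtpD[OF c'_eqtp[of 0] defn_eq[OF x(1,2)]] by (simp add: f_def)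
    then show "x = x'" using x by simp
  qed
  define Z where "Z = f ` X"
  define g where "g = inv_into X f"
  have gf: "g (f x) = x" if "x \<in> X" for x using \<open>inj_on f X\<close> that by (simp add: g_def)
  have fg: "f (g z) = z" "g z \<in> X" if "z \<in> Z" for z
    using that by (auto simp: g_def Z_def f_inv_into_f inv_into_into)
  have ZU: "Z \<subseteq> U" "small \<kappa> Z" using cX by (auto simp: Z_def f_def c'_def)
  have gZ: "g ` Z \<subseteq> X" using fg by auto
  let ?PZ = "P \<inter> fms L Z U"
  note gtZ = gt[OF ZU]
  have pullZ: "pull X f ?PZ = p" by (simp add: pull_restrict Z_def f_def p_def)
  have q': "inv_type L \<MM> M Z (pull Z g q)" by (rule pull_inv_type[OF q(1) gZ])
  have gtq: "global_type L \<MM> X q" and gtq': "global_type L \<MM> Z (pull Z g q)"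
    using q(1) q' by (simp_all add: inv_type_def)
  have "realizing (pull Z g q) Z M (\<lambda>z. self X (g z))" by (rule realizing_pull[OF gtq q(2) MU gZ])
  moreover have "eqtp Z M (\<lambda>z. self X (g z)) (\<lambda>z. f (g z))"
    by (rule eqtp_subst[OF eqtp_sym]) (use c'_eqtp[of 0] fg in \<open>auto simp: f_def\<close>)
  moreover have "eqtp Z M (\<lambda>z. f (g z)) (self Z)"
  proof (rule eqtp_agree)
    show "tup (\<lambda>z. f (g z))" using c'_tup[of 0] unfolding f_def by (intro tupI) blast
  qed (use tup_id[OF ZU(1)] fg in auto)
  ultimately have idq': "realizing (pull Z g q) Z M (self Z)" using realizing_eqtp by blast
  have "pull Z g q \<inter> fms L Z M = ?PZ \<inter> fms L Z M"
    by (rule restrict_eq_of_realizing[OF gtq' gtZ MU idq' idP[OF ZU]])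
  then have kim: "kim_ge L \<MM> M Z (pull Z g q) ?PZ"
    using least[OF ZU] q' unfolding least_type_def by blast
  define R' where "R' x y = R x (\<lambda>v. y (f v))" for x and y :: "'m \<Rightarrow> 'm"
  have R': "defn2 UNIV Z M R'"
  proof -
    have "defn (UNIV <+> Z) M (\<lambda>e. (\<lambda>e. R (\<lambda>v. e (Inl v)) (\<lambda>w. e (Inr w)))
        (\<lambda>n. e (case n of Inl v \<Rightarrow> Inl v | Inr w \<Rightarrow> Inr (f w))))"
      by (rule defn_subst[OF R[unfolded defn2_def]]) (auto simp: Z_def)
    then show ?thesis by (simp add: defn2_def R'_def)
  qed
  obtain \<phi> where \<phi>: "\<phi> \<in> fms L UNIV (Z <+> M)"
    "\<And>x y. tup x \<Longrightarrow> tup y \<Longrightarrow> holds_at x (inst_over y \<phi>) = R' x y"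
    using fm_of_defn2[OF R'] by blast
  define e where "e i z = d i (g z)" for i z
  have e: "morley (pull Z g q) Z M e"
    unfolding e_def by (rule morley_pull[OF gtq d MU gZ refl])
  have "eqtp Z M (self Z) (e 0)"
    using idq' morley_realizing_base[OF e, of 0] unfolding eqtp_def realizing_def by metis
  then have "realizing ?PZ Z M (e 0)" using realizing_eqtp[OF idP[OF ZU]] by blast
  then have "realizes \<MM> (e 0) (?PZ \<inter> fms L Z M)"
    using realizing_iff_realizes[OF gtZ MU morley_tup[OF e]] by blast
  \<comment> \<open>A Morley sequence in \<open>?PZ\<close> relabelled by \<open>f\<close> is a
    Morley sequence in \<open>p\<close>, so it has the type over \<open>M\<close> of the
    inconsistent path and fails on the same \<open>K\<close>.\<close>
  moreover have "divides_along L \<MM> M Z ?PZ \<phi> (e 0)"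
    unfolding divides_along_def
  proof (intro allI impI notI; elim conjE)
    fix a :: "nat \<Rightarrow> 'm \<Rightarrow> 'm"
    assume a: "morley_seq L \<MM> M Z ?PZ a" and cons: "consistent \<MM> (range (\<lambda>i. inst_over (a i) \<phi>))"
    define a' where "a' i = tot Z (a i)" for i
    have a't: "tup (a' i)" for i unfolding a'_def using morley_seq_tot(2)[OF a] .
    have "morley_seq L \<MM> M Z ?PZ a'" unfolding a'_def by (rule morley_seq_tot(1)[OF a])
    then have "morley ?PZ Z M a'" using morley_iff_morley_seq[where d = a', OF gtZ MU a't] by blast
    then have msa: "morley p X M (\<lambda>i x. a' i (f x))"
      by (rule morley_pull[OF gtZ _ MU _ pullZ]) (simp_all add: Z_def)
    have inst: "inst_over (a i) \<phi> = inst_over (a' i) \<phi>" for i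
      by (rule inst_over_cong[OF \<phi>(1)]) (simp add: a'_def)
    obtain x where x: "tup x" "\<forall>i\<in>K. holds_at x (inst_over (a i) \<phi>)"
      using cons K(1) unfolding consistent_insts by blast
    then have x': "\<forall>i\<in>K. R x (\<lambda>v. a' i (f v))" using \<phi>(2)[OF x(1) a't] inst by (simp add: R'_def)
    obtain n where n: "K \<subseteq> {..<n}" using K(1) by (auto simp: finite_nat_set_iff_bounded)
    have pinv': "inv_type L \<MM> M X p" unfolding p_def c'_def by (rule pinv)
    from eqtpD[OF morley_eqtp[OF pinv' MU msa d0] defn_joint_rows[OF R K(1) n order_refl]]
    have "joint R K (\<lambda>l v. a' l (f v)) = joint R K (\<lambda>l v. I l (c' (\<sigma> l) v))"
      by simp
    then show False using x(1) x' K(2) by blast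
  qed
  ultimately have "divides_along L \<MM> M Z (pull Z g q) \<phi> (e 0)"
    using kim \<phi>(1) morley_tup[OF e, of 0] unfolding kim_ge_def tup_def by blast
  moreover have "morley_seq L \<MM> M Z (pull Z g q) e"
    using e morley_iff_morley_seq[where d = e, OF gtq' MU morley_tup[OF e]] by blast
  ultimately have "\<not> consistent \<MM> (range (\<lambda>i. inst_over (e i) \<phi>))"
    unfolding divides_along_def by blast
  then obtain K' where K': "finite K'"
    "\<not> (\<exists>x. tup x \<and> (\<forall>i\<in>K'. holds_at x (inst_over (e i) \<phi>)))"
    unfolding consistent_insts by blast
  have "holds_at x (inst_over (e i) \<phi>) = R x (d i)" if x: "tup x" for x i
  proof -
    have "R x (\<lambda>v. e i (f v)) = R x (d i)"
    proof (rule defn2_local[OF R x _ x morley_tup[OF d]])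
      show "tup (\<lambda>v. e i (f v))" using morley_tup[OF e, of i] by (intro tupI) blast
    qed (simp_all add: e_def gf)
    then show ?thesis using \<phi>(2)[OF x morley_tup[OF e, of i]] by (simp add: R'_def)
  qed
  then have "\<not> joint R K' d" using K'(2) by metis
  from morley_kinc[OF q(1) MU d R K'(1) this] show ?thesis .
qed

text \<open>Only finitely many variables of \<open>x\<close> occur, and an injection
  \<open>\<beta>\<close> renames them by natural numbers. Solutions are carried over in both
  directions, so the bounds of inconsistency agree.\<close>

lemma kdiv_all_morley:
  fixes R :: "('x \<Rightarrow> 'm) \<Rightarrow> ('m \<Rightarrow> 'm) \<Rightarrow> bool"
  assumes nTP2: "\<not> TP2 L \<MM>" and sw: "strong_witnessing L \<kappa> \<MM>"
    and M: "small_model L \<kappa> \<MM> M" and X: "X \<subseteq> U" "small \<kappa> X"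
    and R: "defn2 UNIV X M R" and div: "kdiv k M X R (self X)"
    and q: "inv_type L \<MM> M X q" "realizing q X M (self X)" and d: "morley q X M d"
  shows "\<exists>n. kinc UNIV n R d"
proof -
  obtain W A0 where W: "finite W" "W \<subseteq> UNIV <+> X" "finite A0" "A0 \<subseteq> M"
    "defn W A0 (\<lambda>e. R (\<lambda>v. e (Inl v)) (\<lambda>w. e (Inr w)))"
    by (rule defn_finite[OF R[unfolded defn2_def]])
  define V where "V = Inl -` W"
  have "finite V" using W(1) by (simp add: V_def finite_vimageI)
  then obtain \<beta> :: "'x \<Rightarrow> nat" where \<beta>: "inj_on \<beta> V" using finite_imp_inj_to_nat_seg by blast
  have "W \<subseteq> V <+> X"
  proof
    fix x assume "x \<in> W" then show "x \<in> V <+> X" using W(2) by (cases x rule: sum.exhaust) (auto simp: V_def)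
  qed
  then have RV: "defn2 V X M R" unfolding defn2_def using defn_mono[OF W(5)] W(4) by blast
  define R' where "R' x y = R (\<lambda>v. x (\<beta> v)) y" for x :: "nat \<Rightarrow> 'm" and y
  have "defn (UNIV <+> X) M (\<lambda>e. (\<lambda>e. R (\<lambda>v. e (Inl v)) (\<lambda>w. e (Inr w)))
        (\<lambda>n. e (case n of Inl v \<Rightarrow> Inl (\<beta> v) | Inr w \<Rightarrow> Inr w)))"
    by (rule defn_subst[OF RV[unfolded defn2_def]]) auto
  then have R': "defn2 UNIV X M R'" by (simp add: defn2_def R'_def)
  have eq: "joint R' K c = joint R K c"
    if c: "\<And>l. tup (c l)" for K :: "nat set" and c
  proof
    assume "joint R' K c"
    then obtain x where x: "tup x" "\<forall>l\<in>K. R (\<lambda>v. x (\<beta> v)) (c l)" unfolding R'_def by blast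
    moreover have "tup (\<lambda>v. x (\<beta> v))" using x(1) by (intro tupI) blast
    ultimately show "joint R K c" by blast
  next
    assume "joint R K c"
    then obtain x where x: "tup x" "\<forall>l\<in>K. R x (c l)" by blast
    define x' where "x' n = x (inv_into V \<beta> n)" for n
    have x't: "tup x'" "tup (\<lambda>v. x' (\<beta> v))" unfolding x'_def using x(1) by (auto intro!: tupI)
    have "R (\<lambda>v. x' (\<beta> v)) (c l) = R x (c l)" for l
      by (rule defn2_local[OF RV x't(2) c x(1) c]) (simp_all add: x'_def \<beta>)
    then show "joint R' K c" using x(2) x't(1) unfolding R'_def by blast
  qed
  have kinc: "kinc UNIV n R' c = kinc UNIV n R c" if "\<And>l. tup (c l)" for n and c :: "nat \<Rightarrow> 'm \<Rightarrow> 'm"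
    unfolding kinc_def using eq[OF that] by simp
  have "kdiv k M X R' (self X)" using div kinc unfolding kdiv_def by blast
  from kdiv_all_morley_nat[OF nTP2 sw M X R' this q d] show ?thesis
    using kinc[of d] morley_tup[OF d] by blast
qed

end

section \<open>Independence\<close>

context fo_struct
begin

text \<open>Dividing independence phrased through \<open>kdiv\<close>, with the right-hand side
  listed by itself, so that Kim's lemma and conjugation of the whole set \<open>B\<close> apply
  directly.\<close>

definition indep :: "'m set \<Rightarrow> 'i set \<Rightarrow> ('i \<Rightarrow> 'm) \<Rightarrow> 'm set \<Rightarrow> bool" where
  "indep M V a B \<longleftrightarrow>
    (\<forall>R k. defn2 V B M R \<and> R a (self B) \<longrightarrow> \<not> kdiv k M B R (self B))"

lemma tup_tot_id: "Z \<subseteq> U \<Longrightarrow> tup (self Z)"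
  by (intro tup_tot) auto

lemma tot_id_image [simp]: "self Z ` Z = Z"
  by auto

lemma kdiv_eqtp: "kdiv k C V R b \<Longrightarrow> eqtp V C b b' \<Longrightarrow> kdiv k C V R b'"
  unfolding kdiv_def using eqtp_trans by blast

lemma automorphism_tup: "automorphism L \<MM> g \<Longrightarrow> tup a \<Longrightarrow> tup (\<lambda>v. g (a v))"
  by (intro tupI) (auto simp: automorphism_def bij_betw_def)

lemma kinc_automorphism:
  fixes R :: "('x \<Rightarrow> 'm) \<Rightarrow> ('v \<Rightarrow> 'm) \<Rightarrow> bool" and c :: "nat \<Rightarrow> 'v \<Rightarrow> 'm"
  assumes g: "automorphism L \<MM> g" "\<And>m. m \<in> M \<Longrightarrow> g m = m" and M: "M \<subseteq> U" and R: "defn2 X V M R"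
    and c: "\<And>l. tup (c l)" "kinc UNIV k R c"
  shows "kinc UNIV k R (\<lambda>l v. g (c l v))"
  unfolding kinc_def
proof (intro allI impI)
  fix K :: "nat set" assume K: "card K = k"
  have fin: "finite K" using kinc_pos[OF c(2)] K card.infinite by fastforce
  have "tup (\<lambda>(l, v). c l v)" using c(1) by (auto intro!: tupI)
  from automorphism_defn[OF g defn_joint_rows[OF R fin subset_UNIV order_refl] this M]
  have "joint R K (\<lambda>l v. g (c l v)) = joint R K c" by simp
  then show "\<not> joint R K (\<lambda>l v. g (c l v))" using c(2) K unfolding kinc_def by blast
qed

end

context monster
begin

text \<open>If extension fails, a finite part of the type of \<open>a\<close> over \<open>M\<close>
  and \<open>B\<close> implies a disjunction of dividing predicates over \<open>B'\<close>. Kim's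
  lemma makes all disjuncts inconsistent along the same Morley sequence. As the finite part itself
  does not divide, many of its instances along this sequence have a common solution, which then
  satisfies some disjunct too often.\<close>

lemma indep_extend:
  fixes a :: "'i \<Rightarrow> 'm"
  assumes nTP2: "\<not> TP2 L \<MM>" and sw: "strong_witnessing L \<kappa> \<MM>" and M: "small_model L \<kappa> \<MM> M"
    and a: "tup a" "small \<kappa> V" and B: "B \<subseteq> B'" "B' \<subseteq> U" "small \<kappa> B'" and ind: "indep M V a B"
  obtains a' where "tup a'" "eqtp V (M \<union> B) a' a" "indep M V a' B'"
proof -
  have MU: "M \<subseteq> U" and sM: "small \<kappa> M" using M by (auto simp: small_model_def elem_sub_def)
  have BU: "B \<subseteq> U" using B by blast
  note tid = tup_tot_id[OF BU] tup_tot_id[OF B(2)]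
  define F1 where "F1 = {S. defn V (M \<union> B) S \<and> S a}"
  define F2 where "F2 = {\<lambda>x. \<not> R x (self B') | R k. defn2 V B' M R \<and> kdiv k M B' R (self B')}"
  have "\<exists>x. tup x \<and> (\<forall>S\<in>F1 \<union> F2. S x)"
  proof (rule saturation[OF a(2)])
    show "small \<kappa> (M \<union> B')" "M \<union> B' \<subseteq> U" using MU sM B by (auto intro: small_Un)
  next
    fix S assume "S \<in> F1 \<union> F2"
    then show "defn V (M \<union> B') S"
    proof
      assume "S \<in> F1"
      then have "defn V (M \<union> B) S" by (simp add: F1_def)
      then show ?thesis by (rule defn_mono) (use B(1) in auto)
    next
      assume "S \<in> F2"
      then obtain R where R: "S = (\<lambda>x. \<not> R x (self B'))" "defn2 V B' M R" by (auto simp: F2_def)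
      show ?thesis unfolding R(1) by (rule defn_not, rule defn2_fix[OF R(2) tid(2)]) simp
    qed
  next
    fix F assume F: "finite F" "F \<subseteq> F1 \<union> F2"
    show "\<exists>x. tup x \<and> (\<forall>S\<in>F. S x)"
    proof (rule ccontr)
      assume unsat: "\<not> ?thesis"
      define S0 where "S0 x \<longleftrightarrow> (\<forall>S\<in>F \<inter> F1. S x)" for x
      have "defn V (M \<union> self B ` B) S0"
        unfolding S0_def tot_id_image by (rule defn_ball) (use F(1) in \<open>auto simp: F1_def\<close>)
      then obtain R0 where R0: "defn2 V B M R0" "\<And>x. tup x \<Longrightarrow> R0 x (self B) = S0 x"
        by (rule defn_params[OF _ tid(1)]) blast
      have "S0 a" by (auto simp: S0_def F1_def)
      then have nd: "\<not> kdiv k M B R0 (self B)" for k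
        using ind R0 a(1) unfolding indep_def by blast
      have "\<forall>S\<in>F \<inter> F2. \<exists>R. defn2 V B' M R \<and> (\<exists>k. kdiv k M B' R (self B')) \<and> S = (\<lambda>x. \<not> R x (self B'))"
        by (auto simp: F2_def)
      from bchoice[OF this] obtain R where R: "\<And>S. S \<in> F \<inter> F2 \<Longrightarrow> defn2 V B' M (R S)"
        "\<And>S. S \<in> F \<inter> F2 \<Longrightarrow> \<exists>k. kdiv k M B' (R S) (self B')"
        "\<And>S. S \<in> F \<inter> F2 \<Longrightarrow> S = (\<lambda>x. \<not> R S x (self B'))" by blast
      obtain P where least: "\<And>Z. Z \<subseteq> U \<Longrightarrow> small \<kappa> Z \<Longrightarrow> least_type L \<MM> M Z (P \<inter> fms L Z U)"
        and idP: "\<And>Z. Z \<subseteq> U \<Longrightarrow> small \<kappa> Z \<Longrightarrow> realizing (P \<inter> fms L Z U) Z M (self Z)"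
        using least_types[OF sw M] by metis
      define p where "p = P \<inter> fms L B' U"
      have p: "inv_type L \<MM> M B' p" "realizing p B' M (self B')"
        using least[OF B(2,3)] idP[OF B(2,3)] by (simp_all add: p_def least_type_def)
      then have gp: "global_type L \<MM> B' p" by (simp add: inv_type_def)
      obtain d where d: "morley p B' M d" using morley_exists[OF gp B(3) sM MU] by blast
      have deq: "eqtp B' M (self B') (d l)" for l
        using p(2) morley_realizing_base[OF d, of l] unfolding eqtp_def realizing_def by metis
      have "\<exists>n. kinc UNIV n (R S) d" if S: "S \<in> F \<inter> F2" for S
      proof -
        obtain k where "kdiv k M B' (R S) (self B')" using R(2)[OF S] by blast
        moreover have "defn2 UNIV B' M (R S)" by (rule defn2_mono[OF R(1)[OF S]]) auto
        ultimately show ?thesis using kdiv_all_morley[OF nTP2 sw M B(2,3) _ _ p d] by blast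
      qed
      then have "\<forall>S\<in>F \<inter> F2. \<exists>n. kinc UNIV n (R S) d" by blast
      from bchoice[OF this] obtain n where n: "\<And>S. S \<in> F \<inter> F2 \<Longrightarrow> kinc UNIV (n S) (R S) d" by blast
      \<comment> \<open>One more than the disjuncts can cover together: disjunct \<open>S\<close>
        holds at no more than \<open>n S\<close> members of the sequence.\<close>
      define N where "N = Suc (\<Sum>S\<in>F \<inter> F2. n S)"
      have "eqtp B M (d l) (self B)" for l
      proof -
        have "eqtp B M (d l) (self B')" using eqtp_mono[OF eqtp_sym[OF deq] B(1) order_refl] .
        moreover have "eqtp B M (self B') (self B)" by (rule eqtp_agree[OF tid(2,1)]) (use B(1) in auto)
        ultimately show ?thesis by (rule eqtp_trans)
      qed
      then have "\<not> kinc UNIV N R0 d" using nd[of N] morley_tup[OF d] unfolding kdiv_def by blast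
      then obtain K x where K: "card K = N" "tup x" "\<And>l. l \<in> K \<Longrightarrow> R0 x (d l)"
        unfolding kinc_def by blast
      \<comment> \<open>The implication from the premise to the disjunction belongs to the type of
        \<open>self B'\<close> over \<open>M\<close>, so it holds at every
        \<open>d l\<close>.\<close>
      have cover: "\<exists>S\<in>F \<inter> F2. R S x (d l)" if l: "l \<in> K" for l
      proof (rule ccontr)
        assume none: "\<not> ?thesis"
        let ?E = "\<lambda>y. \<exists>x. tup x \<and> (R0 x y \<and> (\<forall>S\<in>F \<inter> F2. \<not> R S x y))"
        have "defn B' M ?E"
          unfolding defn2_def
        proof (rule defn2_ex[where V = V], unfold defn2_def, rule defn_conj)
          show "defn (V <+> B') M (\<lambda>e. R0 (\<lambda>v. e (Inl v)) (\<lambda>w. e (Inr w)))"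
            using defn2_mono[OF R0(1) order_refl B(1) order_refl] by (simp add: defn2_def)
          show "defn (V <+> B') M (\<lambda>e. \<forall>S\<in>F \<inter> F2. \<not> R S (\<lambda>v. e (Inl v)) (\<lambda>w. e (Inr w)))"
            by (rule defn_ball) (use F(1) R(1) in \<open>auto simp: defn2_def intro: defn_not\<close>)
        qed
        from eqtpD[OF deq[of l] this] have "?E (self B')" using K(2) K(3)[OF l] none by blast
        then obtain x' where x': "tup x'" "R0 x' (self B')" "\<And>S. S \<in> F \<inter> F2 \<Longrightarrow> \<not> R S x' (self B')"
          by blast
        have "R0 x' (self B') = R0 x' (self B)"
          by (rule defn2_local[OF R0(1) x'(1) tid(2) x'(1) tid(1)]) (use B(1) in auto)
        then have "S0 x'" using R0(2)[OF x'(1)] x'(2) by simp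
        have "S x'" if "S \<in> F" for S
        proof (cases "S \<in> F1")
          case True
          then show ?thesis using \<open>S0 x'\<close> that unfolding S0_def by blast
        next
          case False
          then have S: "S \<in> F \<inter> F2" using F(2) that by blast
          show ?thesis by (subst R(3)[OF S]) (rule x'(3)[OF S])
        qed
        then show False using unsat x'(1) by blast
      qed
      have fK: "finite K" using K(1) card.infinite by (fastforce simp: N_def)
      have "card {l \<in> K. R S x (d l)} \<le> n S" if S: "S \<in> F \<inter> F2" for S
      proof (rule ccontr)
        assume "\<not> ?thesis"
        then obtain K' where "K' \<subseteq> {l \<in> K. R S x (d l)}" "card K' = n S"
          using obtain_subset_with_card_n[of "n S" "{l \<in> K. R S x (d l)}"] by auto
        then show False using n[OF S] K(2) unfolding kinc_def by blast
      qed
      then have "(\<Sum>S\<in>F \<inter> F2. card {l \<in> K. R S x (d l)}) \<le> (\<Sum>S\<in>F \<inter> F2. n S)"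
        by (rule sum_mono)
      moreover have "K \<subseteq> (\<Union>S\<in>F \<inter> F2. {l \<in> K. R S x (d l)})" using cover by blast
      then have "card K \<le> card (\<Union>S\<in>F \<inter> F2. {l \<in> K. R S x (d l)})"
        by (rule card_mono[rotated]) (use fK F(1) in auto)
      moreover have "\<dots> \<le> (\<Sum>S\<in>F \<inter> F2. card {l \<in> K. R S x (d l)})"
        by (rule card_UN_le) (use F(1) in auto)
      ultimately show False using K(1) by (simp add: N_def)
    qed
  qed
  then obtain a' where a': "tup a'" "\<And>S. S \<in> F1 \<Longrightarrow> S a'" "\<And>S. S \<in> F2 \<Longrightarrow> S a'" by blast
  have "eqtp V (M \<union> B) a' a"
    by (rule eqtp_sym, rule eqtpI) (use a'(2) in \<open>auto simp: F1_def\<close>)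
  moreover have "indep M V a' B'"
    unfolding indep_def
  proof (intro allI impI notI; elim conjE)
    fix R k assume "defn2 V B' M R" "R a' (self B')" "kdiv k M B' R (self B')"
    moreover from this have "(\<lambda>x. \<not> R x (self B')) \<in> F2" by (auto simp: F2_def)
    ultimately show False using a'(3) by blast
  qed
  ultimately show thesis using that a'(1) by blast
qed

text \<open>Automorphisms over \<open>M \<union> C\<close> that take \<open>e\<close> to
  \<open>c l\<close> move all of \<open>B\<close> to conjugates over \<open>M\<close>. Viewing
  \<open>S\<close> as a predicate of \<open>a\<close> and \<open>B\<close>, independence makes any
  number of these conjugates jointly solvable. The automorphisms fix \<open>C\<close>, so its
  elements can act as parameters although dividing is measured over \<open>M\<close>.\<close>

lemma indep_joint:
  fixes a :: "'i \<Rightarrow> 'm" and e :: "'j \<Rightarrow> 'm"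
  assumes M: "M \<subseteq> U" "small \<kappa> M" and B: "B \<subseteq> U" "small \<kappa> B" and ind: "indep M V a B"
    and a: "tup a" and C: "C \<subseteq> B" and e: "tup e" "e ` W \<subseteq> B" "small \<kappa> W"
    and c: "\<And>l :: nat. tup (c l)" "\<And>l. eqtp W (M \<union> C) (c l) e"
    and S: "defn2 V W (M \<union> C) S" "S a e"
  shows "\<exists>K x. card K = N \<and> tup x \<and> (\<forall>l\<in>K. S x (c l))"
proof -
  have CU: "C \<subseteq> U" using B C by blast
  note tid = tup_tot_id[OF B(1)] tup_tot_id[OF CU]
  have sC: "small \<kappa> (M \<union> C)" "M \<union> C \<subseteq> U"
    using M B(2) C CU small_subset by (auto intro!: small_Un)
  have "\<exists>g. automorphism L \<MM> g \<and> (\<forall>m\<in>M \<union> C. g m = m) \<and> (\<forall>w\<in>W. g (e w) = c l w)" for l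
    using homogeneity[OF e(1) c(1) e(3) sC eqtp_sym[OF c(2)], of l] by metis
  then obtain g where g: "\<And>l. automorphism L \<MM> (g l)" "\<And>l m. m \<in> M \<union> C \<Longrightarrow> g l m = m"
    "\<And>l w. w \<in> W \<Longrightarrow> g l (e w) = c l w" by metis
  have "defn (V <+> W) (M \<union> self C ` C) (\<lambda>z. S (\<lambda>v. z (Inl v)) (\<lambda>w. z (Inr w)))"
    using S(1) by (simp add: defn2_def)
  then obtain S' where S': "defn2 (V <+> W) C M S'"
    "\<And>z. tup z \<Longrightarrow> S' z (self C) = S (\<lambda>v. z (Inl v)) (\<lambda>w. z (Inr w))"
    by (rule defn_params[OF _ tid(2)]) blast
  \<comment> \<open>Recovers both the tuple \<open>e\<close> and the parameters in \<open>C\<close>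
    from the listing of \<open>B\<close>.\<close>
  define R where "R x y = S' (case_sum x (\<lambda>w. if w \<in> W then y (e w) else pt)) y"
    for x :: "'i \<Rightarrow> 'm" and y :: "'m \<Rightarrow> 'm"
  have "defn (V <+> B) M (\<lambda>z. (\<lambda>u. S' (\<lambda>v. u (Inl v)) (\<lambda>w. u (Inr w)))
      (\<lambda>n. (\<lambda>n z. case n of Inl (Inl v) \<Rightarrow> z (Inl v)
        | Inl (Inr w) \<Rightarrow> if w \<in> W then z (Inr (e w)) else pt | Inr m \<Rightarrow> z (Inr m)) n z))"
  proof (rule defn_subst[OF S'(1)[unfolded defn2_def] order_refl], goal_cases)
    case (1 n)
    have "\<exists>w\<in>V <+> B. \<forall>z :: 'i + 'm \<Rightarrow> 'm. (case n of Inl (Inl v) \<Rightarrow> z (Inl v)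
        | Inl (Inr w) \<Rightarrow> if w \<in> W then z (Inr (e w)) else pt | Inr m \<Rightarrow> z (Inr m)) = z w"
      using 1 e(2) C by (auto split: sum.split)
    then show ?case by blast
  qed (auto split: sum.split)
  then have R: "defn2 V B M R"
    by (simp add: defn2_def R_def)
  have RS: "R x y = S x y'" if "tup x" "tup y" "tup y'" "\<And>m. m \<in> C \<Longrightarrow> y m = m" "\<And>w. w \<in> W \<Longrightarrow> y (e w) = y' w"
    for x y y'
  proof -
    let ?z = "case_sum x (\<lambda>w. if w \<in> W then y (e w) else pt)"
    have tz: "tup ?z" using that(1,2) by (intro tupI) (auto split: sum.split)
    have "R x y = S' ?z (self C)"
      unfolding R_def by (rule defn2_local[OF S'(1) tz that(2) tz tid(2)]) (use that(4) in auto)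
    also have "\<dots> = S x (\<lambda>w. if w \<in> W then y (e w) else pt)" using S'(2)[OF tz] by simp
    also have "\<dots> = S x y'"
    proof (rule defn2_local[OF S(1) that(1) _ that(1,3)])
      show "tup (\<lambda>w. if w \<in> W then y (e w) else pt)" using that(2) by (intro tupI) auto
    qed (use that(5) in auto)
    finally show ?thesis .
  qed
  have "R a (self B)" using RS[OF a tid(1) e(1)] S(2) C e(2) by (auto simp: image_subset_iff subset_iff)
  then have "\<not> kdiv N M B R (self B)" using ind R unfolding indep_def by blast
  moreover define y where "y l m = g l (self B m)" for l m
  have ty: "tup (y l)" for l unfolding y_def by (rule automorphism_tup[OF g(1) tid(1)])
  have "eqtp B M (y l) (self B)" for l
    unfolding eqtp_def y_def using automorphism_defn[OF g(1) _ _ tid(1) M(1)] g(2) by blast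
  ultimately have "\<not> kinc UNIV N R y" using ty unfolding kdiv_def by blast
  then obtain K x where K: "card K = N" "tup x" "\<forall>l\<in>K. R x (y l)" unfolding kinc_def by blast
  have "R x (y l) = S x (c l)" for l
  proof (rule RS[OF K(2) ty c(1)])
    show "y l m = m" if "m \<in> C" for m using that C g(2) by (auto simp: y_def subset_iff)
    show "y l (e w) = c l w" if "w \<in> W" for w using that e(2) g(3) by (auto simp: y_def image_subset_iff)
  qed
  then show ?thesis using K by blast
qed

text \<open>Left transitivity of independence combined with base monotonicity.\<close>

lemma kdiv_over_indep:
  fixes a :: "'i \<Rightarrow> 'm" and e :: "'j \<Rightarrow> 'm" and R :: "('x \<Rightarrow> 'm) \<Rightarrow> ('j \<Rightarrow> 'm) \<Rightarrow> bool"
  assumes M: "M \<subseteq> U" "small \<kappa> M" and B: "B \<subseteq> U" "small \<kappa> B" and ind: "indep M V a B"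
    and a: "tup a" "small \<kappa> V" and C: "C \<subseteq> B" and e: "tup e" "e ` W \<subseteq> B" "small \<kappa> W"
    and R: "defn2 X W M R" and div: "kdiv k (M \<union> C) W R e"
  shows "kdiv k (M \<union> C \<union> a ` V) W R e"
proof -
  obtain c :: "nat \<Rightarrow> 'j \<Rightarrow> 'm" where c: "\<And>l. tup (c l)" "\<And>l. eqtp W (M \<union> C) (c l) e" "kinc UNIV k R c"
    using div unfolding kdiv_def by blast
  have sC: "small \<kappa> (M \<union> C)" "M \<union> C \<subseteq> U"
    using M B C small_subset by (auto intro!: small_Un)
  have finK: "finite K" if "card K = k" for K :: "nat set"
    using that kinc_pos[OF c(3)] card.infinite by fastforce
  let ?V = "V <+> (UNIV :: nat set) \<times> W"
  \<comment> \<open>The unknowns are a copy of \<open>a\<close> and a sequence: \<open>F1\<close>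
    gives each pair the type of \<open>(a, e)\<close> over \<open>M \<union> C\<close>, while
    \<open>F2\<close> makes the sequence k-inconsistent.\<close>
  define F1 where "F1 I = {\<lambda>z. S (\<lambda>v. z (Inl v)) (\<lambda>w. z (Inr (l, w))) | l S.
    l \<in> I \<and> defn2 V W (M \<union> C) S \<and> S a e}" for I :: "nat set"
  define F2 where "F2 = {\<lambda>z :: 'i + nat \<times> 'j \<Rightarrow> 'm. \<not> joint R K (\<lambda>l w. z (Inr (l, w))) | K. card K = k}"
  have "\<exists>z. tup z \<and> (\<forall>Q\<in>F1 UNIV \<union> F2. Q z)"
  proof (rule saturation)
    show "small \<kappa> ?V" by (intro small_Plus small_Times small_nat a(2) e(3))
  next
    fix Q assume "Q \<in> F1 UNIV \<union> F2"
    then show "defn ?V (M \<union> C) Q"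
    proof
      assume "Q \<in> F1 UNIV"
      then obtain l S where Q: "Q = (\<lambda>z. S (\<lambda>v. z (Inl v)) (\<lambda>w. z (Inr (l, w))))" "defn2 V W (M \<union> C) S"
        unfolding F1_def by blast
      have "defn ?V (M \<union> C) (\<lambda>z. (\<lambda>e. S (\<lambda>v. e (Inl v)) (\<lambda>w. e (Inr w)))
          (\<lambda>n. z (case n of Inl v \<Rightarrow> Inl v | Inr w \<Rightarrow> Inr (l, w))))"
        by (rule defn_subst[OF Q(2)[unfolded defn2_def]]) auto
      then show ?thesis by (simp add: Q(1))
    next
      assume "Q \<in> F2"
      then obtain K where Q: "Q = (\<lambda>z. \<not> joint R K (\<lambda>l w. z (Inr (l, w))))" "card K = k"
        unfolding F2_def by blast
      have "defn ?V (M \<union> C) (\<lambda>z. joint R K (\<lambda>l w. (\<lambda>l w z. z (Inr (l, w))) l w z))"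
        by (rule defn_joint[OF R finK[OF Q(2)]]) auto
      then show ?thesis unfolding Q(1) by (rule defn_not)
    qed
  next
    fix F assume F: "finite F" "F \<subseteq> F1 UNIV \<union> F2"
    have "\<exists>I. finite I \<and> F \<subseteq> F1 I \<union> F2"
      using F
    proof (induction F rule: finite_induct)
      case (insert Q F)
      then obtain I where I: "finite I" "F \<subseteq> F1 I \<union> F2" by auto
      show ?case
      proof (cases "Q \<in> F2")
        case False
        then have "Q \<in> F1 UNIV" using insert.prems by blast
        then obtain l where "Q \<in> F1 {l}" unfolding F1_def by blast
        moreover have "F1 I \<subseteq> F1 (insert l I)" "F1 {l} \<subseteq> F1 (insert l I)" unfolding F1_def by blast+
        ultimately show ?thesis using I by (intro exI[of _ "insert l I"]) auto
      qed (use I in blast)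
    qed auto
    then obtain I where I: "finite I" "F \<subseteq> F1 I \<union> F2" by blast
    have "\<exists>lS. fst lS \<in> I \<and> defn2 V W (M \<union> C) (snd lS) \<and> snd lS a e \<and>
        Q = (\<lambda>z. snd lS (\<lambda>v. z (Inl v)) (\<lambda>w. z (Inr (fst lS, w))))" if Q: "Q \<in> F1 I" for Q
    proof -
      obtain l S where "Q = (\<lambda>z. S (\<lambda>v. z (Inl v)) (\<lambda>w. z (Inr (l, w))))" "l \<in> I" "defn2 V W (M \<union> C) S" "S a e"
        using Q unfolding F1_def by blast
      then show ?thesis by (intro exI[of _ "(l, S)"]) (simp only: fst_conv snd_conv simp_thms)
    qed
    then have "\<forall>Q\<in>F1 I. \<exists>lS. fst lS \<in> I \<and> defn2 V W (M \<union> C) (snd lS) \<and> snd lS a e \<and>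
        Q = (\<lambda>z. snd lS (\<lambda>v. z (Inl v)) (\<lambda>w. z (Inr (fst lS, w))))" by blast
    from bchoice[OF this] obtain IS where IS: "\<And>Q. Q \<in> F1 I \<Longrightarrow>
        fst (IS Q) \<in> I \<and> defn2 V W (M \<union> C) (snd (IS Q)) \<and> snd (IS Q) a e \<and>
        Q = (\<lambda>z. snd (IS Q) (\<lambda>v. z (Inl v)) (\<lambda>w. z (Inr (fst (IS Q), w))))" by blast
    \<comment> \<open>The finitely many conditions are merged into one predicate, imposed at every
      index, so that \<open>indep_joint\<close> applies.\<close>
    define S where "S x y \<longleftrightarrow> (\<forall>Q\<in>F \<inter> F1 I. snd (IS Q) x y)" for x y
    have "defn2 V W (M \<union> C) S"
      unfolding defn2_def S_def by (rule defn_ball) (use F(1) IS in \<open>auto simp: defn2_def\<close>)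
    moreover have "S a e" using IS by (auto simp: S_def)
    \<comment> \<open>The cardinality exceeds every index in \<open>I\<close>, so that
      \<open>I\<close> maps injectively into \<open>K\<close>.\<close>
    ultimately obtain K x where K: "card K = Suc (Max (insert 0 I))" "tup x" "\<And>l. l \<in> K \<Longrightarrow> S x (c l)"
      using indep_joint[where c = c, OF M B ind a(1) C e c(1,2)] by blast
    have fK: "finite K" using K(1) card.infinite by fastforce
    then obtain h where h: "bij_betw h {0..<Suc (Max (insert 0 I))} K"
      using ex_bij_betw_nat_finite[OF fK] K(1) by auto
    have hI: "h l \<in> K" if "l \<in> I" for l
    proof -
      have "l \<le> Max (insert 0 I)" using I(1) that by simp
      then show ?thesis using h by (auto simp: bij_betw_def)
    qed
    have hinj: "inj_on h I"
    proof (rule inj_on_subset)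
      show "inj_on h {0..<Suc (Max (insert 0 I))}" using h by (simp add: bij_betw_def)
      show "I \<subseteq> {0..<Suc (Max (insert 0 I))}" using I(1) by (auto simp: less_Suc_eq_le)
    qed
    \<comment> \<open>The conditions in \<open>F2\<close> concern all of \<open>nat\<close>, so the
      injection is extended beyond \<open>I\<close> with values above \<open>K\<close>; reindexing
      then keeps k-inconsistency everywhere.\<close>
    obtain h' where h': "inj h'" "\<And>l. l \<in> I \<Longrightarrow> h' l = h l"
    proof -
      define h' where "h' l = (if l \<in> I then h l else Suc (Max (insert 0 K)) + l)" for l
      have "h l < Suc (Max (insert 0 K))" if "l \<in> I" for l
        using hI[OF that] fK by (simp add: less_Suc_eq_le)
      then have "inj h'" using hinj unfolding h'_def inj_on_def
        by (smt (verit) add_left_cancel not_add_less1)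
      then show thesis using that by (simp add: h'_def)
    qed
    let ?z = "case_sum x (\<lambda>(l, w). c (h' l) w)"
    have tz: "tup ?z" using K(2) c(1) by (intro tupI) (auto split: sum.split prod.split)
    have "Q ?z" if "Q \<in> F" for Q
    proof (cases "Q \<in> F2")
      case True
      then obtain K' where Q: "Q = (\<lambda>z. \<not> joint R K' (\<lambda>l w. z (Inr (l, w))))" "card K' = k"
        unfolding F2_def by blast
      have "kinc UNIV k R (\<lambda>l. c (h' l))" by (rule kinc_reindex[OF c(3) h'(1)]) simp
      then have "\<not> joint R K' (\<lambda>l. c (h' l))" using Q(2) unfolding kinc_def by blast
      then show ?thesis by (simp add: Q(1))
    next
      case False
      then have Q: "Q \<in> F \<inter> F1 I" using that I(2) by blast
      then have "snd (IS Q) x (c (h (fst (IS Q))))"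
        using K(3)[OF hI] IS[of Q] unfolding S_def by blast
      moreover have "Q ?z = snd (IS Q) (\<lambda>v. ?z (Inl v)) (\<lambda>w. ?z (Inr (fst (IS Q), w)))"
        by (rule fun_cong[where x = ?z, of Q]) (use IS[of Q] Q in blast)
      ultimately show ?thesis using h'(2)[of "fst (IS Q)"] conjunct1[OF IS[of Q]] Q by simp
    qed
    then show "\<exists>z. tup z \<and> (\<forall>Q\<in>F. Q z)" using tz by blast
  qed (use sC in auto)
  then obtain z where z: "tup z" "\<And>Q. Q \<in> F1 UNIV \<Longrightarrow> Q z" "\<And>Q. Q \<in> F2 \<Longrightarrow> Q z" by blast
  define x where "x v = z (Inl v)" for v
  define y where "y l w = z (Inr (l, w))" for l w
  have t: "tup x" "tup (y l)" for l unfolding x_def y_def using z(1) by (auto intro!: tupI)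
  have joint: "S x (y l)" if "defn2 V W (M \<union> C) S" "S a e" for S l
  proof -
    have "(\<lambda>z. S (\<lambda>v. z (Inl v)) (\<lambda>w. z (Inr (l, w)))) \<in> F1 UNIV" unfolding F1_def using that by blast
    from z(2)[OF this] show ?thesis unfolding x_def y_def .
  qed
  have "eqtp V (M \<union> C) x a"
  proof (rule eqtp_sym, rule eqtpI)
    fix S assume S: "defn V (M \<union> C) S" "S a"
    have "defn2 V W (M \<union> C) (\<lambda>x y. S x)"
      unfolding defn2_def by (rule defn_subst[OF S(1)]) auto
    from joint[OF this S(2)] show "S x" .
  qed
  \<comment> \<open>The copy \<open>x\<close> is moved back to \<open>a\<close>, and the sequence is
    moved along with it.\<close>
  then obtain g where g: "automorphism L \<MM> g" "\<And>m. m \<in> M \<union> C \<Longrightarrow> g m = m" "\<And>v. v \<in> V \<Longrightarrow> g (x v) = a v"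
    using homogeneity[OF t(1) a(1) a(2) sC] by metis
  define y' where "y' l w = g (y l w)" for l w
  have ty': "tup (y' l)" for l unfolding y'_def by (rule automorphism_tup[OF g(1) t(2)])
  have "eqtp W (M \<union> C \<union> a ` V) (y' l) e" for l
  proof (rule eqtp_add_params[OF _ ty' e(1) a(1)], rule eqtp_sym, rule eqtpI)
    fix T assume T: "defn (W <+> V) (M \<union> C) T" "T (case_sum e a)"
    have "defn2 W V (M \<union> C) (\<lambda>y x. T (case_sum y x))" using T(1) by (simp add: defn2_def sum_eta)
    from joint[OF defn2_swap[OF this]] T(2) have Tyx: "T (case_sum (y l) x)" .
    have tyx: "tup (case_sum (y l) x)" using t by (intro tupI) (auto split: sum.split)
    have "T (\<lambda>v. g (case_sum (y l) x v))"
      using automorphism_defn[OF g(1,2) T(1) tyx sC(2)] Tyx by simp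
    moreover have "T (\<lambda>v. g (case_sum (y l) x v)) = T (case_sum (y' l) a)"
    proof (rule defn_local[OF T(1) automorphism_tup[OF g(1) tyx]])
      show "tup (case_sum (y' l) a)" using ty' a(1) by (intro tupI) (auto split: sum.split)
      show "g (case_sum (y l) x v) = case_sum (y' l) a v" if "v \<in> W <+> V" for v
        using that g(3) by (auto simp: y'_def)
    qed
    ultimately show "T (case_sum (y' l) a)" by simp
  qed
  moreover have "kinc UNIV k R y"
    unfolding kinc_def
  proof (intro allI impI)
    fix K :: "nat set" assume "card K = k"
    then have "(\<lambda>z. \<not> joint R K (\<lambda>l w. z (Inr (l, w)))) \<in> F2" unfolding F2_def by blast
    from z(3)[OF this] show "\<not> joint R K y" unfolding y_def .
  qed
  then have "kinc UNIV k R y'"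
    unfolding y'_def using kinc_automorphism[where c = y, OF g(1) _ M(1) R t(2)] g(2) by blast
  ultimately show ?thesis using ty' unfolding kdiv_def by blast
qed

text \<open>Each new element is a copy of \<open>a\<close> over \<open>M\<close> and
  \<open>b\<close>, independent of \<open>b\<close> and all elements so far, and goes to the front
  of the list. There it has to divide over \<open>M\<close> only, while dividing of the old elements
  survives because their base grows by an independent tuple.\<close>

lemma dividing_chain_exists:
  fixes a :: "'i \<Rightarrow> 'm" and b :: "'j \<Rightarrow> 'm" and R :: "('j \<Rightarrow> 'm) \<Rightarrow> ('i \<Rightarrow> 'm) \<Rightarrow> bool"
  assumes nTP2: "\<not> TP2 L \<MM>" and sw: "strong_witnessing L \<kappa> \<MM>" and M: "small_model L \<kappa> \<MM> M"
    and a: "tup a" "small \<kappa> V" and b: "tup b" "small \<kappa> J" and ind: "indep M V a (b ` J)"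
    and R: "defn2 J V M R" "R b a" and div: "kdiv k M V R a"
  shows "\<exists>es. length es = n \<and> (\<forall>e\<in>set es. tup e \<and> R b e) \<and>
    (\<forall>i<n. kdiv k (M \<union> (\<Union>e\<in>set (take i es). e ` V)) V R (es ! i))"
proof (induction n)
  case 0
  then show ?case by simp
next
  case (Suc n)
  have MU: "M \<subseteq> U" and sM: "small \<kappa> M" using M by (auto simp: small_model_def elem_sub_def)
  obtain es where es: "length es = n" "\<And>e. e \<in> set es \<Longrightarrow> tup e \<and> R b e"
    "\<And>i. i < n \<Longrightarrow> kdiv k (M \<union> (\<Union>e\<in>set (take i es). e ` V)) V R (es ! i)" using Suc by blast
  define B' where "B' = b ` J \<union> (\<Union>e\<in>set es. e ` V)"
  have "small \<kappa> (\<Union>e\<in>set xs. e ` V)" for xs :: "('i \<Rightarrow> 'm) list"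
    by (induction xs) (auto intro!: small_Un small_image a(2) intro: small_finite)
  then have B': "b ` J \<subseteq> B'" "B' \<subseteq> U" "small \<kappa> B'"
    using b es(2) by (auto simp: B'_def intro!: small_Un small_image)
  obtain a' where a': "tup a'" "eqtp V (M \<union> b ` J) a' a" "indep M V a' B'"
    by (rule indep_extend[OF nTP2 sw M a B' ind])
  have "R b a'"
    using eqtpD[OF a'(2) defn2_fix[OF defn2_swap[OF R(1)] b(1) order_refl]] R(2) by simp
  moreover have "kdiv k (M \<union> (\<Union>e\<in>set (take i (a' # es)). e ` V)) V R ((a' # es) ! i)" if "i < Suc n" for i
  proof (cases i)
    case 0
    have "eqtp V M a a'" using eqtp_mono[OF eqtp_sym[OF a'(2)] order_refl, of M] by simp
    then show ?thesis using 0 kdiv_eqtp[OF div] by simp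
  next
    case (Suc j)
    let ?C = "\<Union>e\<in>set (take j es). e ` V"
    have j: "j < n" using that Suc by simp
    then have mem: "es ! j \<in> set es" using es(1) by simp
    have "?C \<subseteq> B'" using set_take_subset[of j es] by (auto simp: B'_def)
    moreover have "(es ! j) ` V \<subseteq> B'" using mem by (auto simp: B'_def)
    ultimately have "kdiv k (M \<union> ?C \<union> a' ` V) V R (es ! j)"
      using kdiv_over_indep[OF MU sM B'(2,3) a'(3,1) a(2) _ _ _ a(2) R(1) es(3)[OF j]] es(2)[OF mem]
      by blast
    moreover have "M \<union> ?C \<union> a' ` V = M \<union> (\<Union>e\<in>set (take i (a' # es)). e ` V)" using Suc by auto
    ultimately show ?thesis using Suc by simp
  qed
  ultimately show ?case using es a'(1) by (intro exI[of _ "a' # es"]) auto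
qed

section \<open>Dividing along indiscernible sequences\<close>

text \<open>A Morley sequence in the average type of the witnessing sequence is indiscernible, and
  reflection into that sequence shows its inconsistency. Its members have the type of
  \<open>b\<close> over \<open>M\<close>, so an automorphism makes it start with
  \<open>b\<close>.\<close>

lemma kdiv_indiscernible:
  fixes R :: "('x \<Rightarrow> 'm) \<Rightarrow> ('v \<Rightarrow> 'm) \<Rightarrow> bool"
  assumes M: "M \<subseteq> U" "small \<kappa> M" and V: "small \<kappa> V" and b: "tup b" and R: "defn2 X V M R"
    and div: "kdiv k M V R b"
  obtains c n where "\<And>l. tup (c l)" "indiscernible L \<MM> M V c" "\<And>v. v \<in> V \<Longrightarrow> c 0 v = b v" "kinc UNIV n R c"
proof -
  obtain c0 :: "nat \<Rightarrow> 'v \<Rightarrow> 'm" where c0: "\<And>l. tup (c0 l)" "\<And>l. eqtp V M (c0 l) b" "kinc UNIV k R c0"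
    using div unfolding kdiv_def by blast
  obtain \<U> :: "nat set set" where u: "ultra \<U>" "\<And>F. finite F \<Longrightarrow> - F \<in> \<U>" by (rule nonprincipal_ultra) blast
  \<comment> \<open>The base contains the whole sequence, which makes the average type invariant
    over it.\<close>
  define M' where "M' = M \<union> (\<Union>l. c0 l ` V)"
  have "(\<Union>l. c0 l ` V) = (\<lambda>(l, v). c0 l v) ` (UNIV \<times> V)" by auto
  then have "small \<kappa> (\<Union>l. c0 l ` V)" using small_image small_Times[OF small_nat V] by metis
  then have M': "M \<subseteq> M'" "M' \<subseteq> U" "small \<kappa> M'" "\<And>l. c0 l ` V \<subseteq> M'"
    using M c0(1) by (auto simp: M'_def intro!: small_Un)
  let ?q = "limt \<U> V c0"
  have q: "inv_type L \<MM> M' V ?q" by (rule limt_inv_type[OF u(1) c0(1) M'(4,2)])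
  then have gq: "global_type L \<MM> V ?q" by (simp add: inv_type_def)
  obtain d where d: "morley ?q V M' d" using morley_exists[OF gq V M'(3,2)] by blast
  have R': "defn2 X V M' R" by (rule defn2_mono[OF R]) (use M'(1) in auto)
  have "\<not> joint R {..<k} d"
  proof
    assume "joint R {..<k} d"
    then have "(\<lambda>e. joint R {..<k} (\<lambda>l v. e (l, v))) (\<lambda>(l, v). d l v)" by simp
    from limt_morley_reflect[where j = k, OF u c0(1) M'(4,2) d defn_joint_rows[OF R'] this ultra_UNIV[OF u(1)]]
    obtain \<nu> x where "inj_on \<nu> {..<k}" "tup x" "\<forall>l\<in>{..<k}. R x (c0 (\<nu> l))" by auto
    moreover have "card (\<nu> ` {..<k}) = k" using card_image[OF calculation(1)] by simp
    ultimately show False using c0(3) unfolding kinc_def by (metis imageE subset_UNIV)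
  qed
  then obtain n where n: "kinc UNIV n R d" using morley_kinc[OF q M'(2) d R', of "{..<k}"] by auto
  have "eqtp V M (d 0) b"
    unfolding eqtp_def
  proof (intro allI impI)
    fix T assume T: "defn V M T"
    have "T (d 0) = forces ?q T" using realizingD[OF morley_realizing_base[OF d]] defn_mono[OF T order_refl M'(1)] by blast
    also have "\<dots> = ({l. T (c0 l)} \<in> \<U>)"
      using forces_limt[where c = c0, OF u(1) c0(1)] defn_mono[OF T order_refl M(1)] by blast
    also have "{l. T (c0 l)} = (if T b then UNIV else {})" using eqtpD[OF c0(2) T] by auto
    also have "(\<dots> \<in> \<U>) = T b" using ultra_UNIV[OF u(1)] ultra_nonempty[OF u(1), of "{}"] by auto
    finally show "T (d 0) = T b" .
  qed
  then obtain g where g: "automorphism L \<MM> g" "\<And>m. m \<in> M \<Longrightarrow> g m = m" "\<And>v. v \<in> V \<Longrightarrow> g (d 0 v) = b v"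
    using homogeneity[OF morley_tup[OF d] b V M(2,1)] by metis
  show thesis
  proof
    show td: "tup (\<lambda>v. g (d l v))" for l by (rule automorphism_tup[OF g(1) morley_tup[OF d]])
    show "g (d 0 v) = b v" if "v \<in> V" for v by (rule g(3)[OF that])
    show "kinc UNIV n R (\<lambda>l v. g (d l v))" by (rule kinc_automorphism[OF g(1,2) M(1) R morley_tup[OF d] n])
    show "indiscernible L \<MM> M V (\<lambda>l v. g (d l v))"
      unfolding indiscernible_def
    proof (intro conjI allI impI; (elim conjE)?)
      show "(\<lambda>v. g (d l v)) ` V \<subseteq> U" for l using td by (rule tup_image)
    next
      fix r and i j :: "nat \<Rightarrow> nat"
      assume ij: "strict_mono_on {..<r} i" "strict_mono_on {..<r} j"
      have tup: "tup (\<lambda>(l, v). d (i l) v)" for i :: "nat \<Rightarrow> nat" using morley_tup[OF d] by (auto intro!: tupI)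
      have tupg: "tup (\<lambda>(l, v). g (d (i l) v))" for i :: "nat \<Rightarrow> nat"
        using tup_in[OF td] by (auto intro!: tupI)
      have "eqtp ({..<r} \<times> V) M' (\<lambda>(l, v). d (i l) v) (\<lambda>(l, v). d (j l) v)"
        using morley_seq_eqtp[OF q M'(2) d ij(1)] morley_seq_eqtp[OF q M'(2) d ij(2)] eqtp_trans eqtp_sym by blast
      then have e: "eqtp ({..<r} \<times> V) M (\<lambda>(l, v). d (i l) v) (\<lambda>(l, v). d (j l) v)"
        using eqtp_mono M'(1) by blast
      have "eqtp ({..<r} \<times> V) M (\<lambda>(l, v). g (d (i l) v)) (\<lambda>(l, v). g (d (j l) v))"
        unfolding eqtp_def
      proof (intro allI impI)
        fix T assume T: "defn ({..<r} \<times> V) M T"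
        have eta: "(\<lambda>z. g ((\<lambda>(l, v). d (i l) v) z)) = (\<lambda>(l, v). g (d (i l) v))" for i :: "nat \<Rightarrow> nat"
          by (simp add: fun_eq_iff)
        show "T (\<lambda>(l, v). g (d (i l) v)) = T (\<lambda>(l, v). g (d (j l) v))"
          using automorphism_defn[OF g(1,2) T tup[of i] M(1)] automorphism_defn[OF g(1,2) T tup[of j] M(1)]
            eqtpD[OF e T] unfolding eta by simp
      qed
      then show "tp L \<MM> ({..<r} \<times> V) (\<lambda>(l, v). g (d (i l) v)) M = tp L \<MM> ({..<r} \<times> V) (\<lambda>(l, v). g (d (j l) v)) M"
        using eqtp_iff_tp[OF tupg tupg] by blast
    qed
  qed
qed

text \<open>The tuple \<open>b\<close> may have repetitions, whereas \<open>indep\<close> lists its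
  range; a section \<open>s\<close> of \<open>b\<close> translates between the two. The dividing
  sequence is then replaced by an indiscernible one.\<close>

lemma indep_of_dividing_indep:
  fixes a :: "'i \<Rightarrow> 'm" and b :: "'j \<Rightarrow> 'm"
  assumes M: "M \<subseteq> U" "small \<kappa> M" and a: "tup a" and b: "tup b" "small \<kappa> J"
    and d: "dividing_indep L \<MM> M I a J b"
  shows "indep M I a (b ` J)"
  unfolding indep_def
proof (intro allI impI notI; elim conjE)
  let ?B = "b ` J" and ?id = "self (b ` J)"
  fix R k assume R: "defn2 I ?B M R" "R a ?id" and div: "kdiv k M ?B R ?id"
  have BU: "?B \<subseteq> U" using b(1) by auto
  note tid = tup_tot_id[OF BU]
  define s where "s m = (SOME j. j \<in> J \<and> b j = m)" for m
  have s: "s m \<in> J" "b (s m) = m" if "m \<in> ?B" for m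
  proof -
    have "\<exists>j. j \<in> J \<and> b j = m" using that by blast
    from someI_ex[OF this] show "s m \<in> J" "b (s m) = m" by (simp_all add: s_def)
  qed
  define R1 where "R1 x y = R x (\<lambda>m. y (s m))" for x and y :: "'j \<Rightarrow> 'm"
  have "defn (I <+> J) M (\<lambda>e. (\<lambda>e. R (\<lambda>v. e (Inl v)) (\<lambda>w. e (Inr w)))
      (\<lambda>n. e (case n of Inl v \<Rightarrow> Inl v | Inr m \<Rightarrow> Inr (s m))))"
    by (rule defn_subst[OF R(1)[unfolded defn2_def]]) (use s in auto)
  then have R1: "defn2 I J M R1" by (simp add: defn2_def R1_def)
  have R1R: "R1 x y = R x z" if "tup x" "tup y" "tup z" "\<And>m. m \<in> ?B \<Longrightarrow> y (s m) = z m" for x y z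
    unfolding R1_def
  proof (rule defn2_local[OF R(1) that(1) _ that(1,3)])
    show "tup (\<lambda>m. y (s m))" using that(2) by (intro tupI) blast
  qed (use that(4) in auto)
  have "R1 a b" using R1R[OF a b(1) tid] R(2) s by auto
  have "kdiv k M J R1 b"
  proof -
    obtain c :: "nat \<Rightarrow> 'm \<Rightarrow> 'm" where c: "\<And>l. tup (c l)" "\<And>l. eqtp ?B M (c l) ?id" "kinc UNIV k R c"
      using div unfolding kdiv_def by blast
    have t: "tup (\<lambda>j. c l (b j))" for l using c(1)[of l] by (intro tupI) blast
    have "eqtp J M (\<lambda>j. c l (b j)) b" for l
    proof (rule eqtp_trans[OF eqtp_subst[OF c(2)]])
      show "eqtp J M (\<lambda>j. ?id (b j)) b"
        by (rule eqtp_agree[OF _ b(1)]) (use tid in \<open>auto intro!: tupI\<close>)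
    qed auto
    moreover have "kinc UNIV k R1 (\<lambda>l j. c l (b j))"
      using c(3) R1R[OF _ t c(1)] s unfolding kinc_def by auto
    ultimately show ?thesis unfolding kdiv_def using t by (intro exI[of _ "\<lambda>l j. c l (b j)"]) blast
  qed
  then obtain c n where c: "\<And>l. tup (c l)" "indiscernible L \<MM> M J c" "\<And>j. j \<in> J \<Longrightarrow> c 0 j = b j" "kinc UNIV n R1 c"
    by (rule kdiv_indiscernible[OF M b(2,1) R1]) blast
  obtain \<phi> where \<phi>: "\<phi> \<in> fms L I (J <+> M)"
    "\<And>x y. tup x \<Longrightarrow> tup y \<Longrightarrow> holds_at x (inst_over y \<phi>) = R1 x y"
    using fm_of_defn2[OF R1] by blast
  have "map_sum (\<lambda>v. v) (case_sum b (\<lambda>m. m)) x \<in> I <+> (M \<union> ?B)" if "x \<in> names \<phi>" for x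
  proof -
    have "x \<in> I <+> (J <+> M)" using \<phi>(1) that by (auto simp: fms_def)
    then show ?thesis by auto
  qed
  then have "inst_over b \<phi> \<in> fms L I (M \<union> ?B)"
    using \<phi>(1) by (auto simp: fms_def inst_over_def inst_def fm.set_map)
  then have "inst_over b \<phi> \<in> tp L \<MM> I a (M \<union> ?B)" using \<phi>(2)[OF a b(1)] \<open>R1 a b\<close> by (simp add: tp_def)
  moreover have "\<not> consistent \<MM> (range (\<lambda>i. inst_over (c i) \<phi>))"
  proof
    assume "consistent \<MM> (range (\<lambda>i. inst_over (c i) \<phi>))"
    then obtain x where "tup x" "\<forall>i\<in>{..<n}. R1 x (c i)"
      unfolding consistent_insts using \<phi>(2) c(1) by (metis finite_lessThan)
    then show False using c(4) unfolding kinc_def by (metis card_lessThan subset_UNIV)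
  qed
  ultimately show False using d \<phi>(1) c(2,3) unfolding dividing_indep_def by blast
qed

text \<open>Members of an indiscernible sequence are conjugate over \<open>M\<close>, and
  inconsistency of the sequence yields a bound \<open>k\<close>. This bound stays fixed in all later
  constructions.\<close>

lemma kdiv_of_not_dividing_indep:
  fixes a :: "'i \<Rightarrow> 'm" and b :: "'j \<Rightarrow> 'm"
  assumes M: "M \<subseteq> U" and a: "tup a" and b: "tup b" and d: "\<not> dividing_indep L \<MM> M J b I a"
  obtains R k where "defn2 J I M R" "R b a" "kdiv k M I R a"
proof -
  obtain \<phi> c where \<phi>: "\<phi> \<in> fms L J (I <+> M)" "inst_over a \<phi> \<in> tp L \<MM> J b (M \<union> a ` I)"
    and c: "indiscernible L \<MM> M I c" "\<forall>i\<in>I. c 0 i = a i" "\<not> consistent \<MM> (range (\<lambda>i. inst_over (c i) \<phi>))"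
    using d unfolding dividing_indep_def by blast
  define R where "R x y = holds_at x (inst_over y \<phi>)" for x y
  have R: "defn2 J I M R" unfolding R_def by (rule defn2_of_fm[OF \<phi>(1)])
  define c' where "c' l = tot I (c l)" for l
  have "c l ` I \<subseteq> U" for l using c(1) by (simp add: indiscernible_def)
  then have c't: "tup (c' l)" for l unfolding c'_def by (rule tup_tot)
  have seq: "eqtp ({..<n} \<times> I) M (\<lambda>(l, v). c' (s l) v) (\<lambda>(l, v). c' (s' l) v)"
    if s: "strict_mono_on {..<n} s" "strict_mono_on {..<n} s'" for n and s s' :: "nat \<Rightarrow> nat"
  proof -
    have t: "tup (\<lambda>(l, v). c' (s l) v)" for s :: "nat \<Rightarrow> nat" using c't by (auto intro!: tupI)
    have "tp L \<MM> ({..<n} \<times> I) (\<lambda>(l, v). c (s l) v) M = tp L \<MM> ({..<n} \<times> I) (\<lambda>(l, v). c (s' l) v) M"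
      using c(1) s unfolding indiscernible_def by blast
    moreover have "tp L \<MM> ({..<n} \<times> I) (\<lambda>(l, v). c' (s l) v) M = tp L \<MM> ({..<n} \<times> I) (\<lambda>(l, v). c (s l) v) M"
      for s :: "nat \<Rightarrow> nat"
      by (rule tp_cong) (auto simp: c'_def)
    ultimately show ?thesis using eqtp_iff_tp[OF t t] by blast
  qed
  have "eqtp I M (c' l) a" for l
  proof -
    have mono: "strict_mono_on {..<1 :: nat} (\<lambda>_ :: nat. l)" for l :: nat
      by (auto simp: strict_mono_on_def)
    from eqtp_subst[OF seq[OF mono[of l] mono[of 0]], of I "\<lambda>v. (0, v)"]
    have "eqtp I M (c' l) (c' 0)" by simp
    moreover have "eqtp I M (c' 0) a" by (rule eqtp_agree[OF c't a]) (use c(2) in \<open>auto simp: c'_def\<close>)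
    ultimately show ?thesis by (rule eqtp_trans)
  qed
  moreover have "\<exists>n. kinc UNIV n R c'"
  proof -
    have "inst_over (c i) \<phi> = inst_over (c' i) \<phi>" for i
      by (rule inst_over_cong[OF \<phi>(1)]) (simp add: c'_def)
    then obtain K where K: "finite K" "\<not> joint R K c'"
      using c(3) unfolding consistent_insts R_def by metis
    have "strict_mono_on {..<n} (\<lambda>l. l)" for n :: nat by (simp add: strict_mono_on_def)
    from kinc_of_inconsistent[OF R seq[OF _ this] K] show ?thesis .
  qed
  moreover have "R b a" using \<phi>(2) by (simp add: R_def tp_def)
  ultimately show thesis using that R c't unfolding kdiv_def by blast
qed

end

section \<open>Dividing trees\<close>

context fo_struct
begin

text \<open>A tree of height \<open>n\<close> above the branch \<open>es\<close>, with
  k-inconsistent siblings and consistent branches. Carrying the branch along, instead of naming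
  nodes, lets an automorphism act on all that lies above \<open>es\<close> by acting on
  \<open>es\<close>.\<close>

primrec dtree :: "nat \<Rightarrow> (('x \<Rightarrow> 'm) \<Rightarrow> ('v \<Rightarrow> 'm) \<Rightarrow> bool) \<Rightarrow> nat \<Rightarrow> ('v \<Rightarrow> 'm) list \<Rightarrow> bool" where
  "dtree k R 0 es \<longleftrightarrow> (\<exists>x. tup x \<and> (\<forall>e\<in>set es. R x e))"
| "dtree k R (Suc n) es \<longleftrightarrow> (\<exists>c :: nat \<Rightarrow> 'v \<Rightarrow> 'm. (\<forall>l. tup (c l)) \<and> kinc UNIV k R c \<and>
    (\<forall>l. dtree k R n (es @ [c l])))"

text \<open>An automorphism restores earlier nodes only at their coordinates in \<open>V\<close>, so
  nodes agreeing there must be exchangeable.\<close>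

lemma dtree_cong:
  assumes R: "defn2 X V M R"
  shows "list_all2 (\<lambda>e e'. tup e \<and> tup e' \<and> (\<forall>v\<in>V. e v = e' v)) es es' \<Longrightarrow> dtree k R n es \<Longrightarrow> dtree k R n es'"
proof (induction n arbitrary: es es')
  case 0
  obtain x where x: "tup x" "\<And>e. e \<in> set es \<Longrightarrow> R x e" using 0(2) by auto
  have "R x e'" if e': "e' \<in> set es'" for e'
  proof -
    obtain i where i: "i < length es'" "e' = es' ! i" using e' by (auto simp: in_set_conv_nth)
    then have e: "tup (es ! i)" "tup e'" "\<forall>v\<in>V. (es ! i) v = e' v" "es ! i \<in> set es"
      using 0(1) by (auto simp: list_all2_conv_all_nth)
    have "R x (es ! i) = R x e'" by (rule defn2_local[OF R x(1) e(1) x(1) e(2)]) (use e(3) in auto)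
    then show ?thesis using x(2) e(4) by simp
  qed
  then show ?case using x(1) by auto
next
  case (Suc n)
  obtain c :: "nat \<Rightarrow> _" where c: "\<And>l. tup (c l)" "kinc UNIV k R c" "\<And>l. dtree k R n (es @ [c l])"
    using Suc.prems(2) by auto
  have "dtree k R n (es' @ [c l])" for l
  proof (rule Suc.IH[OF _ c(3)])
    show "list_all2 (\<lambda>e e'. tup e \<and> tup e' \<and> (\<forall>v\<in>V. e v = e' v)) (es @ [c l]) (es' @ [c l])"
      using Suc.prems(1) c(1) by (auto intro: list_all2_appendI)
  qed
  then show ?case using c(1,2) by auto
qed

lemma automorphism_defn2:
  assumes g: "automorphism L \<MM> g" "\<And>m. m \<in> M \<Longrightarrow> g m = m" and M: "M \<subseteq> U" and R: "defn2 X V M R"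
    and t: "tup x" "tup e"
  shows "R (\<lambda>v. g (x v)) (\<lambda>v. g (e v)) = R x e"
proof -
  have "tup (case_sum x e)" using t by (intro tupI) (auto split: sum.split)
  from automorphism_defn[OF g R[unfolded defn2_def] this M] show ?thesis by simp
qed

lemma dtree_automorphism:
  assumes g: "automorphism L \<MM> g" "\<And>m. m \<in> M \<Longrightarrow> g m = m" and M: "M \<subseteq> U" and R: "defn2 X V M R"
  shows "(\<And>e. e \<in> set es \<Longrightarrow> tup e) \<Longrightarrow> dtree k R n es \<Longrightarrow> dtree k R n (map (\<lambda>e v. g (e v)) es)"
proof (induction n arbitrary: es)
  case 0
  obtain x where x: "tup x" "\<And>e. e \<in> set es \<Longrightarrow> R x e" using 0(2) by auto
  have "R (\<lambda>v. g (x v)) (\<lambda>v. g (e v))" if "e \<in> set es" for e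
    using automorphism_defn2[OF g M R x(1) 0(1)[OF that]] x(2)[OF that] by simp
  moreover have "tup (\<lambda>v. g (x v))" by (rule automorphism_tup[OF g(1) x(1)])
  ultimately show ?case by auto
next
  case (Suc n)
  obtain c :: "nat \<Rightarrow> _" where c: "\<And>l. tup (c l)" "kinc UNIV k R c" "\<And>l. dtree k R n (es @ [c l])"
    using Suc.prems(2) by auto
  have "dtree k R n (map (\<lambda>e v. g (e v)) (es @ [c l]))" for l
    by (rule Suc.IH[OF _ c(3)]) (use Suc.prems(1) c(1) in auto)
  moreover have "kinc UNIV k R (\<lambda>l v. g (c l v))" by (rule kinc_automorphism[OF g M R c(1,2)])
  moreover have "tup (\<lambda>v. g (c l v))" for l by (rule automorphism_tup[OF g(1) c(1)])
  ultimately show ?case by (auto intro!: exI[of _ "\<lambda>l v. g (c l v)"])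
qed

text \<open>Unfolds the recursion into a labelling of nodes by nonempty lists; the label of the
  empty list is a dummy.\<close>

lemma dtree_branching:
  fixes R :: "('x \<Rightarrow> 'm) \<Rightarrow> ('v \<Rightarrow> 'm) \<Rightarrow> bool"
  shows "dtree k R n es \<Longrightarrow> \<exists>\<tau> :: nat list \<Rightarrow> 'v \<Rightarrow> 'm. (\<forall>s. tup (\<tau> s)) \<and>
    (\<forall>s. length s < n \<longrightarrow> kinc UNIV k R (\<lambda>l. \<tau> (s @ [l]))) \<and>
    (\<forall>s. length s = n \<longrightarrow> (\<exists>x. tup x \<and> (\<forall>e\<in>set es. R x e) \<and> (\<forall>i<n. R x (\<tau> (take (Suc i) s)))))"
proof (induction n arbitrary: es)
  case 0
  then show ?case by (intro exI[of _ "\<lambda>_ _. pt"]) auto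
next
  case (Suc n)
  obtain c :: "nat \<Rightarrow> 'v \<Rightarrow> 'm" where c: "\<And>l. tup (c l)" "kinc UNIV k R c" "\<And>l. dtree k R n (es @ [c l])"
    using Suc.prems by auto
  have "\<forall>l. \<exists>\<tau> :: nat list \<Rightarrow> 'v \<Rightarrow> 'm. (\<forall>s. tup (\<tau> s)) \<and>
    (\<forall>s. length s < n \<longrightarrow> kinc UNIV k R (\<lambda>l. \<tau> (s @ [l]))) \<and>
    (\<forall>s. length s = n \<longrightarrow> (\<exists>x. tup x \<and> (\<forall>e\<in>set (es @ [c l]). R x e) \<and> (\<forall>i<n. R x (\<tau> (take (Suc i) s)))))"
    using Suc.IH[OF c(3)] by blast
  from choice[OF this] obtain \<tau> :: "nat \<Rightarrow> nat list \<Rightarrow> 'v \<Rightarrow> 'm" where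
    \<tau>: "\<And>l s. tup (\<tau> l s)" "\<And>l s. length s < n \<Longrightarrow> kinc UNIV k R (\<lambda>l'. \<tau> l (s @ [l']))"
      "\<And>l s. length s = n \<Longrightarrow> \<exists>x. tup x \<and> (\<forall>e\<in>set (es @ [c l]). R x e) \<and> (\<forall>i<n. R x (\<tau> l (take (Suc i) s)))"
    by metis
  define \<theta> where "\<theta> s = (case s of [] \<Rightarrow> (\<lambda>_. pt) | l # s' \<Rightarrow> if s' = [] then c l else \<tau> l s')" for s
  have "tup (\<theta> s)" for s using c(1) \<tau>(1) by (auto simp: \<theta>_def split: list.split)
  moreover have "kinc UNIV k R (\<lambda>l. \<theta> (s @ [l]))" if "length s < Suc n" for s
  proof (cases s)
    case Nil
    then show ?thesis using c(2) by (simp add: \<theta>_def)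
  next
    case (Cons l s')
    then show ?thesis using \<tau>(2)[of s' l] that by (simp add: \<theta>_def)
  qed
  moreover have "\<exists>x. tup x \<and> (\<forall>e\<in>set es. R x e) \<and> (\<forall>i<Suc n. R x (\<theta> (take (Suc i) s)))"
    if len: "length s = Suc n" for s
  proof -
    obtain l s' where s: "s = l # s'" "length s' = n" using len by (auto simp: length_Suc_conv)
    obtain x where x: "tup x" "\<forall>e\<in>set (es @ [c l]). R x e" "\<forall>i<n. R x (\<tau> l (take (Suc i) s'))"
      using \<tau>(3)[OF s(2), of l] by blast
    have "R x (\<theta> (take (Suc i) s))" if "i < Suc n" for i
    proof (cases i)
      case 0
      then show ?thesis using x(2) s by (simp add: \<theta>_def)
    next
      case (Suc j)
      then have "j < n" using that by simp
      moreover from this have "take (Suc j) s' \<noteq> []" using s(2) by auto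
      ultimately show ?thesis using x(3) s(1) Suc by (simp add: \<theta>_def)
    qed
    then show ?thesis using x(1,2) by auto
  qed
  ultimately show ?case by blast
qed

end

section \<open>Wide trees and chains of models\<close>

context monster
begin

text \<open>Working from the end of the chain, \<open>es ! i\<close> is replaced by the members of a
  sequence witnessing that it divides over the earlier elements. Each member is conjugate to
  \<open>es ! i\<close> over these, and the automorphism carries over the tree already built
  above.\<close>

lemma dtree_of_chain:
  fixes R :: "('j \<Rightarrow> 'm) \<Rightarrow> ('i \<Rightarrow> 'm) \<Rightarrow> bool"
  assumes M: "M \<subseteq> U" "small \<kappa> M" and V: "small \<kappa> V" and R: "defn2 J V M R" and b: "tup b"
    and es: "length es = n" "\<And>e. e \<in> set es \<Longrightarrow> tup e \<and> R b e"
    and div: "\<And>i. i < n \<Longrightarrow> kdiv k (M \<union> (\<Union>e\<in>set (take i es). e ` V)) V R (es ! i)"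
  shows "j \<le> n \<Longrightarrow> dtree k R j (take (n - j) es)"
proof (induction j)
  case 0
  then show ?case using es b by auto
next
  case (Suc j)
  define i where "i = n - Suc j"
  have i: "i < n" "n - j = Suc i" using Suc.prems by (auto simp: i_def)
  let ?C = "M \<union> (\<Union>e\<in>set (take i es). e ` V)"
  have mem: "e \<in> set es" if "e \<in> set (take i es)" for e using that by (rule in_set_takeD)
  have "small \<kappa> (\<Union>e\<in>set xs. e ` V)" for xs :: "('i \<Rightarrow> 'm) list"
    by (induction xs) (auto intro!: small_Un small_image V intro: small_finite)
  then have C: "small \<kappa> ?C" "?C \<subseteq> U" using M es(2) mem by (auto intro!: small_Un)
  obtain c :: "nat \<Rightarrow> 'i \<Rightarrow> 'm" where c: "\<And>l. tup (c l)" "\<And>l. eqtp V ?C (c l) (es ! i)" "kinc UNIV k R c"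
    using div[OF i(1)] unfolding kdiv_def by blast
  have ti: "tup (es ! i)" using es i(1) by auto
  have D: "dtree k R j (take i es @ [es ! i])"
    using Suc i es(1) by (simp add: take_Suc_conv_app_nth)
  have "dtree k R j (take i es @ [c l])" for l
  proof -
    obtain g where g: "automorphism L \<MM> g" "\<And>m. m \<in> ?C \<Longrightarrow> g m = m" "\<And>v. v \<in> V \<Longrightarrow> g ((es ! i) v) = c l v"
      using homogeneity[OF ti c(1) V C eqtp_sym[OF c(2)]] by metis
    have te: "tup e" if "e \<in> set (take i es @ [es ! i])" for e using that es(2) mem ti by auto
    have "dtree k R j (map (\<lambda>e v. g (e v)) (take i es @ [es ! i]))"
      by (rule dtree_automorphism[OF g(1) _ M(1) R te D]) (use g(2) in blast)
    moreover have "list_all2 (\<lambda>e e'. tup e \<and> tup e' \<and> (\<forall>v\<in>V. e v = e' v))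
        (map (\<lambda>e v. g (e v)) (take i es @ [es ! i])) (take i es @ [c l])"
    proof -
      have "list_all2 (\<lambda>e e'. tup e \<and> tup e' \<and> (\<forall>v\<in>V. e v = e' v))
          (map (\<lambda>e v. g (e v)) (take i es)) (take i es)"
        unfolding list_all2_map1
      proof (rule list_all2_same[THEN iffD2], intro ballI conjI)
        fix e v assume e: "e \<in> set (take i es)"
        show "tup e" using es(2) mem[OF e] by blast
        then show "tup (\<lambda>v. g (e v))" by (rule automorphism_tup[OF g(1)])
        show "g (e v) = e v" if "v \<in> V" using g(2) e that by blast
      qed
      moreover have "tup (\<lambda>v. g ((es ! i) v))" by (rule automorphism_tup[OF g(1) ti])
      ultimately show ?thesis using c(1) g(3) by (auto intro!: list_all2_appendI)
    qed
    ultimately show ?thesis using dtree_cong[OF R] by blast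
  qed
  then show ?case using c(1,3) unfolding i_def[symmetric] by auto
qed

text \<open>By compactness over finite sets of labels and finite heights: the labels are embedded
  into \<open>nat\<close>, and a countably branching tree of the required height supplies the
  nodes.\<close>

lemma wide_dtree:
  fixes R :: "('x \<Rightarrow> 'm) \<Rightarrow> ('v \<Rightarrow> 'm) \<Rightarrow> bool" and \<Lambda> :: "'l set"
  assumes M: "M \<subseteq> U" "small \<kappa> M" and V: "small \<kappa> V" and R: "defn2 X V M R"
    and tree: "\<And>n. dtree k R n []" and \<Lambda>: "infinite \<Lambda>" "small \<kappa> \<Lambda>"
  obtains t :: "'l list \<Rightarrow> 'v \<Rightarrow> 'm" where "\<And>s. tup (t s)"
    "\<And>s. s \<in> lists \<Lambda> \<Longrightarrow> kinc \<Lambda> k R (\<lambda>l. t (s @ [l]))"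
    "\<And>s. s \<in> lists \<Lambda> \<Longrightarrow> \<exists>x. tup x \<and> (\<forall>i<length s. R x (t (take (Suc i) s)))"
proof -
  define Inc :: "'l list \<Rightarrow> 'l set \<Rightarrow> ('l list \<times> 'v \<Rightarrow> 'm) \<Rightarrow> bool" where
    "Inc s K e \<longleftrightarrow> \<not> joint R K (\<lambda>l v. e (s @ [l], v))" for s K e
  define Con :: "'l list \<Rightarrow> ('l list \<times> 'v \<Rightarrow> 'm) \<Rightarrow> bool" where
    "Con s e \<longleftrightarrow> joint R {..<length s} (\<lambda>i v. e (take (Suc i) s, v))" for s e
  define \<R> where "\<R> I n = {Inc s K | s K. s \<in> lists I \<and> length s < n \<and> K \<subseteq> I \<and> card K = k} \<union>
    {Con s | s. s \<in> lists I \<and> length s \<le> n}" for I n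
  have mono: "\<R> I n \<subseteq> \<R> J m" if "I \<subseteq> J" "n \<le> m" for I J n m
  proof -
    have "lists I \<subseteq> lists J" using that(1) by (rule lists_mono)
    then show ?thesis using that unfolding \<R>_def
      by (intro Un_mono) (blast intro: less_le_trans, blast intro: order_trans)
  qed
  have "0 < k" using tree[of 1] kinc_pos by auto
  then have finK: "finite K" if "card K = k" for K :: "'l set"
    using that card.infinite by fastforce
  have "|lists \<Lambda>| \<le>o |\<Lambda>|" by (rule card_lists_ordLeq[OF \<Lambda>(1) card_of_mono1[OF order_refl]])
  then have sl: "small \<kappa> (lists \<Lambda>)" using small_ordLeq \<Lambda>(2) by blast
  define D where "D = {I. finite I \<and> I \<subseteq> \<Lambda>} \<times> (UNIV :: nat set)"
  obtain e where te: "tup e" and "\<And>In Q. In \<in> D \<Longrightarrow> Q \<in> case_prod \<R> In \<Longrightarrow> Q e"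
  proof (rule saturation_directed)
    show "small \<kappa> (lists \<Lambda> \<times> V)" by (rule small_Times[OF sl V])
    show "D \<noteq> {}" by (auto simp: D_def)
  next
    fix p q assume "p \<in> D" "q \<in> D"
    then obtain I n J m where pq: "p = (I, n)" "q = (J, m)" "(I \<union> J, max n m) \<in> D" by (auto simp: D_def)
    then show "\<exists>r\<in>D. case_prod \<R> p \<union> case_prod \<R> q \<subseteq> case_prod \<R> r"
      using mono[of I "I \<union> J" n "max n m"] mono[of J "I \<union> J" m "max n m"]
      by (intro bexI[of _ "(I \<union> J, max n m)"]) auto
  next
    fix p Q assume "p \<in> D" "Q \<in> case_prod \<R> p"
    then obtain I n where "I \<subseteq> \<Lambda>" "Q \<in> \<R> I n" by (auto simp: D_def)
    then have "Q \<in> \<R> \<Lambda> n" using mono[of I \<Lambda> n n] by blast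
    then consider s K where "Q = Inc s K" "s \<in> lists \<Lambda>" "K \<subseteq> \<Lambda>" "card K = k"
      | s where "Q = Con s" "s \<in> lists \<Lambda>" unfolding \<R>_def by blast
    then show "defn (lists \<Lambda> \<times> V) M Q"
    proof cases
      case 1
      have "defn (lists \<Lambda> \<times> V) M (\<lambda>e. joint R K (\<lambda>l v. (\<lambda>l v e. e (s @ [l], v)) l v e))"
      proof (rule defn_joint[OF R finK[OF 1(4)]])
        fix l v assume "l \<in> K" "v \<in> V"
        moreover from this have "s @ [l] \<in> lists \<Lambda>" using 1(2,3) by auto
        ultimately show "(\<exists>z\<in>lists \<Lambda> \<times> V. \<forall>e :: 'l list \<times> 'v \<Rightarrow> 'm. tup e \<longrightarrow> e (s @ [l], v) = e z) \<or>
            (\<exists>m\<in>M. \<forall>e :: 'l list \<times> 'v \<Rightarrow> 'm. tup e \<longrightarrow> e (s @ [l], v) = m)"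
          by blast
      qed auto
      then show ?thesis unfolding 1(1) Inc_def by (rule defn_not)
    next
      case 2
      have "defn (lists \<Lambda> \<times> V) M (\<lambda>e. joint R {..<length s} (\<lambda>i v. (\<lambda>i v e. e (take (Suc i) s, v)) i v e))"
      proof (rule defn_joint[OF R])
        fix i v assume "v \<in> V"
        moreover have "take (Suc i) s \<in> lists \<Lambda>" using 2(2) set_take_subset[of "Suc i" s] by auto
        ultimately show "(\<exists>z\<in>lists \<Lambda> \<times> V. \<forall>e :: 'l list \<times> 'v \<Rightarrow> 'm. tup e \<longrightarrow> e (take (Suc i) s, v) = e z) \<or>
            (\<exists>m\<in>M. \<forall>e :: 'l list \<times> 'v \<Rightarrow> 'm. tup e \<longrightarrow> e (take (Suc i) s, v) = m)"
          by blast
      qed auto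
      then show ?thesis unfolding 2(1) Con_def .
    qed
  next
    fix p assume "p \<in> D"
    then obtain I n where p: "p = (I, n)" and I: "finite I" by (auto simp: D_def)
    obtain h :: "'l \<Rightarrow> nat" where h: "inj_on h I" using finite_imp_inj_to_nat_seg[OF I] by blast
    obtain \<tau> :: "nat list \<Rightarrow> 'v \<Rightarrow> 'm" where \<tau>: "\<And>s. tup (\<tau> s)"
      "\<And>s. length s < n \<Longrightarrow> kinc UNIV k R (\<lambda>l. \<tau> (s @ [l]))"
      "\<And>s. length s = n \<Longrightarrow> \<exists>x. tup x \<and> (\<forall>i<n. R x (\<tau> (take (Suc i) s)))"
      using dtree_branching[OF tree[of n]] by auto
    let ?e = "\<lambda>(s, v). \<tau> (map h s) v"
    have "Q ?e" if Q: "Q \<in> \<R> I n" for Q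
    proof -
      consider s K where "Q = Inc s K" "length s < n" "K \<subseteq> I" "card K = k" | s where "Q = Con s" "length s \<le> n"
        using Q unfolding \<R>_def by blast
      then show ?thesis
      proof cases
        case 1
        have "kinc I k R (\<lambda>l. \<tau> (map h s @ [h l]))"
          by (rule kinc_reindex[OF \<tau>(2) h]) (use 1(2) in simp_all)
        then show ?thesis using 1 unfolding kinc_def Inc_def by simp
      next
        case 2
        \<comment> \<open>Shorter branches are padded to full height, where their consistency is
          known.\<close>
        let ?s = "map h s @ replicate (n - length s) 0"
        obtain x where x: "tup x" "\<forall>i<n. R x (\<tau> (take (Suc i) ?s))" using \<tau>(3)[of ?s] 2(2) by auto
        have "R x (\<tau> (map h (take (Suc i) s)))" if i: "i < length s" for i
        proof -
          have "take (Suc i) ?s = map h (take (Suc i) s)" using i by (simp add: take_map)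
          moreover have "R x (\<tau> (take (Suc i) ?s))" using x(2) i 2(2) by (meson less_le_trans)
          ultimately show ?thesis by (simp only:)
        qed
        then show ?thesis using x(1) unfolding 2(1) Con_def by auto
      qed
    qed
    moreover have "tup ?e" using \<tau>(1) by (auto intro!: tupI)
    ultimately show "\<exists>e. tup e \<and> (\<forall>Q\<in>case_prod \<R> p. Q e)" unfolding p by auto
  qed (use M in auto)
  then have e: "Q e" if "finite I" "I \<subseteq> \<Lambda>" "Q \<in> \<R> I n" for Q I n using that by (auto simp: D_def)
  show thesis
  proof
    show "tup (\<lambda>v. e (s, v))" for s using te by (intro tupI) blast
  next
    fix s assume s: "s \<in> lists \<Lambda>"
    show "kinc \<Lambda> k R (\<lambda>l v. e (s @ [l], v))"
      unfolding kinc_def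
    proof (intro allI impI)
      fix K assume K: "K \<subseteq> \<Lambda>" "card K = k"
      then have "Inc s K \<in> \<R> (set s \<union> K) (Suc (length s))" unfolding \<R>_def by auto
      from e[OF _ _ this] have "Inc s K e" using K s finK by auto
      then show "\<not> joint R K (\<lambda>l v. e (s @ [l], v))" unfolding Inc_def .
    qed
    have "Con s \<in> \<R> (set s) (length s)" unfolding \<R>_def by auto
    from e[OF _ _ this] have "Con s e" using s by auto
    then show "\<exists>x. tup x \<and> (\<forall>i<length s. R x (\<lambda>v. e (take (Suc i) s, v)))"
      unfolding Con_def by auto
  qed
qed

lemma card_Pow_mono:
  assumes "|A| \<le>o |B|"
  shows "|Pow A| \<le>o |Pow B|"
proof -
  obtain f where f: "inj_on f A" "f ` A \<subseteq> B" using assms card_of_ordLeq by metis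
  have "inj_on (image f) (Pow A)" by (rule inj_on_image_Pow[OF f(1)])
  moreover have "image f ` Pow A \<subseteq> Pow B" using f(2) by blast
  ultimately show ?thesis using card_of_ordLeq by metis
qed

text \<open>A single bound \<open>S\<close> controls all stages: a model of size at most
  \<open>|S|\<close> realizes at most \<open>|Pow S|\<close> types of \<open>V\<close>-tuples, fewer
  than there are siblings. The infinitely many siblings of one type witness dividing over the
  current model, and the next model absorbs the chosen sibling without exceeding the bound.\<close>

lemma dividing_chain_of_models:
  fixes R :: "('x \<Rightarrow> 'm) \<Rightarrow> ('v \<Rightarrow> 'm) \<Rightarrow> bool"
  assumes M: "M \<subseteq> U" "small \<kappa> M" and V: "small \<kappa> V" and R: "defn2 X V M R"
    and tree: "\<And>n. dtree k R n []"
  obtains N m where "\<And>n :: nat. tarski_vaught (N n)" "\<And>n. N n \<subseteq> N (Suc n)" "M \<subseteq> N 0"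
    "small \<kappa> (\<Union>n. N n)" "\<And>n. tup (m n)" "\<And>n. m n ` V \<subseteq> N (Suc n)" "\<And>n. kdiv k (N n) V R (m n)"
    "\<And>n. \<exists>x. tup x \<and> (\<forall>i<n. R x (m i))"
proof -
  obtain S :: "(('v + 'm) + 'f + 'r + nat) set" where S: "infinite S" and sS: "small \<kappa> S"
    and FS: "|dom (farity L)| \<le>o |S|" and RS: "|dom (rarity L)| \<le>o |S|"
    and VS: "|V| \<le>o |S|" and MS: "|M| \<le>o |S|"
    by (rule small_bound[OF V M(2)])
  obtain N0 where N0: "M \<subseteq> N0" "tarski_vaught N0" "|N0| \<le>o |S|"
    by (rule loewenheim_skolem[OF S FS RS M(1) MS])
  define \<Lambda> where "\<Lambda> = Pow (Pow S)"
  have "infinite \<Lambda>" "small \<kappa> \<Lambda>" unfolding \<Lambda>_def using S by (simp_all add: small_Pow sS)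
  then obtain t where t: "\<And>s. tup (t s)" "\<And>s. s \<in> lists \<Lambda> \<Longrightarrow> kinc \<Lambda> k R (\<lambda>l. t (s @ [l]))"
    "\<And>s. s \<in> lists \<Lambda> \<Longrightarrow> \<exists>x. tup x \<and> (\<forall>i<length s. R x (t (take (Suc i) s)))"
    using wide_dtree[OF M V R tree] by metis
  \<comment> \<open>A stage is a node together with a model; the cardinality bound is carried along
    so that the pigeonhole can be repeated.\<close>
  let ?P = "\<lambda>n (s, N). length s = n \<and> s \<in> lists \<Lambda> \<and> tarski_vaught N \<and> |N| \<le>o |S| \<and> (n = 0 \<longrightarrow> M \<subseteq> N)"
  let ?Q = "\<lambda>n (s, N) (s', N'). (\<exists>l. s' = s @ [l]) \<and> N \<subseteq> N' \<and> t s' ` V \<subseteq> N' \<and> kdiv k N V R (t s')"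
  have next_model: "\<exists>y. ?P (Suc n) y \<and> ?Q n x y" if x: "?P n x" for n x
  proof -
    obtain s N where sN: "x = (s, N)" by fastforce
    have s: "length s = n" "s \<in> lists \<Lambda>" and N: "tarski_vaught N" "|N| \<le>o |S|" using x sN by auto
    have "(\<lambda>l. tp L \<MM> V (t (s @ [l])) N) ` \<Lambda> \<subseteq> Pow (fms L V N)" by (auto simp: tp_def)
    then have "|(\<lambda>l. tp L \<MM> V (t (s @ [l])) N) ` \<Lambda>| \<le>o |Pow (fms L V N)|" by (rule card_of_mono1)
    also have "|Pow (fms L V N)| \<le>o |Pow S|" by (rule card_Pow_mono[OF card_fms[OF S FS RS VS N(2)]])
    finally have few: "|(\<lambda>l. tp L \<MM> V (t (s @ [l])) N) ` \<Lambda>| \<le>o |Pow S|" .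
    have many: "|Pow S| <o |\<Lambda>|" unfolding \<Lambda>_def by (rule card_of_Pow)
    have "infinite (Pow S)" using S by simp
    then obtain y where "infinite {l \<in> \<Lambda>. tp L \<MM> V (t (s @ [l])) N = y}"
      by (rule infinite_fiber[OF _ few many])
    then obtain h :: "nat \<Rightarrow> _" where h: "inj h" "range h \<subseteq> {l \<in> \<Lambda>. tp L \<MM> V (t (s @ [l])) N = y}"
      unfolding infinite_iff_countable_subset by blast
    then have hl: "h j \<in> \<Lambda>" "tp L \<MM> V (t (s @ [h j])) N = y" for j by auto
    have "eqtp V N (t (s @ [h j])) (t (s @ [h 0]))" for j
      using eqtp_iff_tp[OF t(1) t(1)] hl(2) by metis
    moreover have "kinc UNIV k R (\<lambda>j. t (s @ [h j]))"
      by (rule kinc_reindex[OF t(2)[OF s(2)] h(1)]) (use hl in blast)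
    ultimately have div: "kdiv k N V R (t (s @ [h 0]))"
      unfolding kdiv_def using t(1) by (intro exI[of _ "\<lambda>j. t (s @ [h j])"]) blast
    have "N \<union> t (s @ [h 0]) ` V \<subseteq> U" using N(1) t(1) by (auto simp: tarski_vaught_def)
    moreover have "|N \<union> t (s @ [h 0]) ` V| \<le>o |S|" by (intro card_Un_ordLeq card_image_ordLeq S N(2) VS)
    ultimately obtain N' where "N \<union> t (s @ [h 0]) ` V \<subseteq> N'" "tarski_vaught N'" "|N'| \<le>o |S|"
      by (rule loewenheim_skolem[OF S FS RS, of "N \<union> t (s @ [h 0]) ` V"])
    then have "?P (Suc n) (s @ [h 0], N')" "?Q n x (s @ [h 0], N')"
      using s hl(1)[of 0] div by (simp_all add: sN)
    then show ?thesis by (intro exI[of _ "(s @ [h 0], N')"] conjI)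
  qed
  have "\<exists>f. \<forall>n. ?P n (f n) \<and> ?Q n (f n) (f (Suc n))"
  proof (rule dependent_nat_choice)
    show "\<exists>x. ?P 0 x" using N0 by (intro exI[of _ "([], N0)"]) simp
  next
    fix x n assume "?P n x"
    then show "\<exists>y. ?P (Suc n) y \<and> ?Q n x y" by (rule next_model)
  qed
  then obtain f where f': "\<forall>n. ?P n (f n) \<and> ?Q n (f n) (f (Suc n))" by (elim exE)
  have f: "?P n (f n)" for n by (rule conjunct1[OF spec[OF f', of n]])
  have f_step: "?Q n (f n) (f (Suc n))" for n by (rule conjunct2[OF spec[OF f', of n]])
  define s where "s n = fst (f n)" for n
  define N where "N n = snd (f n)" for n
  have s: "length (s n) = n" "s n \<in> lists \<Lambda>" and N: "tarski_vaught (N n)" "|N n| \<le>o |S|" "M \<subseteq> N 0"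
    for n using f[of n] f[of 0] by (auto simp: s_def N_def split: prod.splits)
  have step: "\<exists>l. s (Suc n) = s n @ [l]" "N n \<subseteq> N (Suc n)" "t (s (Suc n)) ` V \<subseteq> N (Suc n)"
    "kdiv k (N n) V R (t (s (Suc n)))" for n
    using f_step[of n] by (auto simp: s_def N_def split: prod.splits)
  have "|\<Union>n. N n| \<le>o |S|" by (rule card_UN_nat_ordLeq[OF S N(2)])
  then have sN: "small \<kappa> (\<Union>n. N n)" using small_ordLeq sS by blast
  have path: "\<exists>x. tup x \<and> (\<forall>i<n. R x (t (s (Suc i))))" for n
  proof -
    have tk: "take i (s (i + j)) = s i" for i j
    proof (induction j)
      case 0
      then show ?case using s(1)[of i] by simp
    next
      case (Suc j)
      obtain l where "s (Suc (i + j)) = s (i + j) @ [l]" using step(1) by blast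
      then show ?case using Suc s(1)[of "i + j"] by simp
    qed
    have "take (Suc i) (s n) = s (Suc i)" if "i < n" for i
      using tk[of "Suc i" "n - Suc i"] that by simp
    moreover obtain x where "tup x" "\<forall>i<n. R x (t (take (Suc i) (s n)))"
      using t(3)[OF s(2)[of n]] s(1)[of n] by auto
    ultimately show ?thesis by auto
  qed
  show thesis
    by (rule that[of N "\<lambda>n. t (s (Suc n))", OF N(1) step(2) N(3) sN t(1) step(3,4) path])
qed

section \<open>Local character\<close>

text \<open>The witnessing sequences \<open>c n\<close> are taken to the limit jointly, as tuples
  over \<open>nat \<times> V\<close>, so the limit \<open>y\<close> is again k-inconsistent. A
  predicate over the union has its parameters in some \<open>N j\<close>, and for
  \<open>n \<ge> j\<close> it cannot tell \<open>c n l\<close> from \<open>m n\<close>; hence every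
  \<open>y l\<close> realizes the limit of the types of the \<open>m n\<close>. Kim's lemma then
  gives an inconsistency that reflects to finitely many \<open>m n\<close>, which have a common
  solution.\<close>

lemma no_dividing_chain:
  fixes R :: "('x \<Rightarrow> 'm) \<Rightarrow> ('v \<Rightarrow> 'm) \<Rightarrow> bool" and N :: "nat \<Rightarrow> 'm set"
  assumes nTP2: "\<not> TP2 L \<MM>" and sw: "strong_witnessing L \<kappa> \<MM>"
    and V: "small \<kappa> V" and R: "defn2 UNIV V M R"
    and N: "\<And>n. tarski_vaught (N n)" "\<And>n. N n \<subseteq> N (Suc n)" "M \<subseteq> N 0" "small \<kappa> (\<Union>n. N n)"
    and m: "\<And>n. tup (m n)" "\<And>n. m n ` V \<subseteq> N (Suc n)" "\<And>n. kdiv k (N n) V R (m n)"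
      "\<And>n. \<exists>x. tup x \<and> (\<forall>i<n. R x (m i))"
  shows False
proof -
  let ?N = "\<Union>n. N n"
  have model: "small_model L \<kappa> \<MM> ?N"
    using tarski_vaught_elem_sub[OF tarski_vaught_UN_chain[where N = N, OF N(1,2)]] N(4) by (simp add: small_model_def)
  have NU: "?N \<subseteq> U" using N(1) unfolding tarski_vaught_def by blast
  have MN: "M \<subseteq> ?N" using N(3) by blast
  obtain \<U> :: "nat set set" where u: "ultra \<U>" "\<And>F. finite F \<Longrightarrow> - F \<in> \<U>" by (rule nonprincipal_ultra) blast
  have "\<forall>n. \<exists>c :: nat \<Rightarrow> 'v \<Rightarrow> 'm. (\<forall>l. tup (c l) \<and> eqtp V (N n) (c l) (m n)) \<and> kinc UNIV k R c"
    using m(3) unfolding kdiv_def by blast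
  from choice[OF this] obtain c :: "nat \<Rightarrow> nat \<Rightarrow> 'v \<Rightarrow> 'm" where
    c: "\<And>n l. tup (c n l)" "\<And>n l. eqtp V (N n) (c n l) (m n)" "\<And>n. kinc UNIV k R (c n)" by blast
  let ?I = "(UNIV :: nat set) \<times> V" and ?C = "\<lambda>n (l, v). c n l v"
  have tC: "tup (?C n)" for n using c(1) by (auto intro!: tupI)
  obtain z where z: "tup z" "realizing (limt \<U> ?I ?C) ?I ?N z"
    using realizing_exists[OF limt_global[where c = ?C and V = ?I, OF u(1) tC] small_Times[OF small_nat V] N(4) NU] by blast
  have zforces: "T z \<longleftrightarrow> {n. T (?C n)} \<in> \<U>" if "defn ?I ?N T" for T
    using realizingD[OF z(2) that] forces_limt[where c = ?C, OF u(1) tC defn_mono[OF that order_refl NU]] by simp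
  define y where "y l v = z (l, v)" for l v
  have ty: "tup (y l)" for l unfolding y_def using z(1) by (intro tupI) blast
  have ylim: "T (y l) \<longleftrightarrow> {n. T (m n)} \<in> \<U>" if T: "defn V ?N T" for T l
  proof -
    have "defn ?I ?N (\<lambda>e. T (\<lambda>v. e (l, v)))" by (rule defn_subst[OF T]) auto
    from zforces[OF this] have "T (y l) \<longleftrightarrow> {n. T (c n l)} \<in> \<U>" by (simp add: y_def[abs_def])
    moreover obtain V0 A0 where A0: "finite V0" "V0 \<subseteq> V" "finite A0" "A0 \<subseteq> ?N" "defn V0 A0 T"
      by (rule defn_finite[OF T])
    obtain j where j: "A0 \<subseteq> N j" by (rule finite_subset_UN_chain[OF A0(3,4) N(2)])
    have "T (c n l) = T (m n)" if "j \<le> n" for n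
    proof -
      have "A0 \<subseteq> N n" using j lift_Suc_mono_le[of N, OF N(2) that] by blast
      then show ?thesis using eqtpD[OF c(2) defn_mono[OF A0(5,2)]] by blast
    qed
    then have "{n. T (c n l)} \<inter> - {..<j} = {n. T (m n)} \<inter> - {..<j}" by auto
    moreover have "A \<inter> - {..<j} \<in> \<U> \<longleftrightarrow> A \<in> \<U>" for A
      using ultra_Int[OF u(1) _ u(2)[of "{..<j}"]] ultra_mono[OF u(1)] by blast
    ultimately show ?thesis by metis
  qed
  then have yeq: "eqtp V ?N (y l) (y 0)" for l unfolding eqtp_def by blast
  have ykinc: "kinc UNIV k R y"
    unfolding kinc_def
  proof (intro allI impI)
    fix K :: "nat set" assume K: "card K = k"
    have fin: "finite K" using K kinc_pos[OF c(3)] card.infinite by fastforce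
    have "{n. joint R K (\<lambda>l. c n l)} = {}"
      using c(3) K unfolding kinc_def by blast
    then have "{n. joint R K (\<lambda>l. c n l)} \<notin> \<U>" using ultra_nonempty[OF u(1)] by metis
    then show "\<not> joint R K y"
      using zforces[OF defn_joint_rows[OF R fin subset_UNIV MN]] by (simp add: y_def[abs_def])
  qed
  \<comment> \<open>Kim's lemma is stated for sets listed by themselves, but \<open>y 0\<close> may
    repeat elements. So \<open>X\<close> is its range, and \<open>i\<close> chooses one coordinate
    for each element.\<close>
  define X where "X = y 0 ` V"
  define i where "i x = (SOME v. v \<in> V \<and> y 0 v = x)" for x
  have i: "i x \<in> V" "y 0 (i x) = x" if "x \<in> X" for x
  proof -
    have "\<exists>v. v \<in> V \<and> y 0 v = x" using that unfolding X_def by blast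
    from someI_ex[OF this] show "i x \<in> V" "y 0 (i x) = x" by (simp_all add: i_def)
  qed
  have yX: "y 0 v \<in> X" if "v \<in> V" for v using that by (simp add: X_def)
  have X: "X \<subseteq> U" "small \<kappa> X" using ty[of 0] V small_image by (auto simp: X_def)
  define m' where "m' n x = m n (i x)" for n x
  have tm': "tup (m' n)" for n unfolding m'_def using m(1)[of n] by (intro tupI) blast
  have m'N: "m' n ` X \<subseteq> ?N" for n using m(2)[of n] i(1) by (auto simp: m'_def)
  let ?q = "limt \<U> X m'"
  have q: "inv_type L \<MM> ?N X ?q" by (rule limt_inv_type[OF u(1) tm' m'N NU])
  then have gq: "global_type L \<MM> X ?q" by (simp add: inv_type_def)
  have qid: "realizing ?q X ?N (self X)"
    unfolding realizing_def
  proof (intro allI impI)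
    fix T assume T: "defn X ?N T"
    have "defn V ?N (\<lambda>e. T (\<lambda>x. e (i x)))" by (rule defn_subst[OF T]) (use i(1) in auto)
    from ylim[OF this, of 0] have "T (\<lambda>x. y 0 (i x)) \<longleftrightarrow> {n. T (m' n)} \<in> \<U>" by (simp add: m'_def[abs_def])
    moreover have "T (\<lambda>x. y 0 (i x)) = T (self X)"
      by (rule defn_local[OF T _ tup_tot_id[OF X(1)]]) (use ty[of 0] i in \<open>auto intro!: tupI\<close>)
    ultimately show "T (self X) = forces ?q T"
      using forces_limt[where c = m', OF u(1) tm' defn_mono[OF T order_refl NU]] by simp
  qed
  define R' where "R' x w = R x (\<lambda>v. if v \<in> V then w (y 0 v) else pt)" for x and w :: "'m \<Rightarrow> 'm"
  have "defn (UNIV <+> X) ?N (\<lambda>e. (\<lambda>e. R (\<lambda>v. e (Inl v)) (\<lambda>w. e (Inr w)))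
      (\<lambda>n. (\<lambda>n e. case n of Inl v \<Rightarrow> e (Inl v) | Inr v \<Rightarrow> if v \<in> V then e (Inr (y 0 v)) else pt) n e))"
    by (rule defn_subst[OF R[unfolded defn2_def] MN]) (use yX in \<open>auto split: sum.split\<close>)
  then have R': "defn2 UNIV X ?N R'" by (simp add: defn2_def R'_def)
  have tR': "tup (\<lambda>v. if v \<in> V then w (y 0 v) else pt)" if "tup w" for w using that by (intro tupI) auto
  have "kdiv k ?N X R' (self X)"
  proof -
    have t: "tup (\<lambda>x. y l (i x))" for l using ty[of l] by (intro tupI) blast
    have "eqtp X ?N (\<lambda>x. y l (i x)) (self X)" for l
    proof (rule eqtp_trans[OF eqtp_subst[OF yeq[of l]]])
      show "eqtp X ?N (\<lambda>x. y 0 (i x)) (self X)"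
        by (rule eqtp_agree[OF t tup_tot_id[OF X(1)]]) (use i in auto)
    qed (rule i(1))
    moreover have R'y: "R' x (\<lambda>x. y l (i x)) = R x (y l)" if x: "tup x" for x l
      unfolding R'_def
    proof (rule defn2_local[OF R x tR'[OF t] x ty])
      fix v assume v: "v \<in> V"
      have "y 0 (i (y 0 v)) = y 0 v" "i (y 0 v) \<in> V" using i yX[OF v] by auto
      then have "y l (i (y 0 v)) = y l v" using eqtpD[OF yeq[of l] defn_eq[of "i (y 0 v)" V v]] v by blast
      then show "(if v \<in> V then y l (i (y 0 v)) else pt) = y l v" using v by simp
    qed simp
    have "joint R' K (\<lambda>l x. y l (i x)) = joint R K y" for K
      using R'y by (intro ex_cong1 conj_cong refl) simp
    then have "kinc UNIV k R' (\<lambda>l x. y l (i x))" using ykinc unfolding kinc_def by simp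
    ultimately show ?thesis unfolding kdiv_def using t by (intro exI[of _ "\<lambda>l x. y l (i x)"]) blast
  qed
  moreover obtain d where d: "morley ?q X ?N d" using morley_exists[OF gq X(2) N(4) NU] by blast
  ultimately obtain n where n: "kinc UNIV n R' d"
    using kdiv_all_morley[OF nTP2 sw model X R' _ q qid] by blast
  obtain W A0 where W: "finite W" "W \<subseteq> UNIV <+> V" "finite A0" "A0 \<subseteq> M"
    "defn W A0 (\<lambda>e. R (\<lambda>v. e (Inl v)) (\<lambda>w. e (Inr w)))"
    by (rule defn_finite[OF R[unfolded defn2_def]])
  define V0 where "V0 = Inr -` W"
  have V0: "finite V0" "V0 \<subseteq> V" using W(1,2) by (auto simp: V0_def intro!: finite_vimageI)
  have "W \<subseteq> UNIV <+> V0"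
  proof
    fix x assume "x \<in> W" then show "x \<in> UNIV <+> V0" by (cases x rule: sum.exhaust) (auto simp: V0_def)
  qed
  then have RV0: "defn2 UNIV V0 M R" unfolding defn2_def by (rule defn_mono[OF W(5) _ W(4)])
  \<comment> \<open>Replacing the coordinate \<open>v\<close> by its representative
    \<open>i (y 0 v)\<close> is harmless at \<open>m j\<close> for almost all \<open>j\<close>. Only
    finitely many coordinates \<open>V0\<close> matter for \<open>R\<close>, so one large set of
    indices serves all of them, and reflection is carried out inside it.\<close>
  define A where "A = {j. \<forall>v\<in>V0. m j (i (y 0 v)) = m j v}"
  have "A \<in> \<U>"
    unfolding A_def
  proof (rule ultra_ball[OF u(1) V0(1)])
    fix v assume "v \<in> V0"
    then have v: "v \<in> V" using V0 by blast
    show "{j. m j (i (y 0 v)) = m j v} \<in> \<U>"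
      using ylim[OF defn_eq[of "i (y 0 v)" V v], of 0] i yX[OF v] v by simp
  qed
  then have A: "A \<in> \<U>" .
  have "\<not> joint R' {..<n} d"
    using n unfolding kinc_def by (metis card_lessThan subset_UNIV)
  then have Qd: "(\<lambda>e. \<not> joint R' {..<n} (\<lambda>l v. e (l, v))) (\<lambda>(l, v). d l v)" by simp
  from limt_morley_reflect[OF u tm' m'N NU d
      defn_not[OF defn_joint_rows[OF R' finite_lessThan order_refl order_refl]] Qd A]
  obtain \<nu> where \<nu>: "\<nu> ` {..<n} \<subseteq> A" "\<not> joint R' {..<n} (\<lambda>l. m' (\<nu> l))"
    by auto
  obtain b where b: "\<nu> ` {..<n} \<subseteq> {..<b}" using finite_nat_set_iff_bounded[of "\<nu> ` {..<n}"] by auto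
  obtain x where x: "tup x" "\<forall>j<b. R x (m j)" using m(4) by blast
  have "R' x (m' (\<nu> l))" if "l \<in> {..<n}" for l
  proof -
    have "\<nu> l \<in> A" "\<nu> l < b" using \<nu>(1) b that by auto
    have "R' x (m' (\<nu> l)) = R x (m (\<nu> l))"
      unfolding R'_def
      by (rule defn2_local[OF RV0 x(1) tR'[OF tm'] x(1) m(1)])
        (use \<open>\<nu> l \<in> A\<close> V0(2) in \<open>auto simp: A_def m'_def\<close>)
    then show ?thesis using x(2) \<open>\<nu> l < b\<close> by simp
  qed
  then show False using \<nu>(2) x(1) by blast
qed

section \<open>Symmetry of independence\<close>

lemma dividing_indep_tot:
  "dividing_indep L \<MM> M I (tot I a) J (tot J b) \<longleftrightarrow> dividing_indep L \<MM> M I a J b"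
proof -
  have im: "tot J b ` J = b ` J" by auto
  have tp: "tp L \<MM> I (tot I a) A = tp L \<MM> I a A" for A by (rule tp_cong) simp
  have inst: "inst_over (tot J b) \<phi> = inst_over b \<phi>" if "\<phi> \<in> fms L I (J <+> M)" for \<phi>
    by (rule inst_over_cong[OF that]) simp
  have 0: "(\<forall>j\<in>J. c 0 j = tot J b j) \<longleftrightarrow> (\<forall>j\<in>J. c 0 j = b j)" for c :: "nat \<Rightarrow> _" by simp
  show ?thesis
    unfolding dividing_indep_def im tp 0 using inst by (metis (no_types, lifting))
qed

lemma dividing_indep_sym:
  fixes a :: "'i \<Rightarrow> 'm" and b :: "'j \<Rightarrow> 'm"
  assumes nTP2: "\<not> TP2 L \<MM>" and sw: "strong_witnessing L \<kappa> \<MM>" and M: "small_model L \<kappa> \<MM> M"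
    and I: "small \<kappa> I" "a ` I \<subseteq> U" and J: "small \<kappa> J" "b ` J \<subseteq> U"
    and d: "dividing_indep L \<MM> M I a J b"
  shows "dividing_indep L \<MM> M J b I a"
proof (rule ccontr)
  assume nd: "\<not> dividing_indep L \<MM> M J b I a"
  have MU: "M \<subseteq> U" and sM: "small \<kappa> M" using M by (auto simp: small_model_def elem_sub_def)
  let ?a = "tot I a" and ?b = "tot J b"
  have ta: "tup ?a" and tb: "tup ?b" using I(2) J(2) by (simp_all add: tup_tot)
  have "indep M I ?a (?b ` J)"
    by (rule indep_of_dividing_indep[OF MU sM ta tb J(1)]) (simp only: dividing_indep_tot d)
  moreover have "\<not> dividing_indep L \<MM> M J ?b I ?a" by (simp only: dividing_indep_tot nd simp_thms)
  then obtain R k where R: "defn2 J I M R" "R ?b ?a" "kdiv k M I R ?a"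
    by (rule kdiv_of_not_dividing_indep[OF MU ta tb])
  ultimately have chain: "\<exists>es. length es = n \<and> (\<forall>e\<in>set es. tup e \<and> R ?b e) \<and>
      (\<forall>i<n. kdiv k (M \<union> (\<Union>e\<in>set (take i es). e ` I)) I R (es ! i))" for n
    using dividing_chain_exists[OF nTP2 sw M ta I(1) tb J(1) _ R] by blast
  have "dtree k R n []" for n
  proof -
    obtain es where es: "length es = n" "\<And>e. e \<in> set es \<Longrightarrow> tup e \<and> R ?b e"
      "\<And>i. i < n \<Longrightarrow> kdiv k (M \<union> (\<Union>e\<in>set (take i es). e ` I)) I R (es ! i)" using chain[of n] by blast
    from dtree_of_chain[OF MU sM I(1) R(1) tb es, of n] show ?thesis by simp
  qed
  then obtain N m where Nm: "\<And>n :: nat. tarski_vaught (N n)" "\<And>n. N n \<subseteq> N (Suc n)" "M \<subseteq> N 0"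
    "small \<kappa> (\<Union>n. N n)" "\<And>n. tup (m n)" "\<And>n. m n ` I \<subseteq> N (Suc n)" "\<And>n. kdiv k (N n) I R (m n)"
    "\<And>n. \<exists>x. tup x \<and> (\<forall>i<n. R x (m i))"
    using dividing_chain_of_models[OF MU sM I(1) R(1)] by blast
  have "defn2 UNIV I M R" by (rule defn2_mono[OF R(1)]) auto
  from no_dividing_chain[OF nTP2 sw I(1) this Nm] show False .
qed

end

theorem theorem3p19:
  fixes L :: "('f, 'r) language"
    and T :: "('f, 'r, nat) fm set"
    and \<kappa> :: "'k rel"
    and \<MM> :: "('f, 'r, 'm) struct"
  assumes "complete_theory L T"
    and "monster_model L T \<kappa> \<MM>"
    and "strong_witnessing L \<kappa> \<MM>"
  shows "TP2 L \<MM> \<or> simple L \<kappa> \<MM>"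
proof -
  interpret monster L \<MM> \<kappa>
    using assms(2) by unfold_locales (simp_all add: monster_model_def is_model_def)
  show ?thesis
  proof (cases "TP2 L \<MM>")
    case False
    have "simple L \<kappa> \<MM>"
      unfolding simple_def
    proof (intro allI impI, elim conjE)
      fix M a b and I J :: "'k set"
      assume "small_model L \<kappa> \<MM> M" "small \<kappa> I" "a ` I \<subseteq> univ \<MM>" "small \<kappa> J" "b ` J \<subseteq> univ \<MM>"
        "dividing_indep L \<MM> M I a J b"
      then show "dividing_indep L \<MM> M J b I a" by (rule dividing_indep_sym[OF False assms(3)])
    qed
    then show ?thesis ..
  qed simp
qed

end
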